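(* Let $n\geq3$, $K_0\in\mathbb{N}=\{0,1,2,\ldots\}$ and $q\in\big[\frac{2K_{0}-1}{n-1}+1,\frac{2K_{0}}{n-1}+1\big]\cap[1,\infty)$. (1) For any $x\in\mathbb{B}^{n}\setminus\{0\}$, any $l\in\mathbb{S}^{n-1}$ and any unit vector $t_{x}\in\mathbb{R}^{n}$ with $\langle t_{x},\frac{x}{|x|}\rangle=0$, $$\mathbf{C}_{\mathbb{B}^{n},q}(x;t_{x})\leq\mathbf{C}_{\mathbb{B}^{n},q}(x;l)\leq\mathbf{C}_{\mathbb{B}^{n},q}\big(x;\pm\tfrac{x}{|x|}\big)=\mathbf{C}_{\mathbb{B}^{n},q}(x).$$ (2) For any $x\in\mathbb{H}^{n}$, any $l\in\mathbb{S}^{n-1}$ and any unit vector $t_{e_n}\in\mathbb{R}^{n}$ with $\langle t_{e_n},e_n\rangle=0$, $$\mathbf{C}_{\mathbb{H}^{n},q}(x;t_{e_{n}})\leq\mathbf{C}_{\mathbb{H}^{n},q}(x;l)\leq\mathbf{C}_{\mathbb{H}^{n},q}(x;\pm e_{n})=\mathbf{C}_{\mathbb{H}^{n},q}(x).$$ Here $\pm$ means the statement holds for both choices of sign.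
   Context: $\langle\cdot,\cdot\rangle$ and $|\cdot|$ are the Euclidean inner product and norm on $\mathbb{R}^n$; $\mathbb{B}^n=\{|x|<1\}$, $\mathbb{S}^{n-1}=\{|x|=1\}$, $\mathbb{H}^n=\{x=(x',x_n): x'\in\mathbb{R}^{n-1},\,x_n>0\}$, $e_n=(0,\ldots,0,1)$; $\partial\mathbb{H}^n$ is identified with $\mathbb{R}^{n-1}$. $\sigma$ is the surface measure on $\mathbb{S}^{n-1}$ normalized so that $\sigma(\mathbb{S}^{n-1})=1$, and $V_{n-1}$ is Lebesgue measure on $\mathbb{R}^{n-1}$. $L^p(\mathbb{S}^{n-1},\mathbb{R})$ and $L^p(\mathbb{R}^{n-1},\mathbb{R})$ are taken with respect to $\sigma$ and $V_{n-1}$ respectively. For $\phi\in L^p(\mathbb{S}^{n-1},\mathbb{R})$, $p\in[1,\infty]$, the Poisson–Szegő integral (for the hyperbolic Laplacian) is $$\mathcal{P}_{\mathbb{B}^n}[\phi](x)=\int_{\mathbb{S}^{n-1}}\Big(\frac{1-|x|^2}{|x-\zeta|^2}\Big)^{n-1}\phi(\zeta)\,d\sigma(\zeta),\quad x\in\mathbb{B}^n.$$ For $\phi\in L^p(\mathbb{R}^{n-1},\mathbb{R})$, $$\mathcal{P}_{\mathbb{H}^n}[\phi](x)=c_n\int_{\mathbb{R}^{n-1}}\Big(\frac{x_n}{|x'-y'|^2+x_n^2}\Big)^{n-1}\phi(y')\,dV_{n-1}(y'),\quad x\in\mathbb{H}^n,\qquad c_n=\frac{2^{n-2}\Gamma(n/2)}{\pi^{n/2}}.$$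 Let $\Omega=\mathbb{B}^n$ or $\mathbb{H}^n$, $q\in[1,\infty]$ and $p$ its conjugate exponent ($1/p+1/q=1$, $1/\infty=0$). For $x\in\Omega$ and $l\in\mathbb{S}^{n-1}$, $\mathbf{C}_{\Omega,q}(x)$ and $\mathbf{C}_{\Omega,q}(x;l)$ denote the smallest constants such that $$|\nabla u(x)|\leq \mathbf{C}_{\Omega,q}(x)\|\phi\|_{L^p(\partial\Omega,\mathbb{R})},\qquad |\langle\nabla u(x),l\rangle|\leq \mathbf{C}_{\Omega,q}(x;l)\|\phi\|_{L^p(\partial\Omega,\mathbb{R})}$$ hold for all $\phi\in L^p(\partial\Omega,\mathbb{R})$ with $u=\mathcal{P}_\Omega[\phi]$. *)

theory Defs
  imports "HOL-Probability.Essential_Supremum"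
begin

section \<open>Lebesgue spaces\<close>

definition Lp_space :: "ennreal \<Rightarrow> 'b measure \<Rightarrow> ('b \<Rightarrow> real) set" where
  "Lp_space p M = {f \<in> borel_measurable M.
     if p = \<infinity> then esssup M (\<lambda>y. ennreal \<bar>f y\<bar>) < \<infinity>
     else integrable M (\<lambda>y. \<bar>f y\<bar> powr enn2real p)}"

definition Lp_norm :: "ennreal \<Rightarrow> 'b measure \<Rightarrow> ('b \<Rightarrow> real) \<Rightarrow> real" where
  "Lp_norm p M f =
     (if p = \<infinity> then enn2real (esssup M (\<lambda>y. ennreal \<bar>f y\<bar>))
      else (\<integral>y. \<bar>f y\<bar> powr enn2real p \<partial>M) powr (1 / enn2real p))"

definition conjugate_exponent :: "ennreal \<Rightarrow> ennreal" where
  "conjugate_exponent q = inverse (1 - inverse q)"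

lemma conjugate_exponent_iff:
  assumes "1 \<le> q"
  shows "inverse p + inverse q = 1 \<longleftrightarrow> p = conjugate_exponent q"
proof -
  have le: "inverse q \<le> 1"
  proof (cases q)
    case (real r)
    then have "1 \<le> r" using assms by (simp flip: ennreal_1)
    with real show ?thesis by (simp add: inverse_ennreal inverse_le_1_iff flip: ennreal_1)
  qed simp
  have inv: "inverse (inverse r) = r" for r :: ennreal
  proof (cases r)
    case (real s)
    then show ?thesis by (cases "s = 0") (simp_all add: inverse_ennreal)
  qed simp
  have "inverse q \<noteq> top" using le by (auto simp: top_unique)
  then have "inverse p + inverse q = 1 \<longleftrightarrow> inverse p = 1 - inverse q"
    using le by (metis diff_add_cancel_ennreal ennreal_add_diff_cancel_right)
  also have "\<dots> \<longleftrightarrow> p = conjugate_exponent q"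
    unfolding conjugate_exponent_def using inv by metis
  finally show ?thesis .
qed


section \<open>The normalized surface measure on the unit sphere\<close>

text \<open>The surface measure of a Borel set \<open>A\<close> on the unit sphere is, up to the dimensional
  factor removed by the normalization, the volume of the cone \<open>{r \<zeta> | 0 < r < 1, \<zeta> \<in> A}\<close>.
  Equivalently it is the image of the uniform distribution on the unit ball under the radial
  projection \<open>sgn x = x / |x|\<close>, which is defined off the origin.\<close>

definition sphere_borel_measure :: "'a::euclidean_space measure" where
  "sphere_borel_measure =
     distr (restrict_space (uniform_measure lborel (ball 0 1)) (- {0}))
       (restrict_space borel (sphere 0 1)) sgn"

definition sphere_measure :: "'a::euclidean_space measure" where
  "sphere_measure = completion sphere_borel_measure"

lemma emeasure_sphere_borel_measure:
  fixes A :: "'a::euclidean_space set"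
  assumes "A \<in> sets borel" "A \<subseteq> sphere 0 1"
  shows "emeasure sphere_borel_measure A =
    emeasure lborel {r *\<^sub>R \<zeta> | r \<zeta>. 0 < r \<and> r < 1 \<and> \<zeta> \<in> A} / emeasure lborel (ball (0::'a) 1)"
proof -
  let ?U = "uniform_measure lborel (ball (0::'a) 1)"
  have s0: "- {0} \<in> sets (borel :: 'a measure)" by simp
  have sgn_b: "sgn \<in> borel_measurable (borel :: 'a measure)"
    unfolding sgn_div_norm by measurable
  have m: "sgn \<in> restrict_space ?U (- {0}) \<rightarrow>\<^sub>M restrict_space borel (sphere (0::'a) 1)"
    by (rule measurable_restrict_space2)
      (auto simp: space_restrict_space norm_sgn intro!: measurable_restrict_space1 sgn_b)
  have A: "A \<in> sets (restrict_space borel (sphere (0::'a) 1))"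
    using assms by (auto simp: sets_restrict_space_iff)
  have sets_vim: "sgn -` A \<inter> - {0} \<in> sets borel"
    using measurable_sets[OF sgn_b assms(1)] s0 by auto
  have cone: "ball 0 1 \<inter> (sgn -` A \<inter> - {0}) = {r *\<^sub>R \<zeta> | r \<zeta>. 0 < r \<and> r < 1 \<and> \<zeta> \<in> A}"
    (is "?L = ?R")
  proof (intro equalityI subsetI)
    fix x assume x: "x \<in> ?L"
    then have "x = norm x *\<^sub>R sgn x" by (simp add: sgn_div_norm)
    then show "x \<in> ?R" using x by fastforce
  next
    fix x assume "x \<in> ?R"
    then obtain r \<zeta> where *: "x = r *\<^sub>R \<zeta>" "0 < r" "r < 1" "\<zeta> \<in> A" by auto
    moreover from * have n: "norm \<zeta> = 1" using assms(2) by auto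
    moreover from n have "\<zeta> \<noteq> 0" by auto
    ultimately show "x \<in> ?L" by (auto simp: sgn_scaleR sgn_div_norm)
  qed
  have "emeasure sphere_borel_measure A = emeasure (restrict_space ?U (- {0})) (sgn -` A \<inter> - {0})"
    unfolding sphere_borel_measure_def using m A
    by (subst emeasure_distr) (auto simp: space_restrict_space)
  also have "\<dots> = emeasure ?U (sgn -` A \<inter> - {0})"
    by (rule emeasure_restrict_space) auto
  also have "\<dots> = emeasure lborel (ball 0 1 \<inter> (sgn -` A \<inter> - {0})) / emeasure lborel (ball (0::'a) 1)"
    using sets_vim by (subst emeasure_uniform_measure) auto
  finally show ?thesis by (simp only: cone)
qed


section \<open>Poisson-Szego integrals\<close>

definition poisson_ball :: "('a::euclidean_space \<Rightarrow> real) \<Rightarrow> 'a \<Rightarrow> real" where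
  "poisson_ball \<phi> x =
     (\<integral>\<zeta>. ((1 - (norm x)\<^sup>2) / (norm (x - \<zeta>))\<^sup>2) ^ (DIM('a) - 1) * \<phi> \<zeta> \<partial>sphere_measure)"

text \<open>The \<open>n\<close>-dimensional space containing the half-space is the product \<open>'a \<times> real\<close> with
  \<open>DIM('a) = n - 1\<close>, so that \<open>x = (x', x\<^sub>n)\<close> literally; its inner product is the Euclidean one.\<close>

definition half_space :: "('a::euclidean_space \<times> real) set" where
  "half_space = {x. 0 < snd x}"

definition poisson_const :: "nat \<Rightarrow> real" where
  "poisson_const n = 2 ^ (n - 2) * Gamma (real n / 2) / pi powr (real n / 2)"

definition poisson_half_space :: "('a::euclidean_space \<Rightarrow> real) \<Rightarrow> 'a \<times> real \<Rightarrow> real" where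
  "poisson_half_space \<phi> x =
     poisson_const DIM('a \<times> real) *
     (\<integral>y. (snd x / ((norm (fst x - y))\<^sup>2 + (snd x)\<^sup>2)) ^ (DIM('a \<times> real) - 1) * \<phi> y \<partial>lebesgue)"


section \<open>Sharp constants in gradient estimates\<close>

definition grad :: "('a::euclidean_space \<Rightarrow> real) \<Rightarrow> 'a \<Rightarrow> 'a" where
  "grad u x = (THE D. GDERIV u x :> D)"

lemma grad_eqI:
  assumes "GDERIV u x :> D"
  shows "grad u x = D"
proof -
  have "D' = D" if "GDERIV u x :> D'" for D'
    using has_derivative_unique[OF that[unfolded gderiv_def] assms[unfolded gderiv_def]]
    by (metis inner_commute vector_eq_rdot)
  with assms show ?thesis unfolding grad_def by blast
qed

text \<open>Here \<open>M\<close> is the measure on the boundary and \<open>P\<close> the integral operator that sends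
  boundary data to functions on the domain.\<close>

definition sharp_const ::
  "'b measure \<Rightarrow> (('b \<Rightarrow> real) \<Rightarrow> 'a::euclidean_space \<Rightarrow> real) \<Rightarrow> ennreal \<Rightarrow> 'a \<Rightarrow> real" where
  "sharp_const M P q x =
     (LEAST C. \<forall>\<phi>\<in>Lp_space (conjugate_exponent q) M.
        norm (grad (P \<phi>) x) \<le> C * Lp_norm (conjugate_exponent q) M \<phi>)"

definition sharp_const_dir ::
  "'b measure \<Rightarrow> (('b \<Rightarrow> real) \<Rightarrow> 'a::euclidean_space \<Rightarrow> real) \<Rightarrow> ennreal \<Rightarrow> 'a \<Rightarrow> 'a \<Rightarrow> real" where
  "sharp_const_dir M P q x l =
     (LEAST C. \<forall>\<phi>\<in>Lp_space (conjugate_exponent q) M.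
        \<bar>grad (P \<phi>) x \<bullet> l\<bar> \<le> C * Lp_norm (conjugate_exponent q) M \<phi>)"

definition C_ball :: "ennreal \<Rightarrow> 'a::euclidean_space \<Rightarrow> real" where
  "C_ball = sharp_const sphere_measure poisson_ball"

definition C_ball_dir :: "ennreal \<Rightarrow> 'a::euclidean_space \<Rightarrow> 'a \<Rightarrow> real" where
  "C_ball_dir = sharp_const_dir sphere_measure poisson_ball"

definition C_half_space :: "ennreal \<Rightarrow> 'a::euclidean_space \<times> real \<Rightarrow> real" where
  "C_half_space = sharp_const lebesgue poisson_half_space"

definition C_half_space_dir :: "ennreal \<Rightarrow> 'a::euclidean_space \<times> real \<Rightarrow> 'a \<times> real \<Rightarrow> real" where
  "C_half_space_dir = sharp_const_dir lebesgue poisson_half_space"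

end

theory Submission
  imports Defs "HOL-Probability.Probability_Measure" "HOL-Real_Asymp.Real_Asymp"
begin

text \<open>At every boundary point the gradient of the kernel is a constant times \<open>P ^ m\<close> times a unit vector
  \<open>\<omega>\<close>, where \<open>P\<close> is the Poisson kernel and \<open>m = n - 1\<close>, and \<open>\<omega>\<close> carries the measure \<open>P ^ m\<close> to the
  uniform measure on the sphere. By duality the sharp constant in direction \<open>l\<close> is an \<open>L\<^sup>q\<close> norm, so up
  to a factor its \<open>q\<close>-th power is the integral over the sphere of
  \<open>(\<gamma> + \<sigma> * (\<omega> \<bullet> e)) powr a * \<bar>\<omega> \<bullet> l\<bar> powr q\<close> with \<open>a = m * (q - 1)\<close>, where \<open>e\<close> is the
  distinguished direction. The hypothesis on \<open>q\<close> gives \<open>a = 0\<close> or \<open>a \<ge> 1\<close>, and then the even part of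
  the first factor increases with \<open>\<bar>\<omega> \<bullet> e\<bar>\<close>. Reflections that swap \<open>l\<close> with \<open>e\<close>, or with a vector
  orthogonal to \<open>e\<close>, now compare the integrals pointwise.\<close>

section \<open>Changes of variables for Lebesgue measure\<close>

text \<open>The difficulty is that both length and direction of the gradient kernel vary along the
  boundary. For the ball, the map from \<open>y\<close> to \<open>\<omega>\<close> is a Moebius map
  of the sphere, that is, a Lorentz boost acting on the rays of the light cone; for the half-space
  it is inverse stereographic projection. In both cases the Jacobian is a multiple of
  \<open>P ^ m\<close>, and \<open>P\<close> is an affine function of
  \<open>\<omega> \<bullet> e\<close>, so the point \<open>x\<close> survives only in a few
  constants.

  Since the sphere measure is the radial image of the unit ball, maps of the sphere are handled as
  maps of the whole space acting on functions constant on rays. Boosts and stereographic projection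
  then both come from one substitution in null coordinates along a line.

  Exponents \<open>0 < a < 1\<close> must be kept out: there the power is concave, the even part
  decreases with \<open>\<bar>\<omega> \<bullet> e\<bar>\<close>, and the pointwise comparison turns
  around.\<close>

lemma nn_integral_lborel_scale:
  fixes f :: "'a::euclidean_space \<Rightarrow> ennreal"
  assumes [measurable]: "f \<in> borel_measurable borel" and c: "c \<noteq> 0"
  shows "(\<integral>\<^sup>+x. f x \<partial>lborel) = ennreal (\<bar>c\<bar> ^ DIM('a)) * (\<integral>\<^sup>+x. f (t + c *\<^sub>R x) \<partial>lborel)"
  by (subst lborel_affine[OF c, of t])
    (simp add: nn_integral_density nn_integral_distr nn_integral_cmult)

lemma nn_integral_lborel_translate:
  fixes f :: "'a::euclidean_space \<Rightarrow> ennreal"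
  assumes "f \<in> borel_measurable borel"
  shows "(\<integral>\<^sup>+x. f (t + x) \<partial>lborel) = (\<integral>\<^sup>+x. f x \<partial>lborel)"
  using nn_integral_lborel_scale[OF assms, of 1 t] by simp

lemma emeasure_unit_ball:
  "emeasure lborel (ball (0::'a::euclidean_space) 1) \<noteq> 0"
  "emeasure lborel (ball (0::'a::euclidean_space) 1) \<noteq> top"
proof -
  show "emeasure lborel (ball (0::'a) 1) \<noteq> top"
    using emeasure_lborel_ball_finite[of "0::'a" 1] by (simp add: less_top)
  show "emeasure lborel (ball (0::'a) 1) \<noteq> 0"
    using content_ball_pos[of 1 "0::'a"] by (auto simp: measure_def)
qed

text \<open>The image of Lebesgue measure under a linear isometry is again translation invariant; the
  usual Fubini argument for the uniqueness of Haar measure makes it a multiple of Lebesgue measure,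
  and the unit ball, which is mapped to itself, shows that the factor is one.\<close>

lemma nn_integral_lborel_involutive_isometry:
  fixes g :: "'a::euclidean_space \<Rightarrow> ennreal"
  assumes [measurable]: "g \<in> borel_measurable borel"
    and lin: "linear R" and inv: "\<And>x. R (R x) = x" and nrm: "\<And>x. norm (R x) = norm x"
  shows "(\<integral>\<^sup>+x. g (R x) \<partial>lborel) = (\<integral>\<^sup>+x. g x \<partial>lborel)"
proof -
  have [measurable]: "R \<in> borel_measurable borel"
    using lin by (simp add: borel_measurable_continuous_onI linear_continuous_on linear_conv_bounded_linear)
  let ?V = "emeasure lborel (ball (0::'a) 1)"
  define b :: "'a \<Rightarrow> ennreal" where "b = indicator (ball 0 1)"
  have [measurable]: "b \<in> borel_measurable borel"
    unfolding b_def by (intro borel_measurable_indicator) simp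
  have V: "(\<integral>\<^sup>+x. b x \<partial>lborel) = ?V" by (simp add: b_def)
  have add: "R (x + y) = R x + R y" for x y using lin by (simp add: linear_add)
  have "?V * (\<integral>\<^sup>+x. g (R x) \<partial>lborel) = (\<integral>\<^sup>+x. b x * (\<integral>\<^sup>+y. g (R y) \<partial>lborel) \<partial>lborel)"
    by (simp add: nn_integral_multc V)
  also have "\<dots> = (\<integral>\<^sup>+x. \<integral>\<^sup>+y. b x * g (x + R y) \<partial>lborel \<partial>lborel)"
  proof (rule nn_integral_cong)
    fix x
    have "(\<integral>\<^sup>+y. g (R y) \<partial>lborel) = (\<integral>\<^sup>+y. g (R (R x + y)) \<partial>lborel)"
      by (subst nn_integral_lborel_translate[of "\<lambda>y. g (R y)"]) simp_all
    then show "b x * (\<integral>\<^sup>+y. g (R y) \<partial>lborel) = (\<integral>\<^sup>+y. b x * g (x + R y) \<partial>lborel)"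
      by (simp add: add inv nn_integral_cmult)
  qed
  also have "\<dots> = (\<integral>\<^sup>+y. \<integral>\<^sup>+x. b x * g (x + R y) \<partial>lborel \<partial>lborel)"
    by (rule lborel_pair.Fubini') measurable
  also have "\<dots> = (\<integral>\<^sup>+y. \<integral>\<^sup>+x. b (x - R y) * g x \<partial>lborel \<partial>lborel)"
  proof (rule nn_integral_cong)
    fix y
    show "(\<integral>\<^sup>+x. b x * g (x + R y) \<partial>lborel) = (\<integral>\<^sup>+x. b (x - R y) * g x \<partial>lborel)"
      by (subst nn_integral_lborel_translate[of "\<lambda>x. b (x - R y) * g x" "R y", symmetric])
        (simp_all add: add.commute)
  qed
  also have "\<dots> = (\<integral>\<^sup>+x. \<integral>\<^sup>+y. b (x - R y) * g x \<partial>lborel \<partial>lborel)"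
    by (rule lborel_pair.Fubini') measurable
  also have "\<dots> = (\<integral>\<^sup>+x. ?V * g x \<partial>lborel)"
  proof (rule nn_integral_cong)
    fix x
    \<comment> \<open>Shifting \<open>y\<close> by \<open>R x\<close> leaves
      \<open>b (- R y)\<close>, and the unit ball is invariant under \<open>R\<close> and under
      negation.\<close>
    have "(\<integral>\<^sup>+y. b (x - R y) \<partial>lborel) = (\<integral>\<^sup>+y. b (x - R (R x + y)) \<partial>lborel)"
      by (subst nn_integral_lborel_translate[of "\<lambda>y. b (x - R y)"]) simp_all
    also have "\<dots> = ?V"
      by (simp add: add inv flip: V) (simp add: b_def indicator_def nrm)
    finally show "(\<integral>\<^sup>+y. b (x - R y) * g x \<partial>lborel) = ?V * g x"
      by (simp add: nn_integral_multc)
  qed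
  also have "\<dots> = ?V * (\<integral>\<^sup>+x. g x \<partial>lborel)" by (simp add: nn_integral_cmult)
  finally show ?thesis
    using emeasure_unit_ball[where 'a='a] by (simp add: ennreal_mult_cancel_left)
qed

section \<open>Reflections in hyperplanes\<close>

definition reflection :: "'a::real_inner \<Rightarrow> 'a \<Rightarrow> 'a" where
  "reflection v z = z - (2 * (z \<bullet> v) / (v \<bullet> v)) *\<^sub>R v"

lemma linear_reflection: "linear (reflection v)"
  by (rule linearI) (auto simp: reflection_def inner_simps algebra_simps add_divide_distrib)

lemma reflection_reflection: "reflection v (reflection v z) = z"
  by (cases "v = 0") (auto simp: reflection_def inner_simps algebra_simps add_divide_distrib diff_divide_distrib)

lemma inner_reflection: "reflection v y \<bullet> z = y \<bullet> reflection v z"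
  by (simp add: reflection_def inner_simps inner_commute)

lemma norm_reflection: "norm (reflection v z) = norm z"
proof -
  have "reflection v z \<bullet> reflection v z = z \<bullet> z"
    by (simp add: inner_reflection reflection_reflection)
  then show ?thesis by (simp add: norm_eq_sqrt_inner)
qed

text \<open>Equal norms make \<open>a + b\<close> orthogonal to \<open>a - b\<close>, so the mirror
  hyperplane bisects the two vectors. For \<open>a = b\<close> the normal vector is 0 and the map is
  the identity.\<close>

lemma reflection_swap:
  assumes "norm a = norm b"
  shows "reflection (a - b) a = b" "reflection (a - b) b = a"
proof -
  have eq: "a \<bullet> a = b \<bullet> b" using assms by (simp add: dot_square_norm)
  show 1: "reflection (a - b) a = b"
  proof (cases "a = b")
    case False
    then have "(a - b) \<bullet> (a - b) \<noteq> 0" by simp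
    moreover have "2 * (a \<bullet> (a - b)) = (a - b) \<bullet> (a - b)"
      using eq by (simp add: inner_simps inner_commute)
    ultimately show ?thesis by (simp add: reflection_def)
  qed (simp add: reflection_def)
  show "reflection (a - b) b = a" using reflection_reflection[of "a - b" a] 1 by simp
qed

lemma reflection_orthogonal: "z \<bullet> v = 0 \<Longrightarrow> reflection v z = z"
  by (simp add: reflection_def)

lemma borel_measurable_reflection[measurable]:
  "reflection v \<in> borel_measurable (borel :: 'a::euclidean_space measure)"
  unfolding reflection_def by measurable

lemma nn_integral_reflection:
  fixes g :: "'a::euclidean_space \<Rightarrow> ennreal"
  assumes "g \<in> borel_measurable borel"
  shows "(\<integral>\<^sup>+x. g (reflection v x) \<partial>lborel) = (\<integral>\<^sup>+x. g x \<partial>lborel)"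
  using assms linear_reflection reflection_reflection norm_reflection
  by (rule nn_integral_lborel_involutive_isometry)

section \<open>One-variable substitutions and Lorentz boosts\<close>

lemma nn_integral_substitution_UNIV:
  fixes f :: "real \<Rightarrow> ennreal"
  assumes [measurable]: "f \<in> borel_measurable borel"
    and deriv: "\<And>x. (g has_real_derivative g' x) (at x)"
    and cont: "continuous_on UNIV g'" and nonneg: "\<And>x. 0 \<le> g' x"
    and top: "filterlim g at_top at_top" and bot: "filterlim g at_bot at_bot"
  shows "(\<integral>\<^sup>+x. f x \<partial>lborel) = (\<integral>\<^sup>+x. f (g x) * ennreal (g' x) \<partial>lborel)"
proof -
  have mono: "g x \<le> g y" if "x \<le> y" for x y
    using that deriv nonneg by (meson DERIV_nonneg_imp_nondecreasing)
  have [measurable]: "g \<in> borel_measurable borel"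
    using deriv by (intro borel_measurable_continuous_onI continuous_at_imp_continuous_on)
      (auto intro: DERIV_isCont)
  have [measurable]: "g' \<in> borel_measurable borel"
    using cont by (rule borel_measurable_continuous_onI)
  \<comment> \<open>The line is exhausted by the images of the intervals from \<open>- k\<close> to
    \<open>k\<close>; the limits of \<open>g\<close> put every \<open>x\<close> into one of them,
    and monotone convergence passes to the limit.\<close>
  have sup1: "(SUP k. f x * indicator {g (- real k)..g (real k)} x) = f x" for x
  proof -
    obtain a where a: "\<And>y. y \<ge> a \<Longrightarrow> g y \<ge> x"
      using top unfolding filterlim_at_top eventually_at_top_linorder by blast
    obtain b where b: "\<And>y. y \<le> b \<Longrightarrow> g y \<le> x"
      using bot unfolding filterlim_at_bot eventually_at_bot_linorder by blast
    obtain k :: nat where "real k \<ge> max a (- b)" using real_arch_simple by blast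
    then have "x \<in> {g (- real k)..g (real k)}" using a[of "real k"] b[of "- real k"] by auto
    then show ?thesis
      by (intro antisym SUP_least SUP_upper2[of k]) (auto split: split_indicator)
  qed
  have sup2: "(SUP k. h x * indicator {- real k..real k} x) = h x" for h :: "real \<Rightarrow> ennreal" and x
  proof -
    obtain k :: nat where "real k \<ge> \<bar>x\<bar>" using real_arch_simple by blast
    then have "x \<in> {- real k..real k}" by auto
    then show ?thesis
      by (intro antisym SUP_least SUP_upper2[of k]) (auto split: split_indicator)
  qed
  have inc1: "incseq (\<lambda>k x. f x * indicator {g (- real k)..g (real k)} x)"
  proof (intro incseq_SucI le_funI)
    fix k x
    have "g (- real (Suc k)) \<le> g (- real k)" "g (real k) \<le> g (real (Suc k))"
      by (intro mono; simp)+
    then show "f x * indicator {g (- real k)..g (real k)} x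
        \<le> f x * indicator {g (- real (Suc k))..g (real (Suc k))} x"
      by (auto split: split_indicator)
  qed
  have inc2: "incseq (\<lambda>k x. f (g x) * ennreal (g' x) * indicator {- real k..real k} x)"
    by (intro incseq_SucI le_funI) (auto split: split_indicator)
  have "(\<integral>\<^sup>+x. f x \<partial>lborel) = (SUP k. \<integral>\<^sup>+x. f x * indicator {g (- real k)..g (real k)} x \<partial>lborel)"
    by (subst nn_integral_monotone_convergence_SUP[OF inc1, symmetric]) (auto simp: sup1)
  also have "\<dots> = (SUP k. \<integral>\<^sup>+x. f (g x) * ennreal (g' x) * indicator {- real k..real k} x \<partial>lborel)"
  proof (rule SUP_cong[OF refl])
    fix k :: nat
    show "(\<integral>\<^sup>+x. f x * indicator {g (- real k)..g (real k)} x \<partial>lborel) =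
        (\<integral>\<^sup>+x. f (g x) * ennreal (g' x) * indicator {- real k..real k} x \<partial>lborel)"
    proof (cases "k = 0")
      \<comment> \<open>The rule for bounded intervals is applied to proper intervals only; at
        \<open>k = 0\<close> both sides integrate over a single point.\<close>
      case True
      have "(\<integral>\<^sup>+x. f x * indicator {g 0} x \<partial>lborel) = 0"
        using AE_lborel_singleton[of "g 0"] by (subst nn_integral_0_iff_AE) auto
      moreover have "(\<integral>\<^sup>+x. f (g x) * ennreal (g' x) * indicator {0} x \<partial>lborel) = 0"
        using AE_lborel_singleton[of "0::real"] by (subst nn_integral_0_iff_AE) auto
      ultimately show ?thesis using True by simp
    next
      case False
      then show ?thesis
        by (intro nn_integral_substitution_aux) (auto intro: deriv nonneg continuous_on_subset[OF cont])
    qed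
  qed
  also have "\<dots> = (\<integral>\<^sup>+x. f (g x) * ennreal (g' x) \<partial>lborel)"
    by (subst nn_integral_monotone_convergence_SUP[OF inc2, symmetric])
      (auto simp: sup2[of "\<lambda>x. f (g x) * ennreal (g' x)"])
  finally show ?thesis .
qed

text \<open>Here \<open>\<tau>\<close> is the logarithm of the null coordinate \<open>sqrt (a + t\<^sup>2) + t\<close>.\<close>

lemma nn_integral_null_coordinate:
  fixes f :: "real \<Rightarrow> ennreal"
  assumes "f \<in> borel_measurable borel" and a: "0 < a"
  shows "(\<integral>\<^sup>+t. f t \<partial>lborel) =
    (\<integral>\<^sup>+\<tau>. f ((exp \<tau> - a * exp (- \<tau>)) / 2) * ennreal ((exp \<tau> + a * exp (- \<tau>)) / 2) \<partial>lborel)"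
proof (rule nn_integral_substitution_UNIV[OF assms(1)])
  show "((\<lambda>\<tau>. (exp \<tau> - a * exp (- \<tau>)) / 2) has_real_derivative (exp \<tau> + a * exp (- \<tau>)) / 2) (at \<tau>)" for \<tau>
    by (auto intro!: derivative_eq_intros)
  show "continuous_on UNIV (\<lambda>\<tau>. (exp \<tau> + a * exp (- \<tau>)) / 2)" by (intro continuous_intros) auto
  show "0 \<le> (exp \<tau> + a * exp (- \<tau>)) / 2" for \<tau> using a by (simp add: add_nonneg_nonneg)
  show "filterlim (\<lambda>\<tau>. (exp \<tau> - a * exp (- \<tau>)) / 2) at_top at_top" using a by real_asymp
  show "filterlim (\<lambda>\<tau>. (exp \<tau> - a * exp (- \<tau>)) / 2) at_bot at_bot" using a by real_asymp
qed

text \<open>In null coordinates a boost is a translation of \<open>\<tau>\<close>, and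
  \<open>dt / sqrt (a + t^2)\<close> is \<open>d\<tau>\<close>, hence invariant. The density is the
  derivative of the boosted coordinate with respect to \<open>t\<close>.\<close>

lemma nn_integral_boost_real:
  fixes f :: "real \<Rightarrow> ennreal"
  assumes [measurable]: "f \<in> borel_measurable borel" and a: "0 < a"
    and g: "0 < \<gamma>" "\<gamma>\<^sup>2 - \<sigma>\<^sup>2 = 1"
  shows "(\<integral>\<^sup>+t. f t \<partial>lborel) =
    (\<integral>\<^sup>+t. f (\<gamma> * t - \<sigma> * sqrt (a + t\<^sup>2)) * ennreal (\<gamma> - \<sigma> * (t / sqrt (a + t\<^sup>2))) \<partial>lborel)"
proof -
  define T where "T \<tau> = (exp \<tau> - a * exp (- \<tau>)) / 2" for \<tau> :: real
  define W where "W \<tau> = (exp \<tau> + a * exp (- \<tau>)) / 2" for \<tau> :: real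
  have [measurable]: "T \<in> borel_measurable borel" "W \<in> borel_measurable borel"
    unfolding T_def W_def by measurable
  have W: "W \<tau> > 0" for \<tau> unfolding W_def using a by (simp add: add_pos_pos)
  have TW: "sqrt (a + (T \<tau>)\<^sup>2) = W \<tau>" for \<tau>
  proof -
    have "exp \<tau> * exp (- \<tau>) = 1" by (simp add: mult_exp_exp)
    then have "a + (T \<tau>)\<^sup>2 = (W \<tau>)\<^sup>2" unfolding T_def W_def by (simp add: power2_eq_square) algebra
    then show ?thesis using W[of \<tau>] by simp
  qed
  have prod: "(\<gamma> + \<sigma>) * (\<gamma> - \<sigma>) = 1" using g by (simp add: power2_eq_square algebra_simps)
  have "\<bar>\<sigma>\<bar>\<^sup>2 < \<gamma>\<^sup>2" using g by simp
  then have "\<bar>\<sigma>\<bar> < \<gamma>" using g by (simp only: power2_less_imp_less less_imp_le)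
  then have pos: "\<gamma> + \<sigma> > 0" by linarith
  \<comment> \<open>The rapidity: \<open>\<gamma> = cosh \<eta>\<close> and
    \<open>\<sigma> = sinh \<eta>\<close>, so the boost subtracts \<open>\<eta>\<close> from
    \<open>\<tau>\<close>.\<close>
  define \<eta> where "\<eta> = ln (\<gamma> + \<sigma>)"
  have e1: "exp \<eta> = \<gamma> + \<sigma>" using pos by (simp add: \<eta>_def)
  have e2: "exp (- \<eta>) = \<gamma> - \<sigma>" using prod pos by (simp add: exp_minus e1 field_simps)
  have ed1: "exp (- \<eta> + \<tau>) = (\<gamma> - \<sigma>) * exp \<tau>" for \<tau> by (simp only: exp_add e2)
  have ed2: "exp (- (- \<eta> + \<tau>)) = (\<gamma> + \<sigma>) * exp (- \<tau>)" for \<tau>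
    by (simp only: minus_add_distrib minus_minus exp_add e1)
  have shT: "T (- \<eta> + \<tau>) = \<gamma> * T \<tau> - \<sigma> * W \<tau>" for \<tau>
    unfolding T_def W_def ed1 ed2 by (simp add: field_simps)
  have shW: "W (- \<eta> + \<tau>) = \<gamma> * W \<tau> - \<sigma> * T \<tau>" for \<tau>
    unfolding T_def W_def ed1 ed2 by (simp add: field_simps)
  have "(\<integral>\<^sup>+t. f (\<gamma> * t - \<sigma> * sqrt (a + t\<^sup>2)) * ennreal (\<gamma> - \<sigma> * (t / sqrt (a + t\<^sup>2))) \<partial>lborel)
      = (\<integral>\<^sup>+\<tau>. f (\<gamma> * T \<tau> - \<sigma> * W \<tau>) * ennreal (\<gamma> - \<sigma> * (T \<tau> / W \<tau>)) * ennreal (W \<tau>) \<partial>lborel)"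
    by (subst nn_integral_null_coordinate[OF _ a]) (simp_all add: T_def[symmetric] W_def[symmetric] TW)
  also have "\<dots> = (\<integral>\<^sup>+\<tau>. f (T (- \<eta> + \<tau>)) * ennreal (W (- \<eta> + \<tau>)) \<partial>lborel)"
  proof (rule nn_integral_cong)
    fix \<tau>
    have "W (- \<eta> + \<tau>) = (\<gamma> - \<sigma> * (T \<tau> / W \<tau>)) * W \<tau>"
      unfolding shW using W[of \<tau>] by (simp add: field_simps)
    then show "f (\<gamma> * T \<tau> - \<sigma> * W \<tau>) * ennreal (\<gamma> - \<sigma> * (T \<tau> / W \<tau>)) * ennreal (W \<tau>) =
        f (T (- \<eta> + \<tau>)) * ennreal (W (- \<eta> + \<tau>))"
      unfolding shT using W[of \<tau>] by (simp only: ennreal_mult'' less_imp_le mult.assoc)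
  qed
  also have "\<dots> = (\<integral>\<^sup>+\<tau>. f (T \<tau>) * ennreal (W \<tau>) \<partial>lborel)"
    by (rule nn_integral_lborel_translate) measurable
  also have "\<dots> = (\<integral>\<^sup>+t. f t \<partial>lborel)"
    by (subst nn_integral_null_coordinate[OF _ a]) (simp_all add: T_def[symmetric] W_def[symmetric])
  finally show ?thesis by simp
qed


lemma nn_integral_lborel_Pair:
  fixes f :: "'a::euclidean_space \<times> 'b::euclidean_space \<Rightarrow> ennreal"
  assumes [measurable]: "f \<in> borel_measurable borel"
  shows "(\<integral>\<^sup>+z. f z \<partial>lborel) = (\<integral>\<^sup>+w. \<integral>\<^sup>+t. f (w, t) \<partial>lborel \<partial>lborel)"
  by (subst lborel_prod[symmetric], subst lborel.nn_integral_fst[symmetric]) (simp_all add: lborel_prod)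

text \<open>The spatial part of the Lorentz boost in direction \<open>e\<close>, applied to the light cone vector
  \<open>(z, norm z)\<close>. On directions it is a Moebius map of the sphere.\<close>

definition boost :: "'a::real_inner \<Rightarrow> real \<Rightarrow> real \<Rightarrow> 'a \<Rightarrow> 'a" where
  "boost e \<gamma> \<sigma> z = z + ((\<gamma> - 1) * (z \<bullet> e) - \<sigma> * norm z) *\<^sub>R e"

lemma borel_measurable_boost[measurable]:
  "boost e \<gamma> \<sigma> \<in> borel_measurable (borel :: 'a::euclidean_space measure)"
  unfolding boost_def by measurable

text \<open>A boost along the last axis fixes \<open>w\<close>, so Tonelli reduces it to the line
  with \<open>a = norm w ^ 2\<close>. Positivity of \<open>a\<close> fails only at
  \<open>w = 0\<close>, a null set.\<close>

lemma nn_integral_boost_vertical: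
  fixes f :: "'a::euclidean_space \<times> real \<Rightarrow> ennreal"
  assumes f[measurable]: "f \<in> borel_measurable borel" and g: "0 < \<gamma>" "\<gamma>\<^sup>2 - \<sigma>\<^sup>2 = 1"
  shows "(\<integral>\<^sup>+z. f z \<partial>lborel) =
    (\<integral>\<^sup>+z. f (boost (0, 1) \<gamma> \<sigma> z) * ennreal (\<gamma> - \<sigma> * (z \<bullet> (0, 1) / norm z)) \<partial>lborel)"
proof -
  have b: "boost (0, 1) \<gamma> \<sigma> (w, t) = (w, \<gamma> * t - \<sigma> * sqrt ((norm w)\<^sup>2 + t\<^sup>2))" for w :: 'a and t
    by (simp add: boost_def norm_Pair algebra_simps)
  have "(\<integral>\<^sup>+z. f z \<partial>lborel) = (\<integral>\<^sup>+w. \<integral>\<^sup>+t. f (w, t) \<partial>lborel \<partial>lborel)"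
    by (rule nn_integral_lborel_Pair) measurable
  also have "\<dots> = (\<integral>\<^sup>+w. \<integral>\<^sup>+t. f (boost (0, 1) \<gamma> \<sigma> (w, t)) *
      ennreal (\<gamma> - \<sigma> * ((w, t) \<bullet> (0, 1) / norm (w, t))) \<partial>lborel \<partial>lborel)"
    by (rule nn_integral_cong_AE, rule eventually_mono[OF AE_lborel_singleton[of 0]],
        subst nn_integral_boost_real[OF _ _ g]) (simp_all add: b norm_Pair)
  also have "\<dots> = (\<integral>\<^sup>+z. f (boost (0, 1) \<gamma> \<sigma> z) * ennreal (\<gamma> - \<sigma> * (z \<bullet> (0, 1) / norm z)) \<partial>lborel)"
    by (rule nn_integral_lborel_Pair[symmetric]) measurable
  finally show ?thesis .
qed

text \<open>The reflection exchanging \<open>e\<close> with the last axis conjugates this boost into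
  the vertical one and preserves Lebesgue measure.\<close>

lemma nn_integral_boost:
  fixes f :: "'a::euclidean_space \<times> real \<Rightarrow> ennreal"
  assumes f[measurable]: "f \<in> borel_measurable borel" and g: "0 < \<gamma>" "\<gamma>\<^sup>2 - \<sigma>\<^sup>2 = 1"
    and e: "norm e = 1"
  shows "(\<integral>\<^sup>+z. f z \<partial>lborel) =
    (\<integral>\<^sup>+z. f (boost e \<gamma> \<sigma> z) * ennreal (\<gamma> - \<sigma> * (z \<bullet> e / norm z)) \<partial>lborel)"
proof -
  define v where "v = e - (0, 1)"
  have swap: "reflection v (0, 1) = e" "reflection v e = (0, 1)"
    unfolding v_def using e by (auto intro!: reflection_swap simp: norm_Pair)
  have conj: "boost e \<gamma> \<sigma> (reflection v z) = reflection v (boost (0, 1) \<gamma> \<sigma> z)" for z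
    unfolding boost_def linear_add[OF linear_reflection] linear_scale[OF linear_reflection]
    by (simp add: norm_reflection inner_reflection swap)
  have "(\<integral>\<^sup>+z. f z \<partial>lborel) = (\<integral>\<^sup>+z. f (reflection v z) \<partial>lborel)"
    by (rule nn_integral_reflection[symmetric]) measurable
  also have "\<dots> = (\<integral>\<^sup>+z. f (reflection v (boost (0, 1) \<gamma> \<sigma> z)) * ennreal (\<gamma> - \<sigma> * (z \<bullet> (0, 1) / norm z)) \<partial>lborel)"
    by (rule nn_integral_boost_vertical[OF _ g]) measurable
  also have "\<dots> = (\<integral>\<^sup>+z. f (boost e \<gamma> \<sigma> (reflection v z)) *
      ennreal (\<gamma> - \<sigma> * (reflection v z \<bullet> e / norm (reflection v z))) \<partial>lborel)"
    by (simp add: conj norm_reflection inner_reflection swap)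
  also have "\<dots> = (\<integral>\<^sup>+z. f (boost e \<gamma> \<sigma> z) * ennreal (\<gamma> - \<sigma> * (z \<bullet> e / norm z)) \<partial>lborel)"
    by (rule nn_integral_reflection[of "\<lambda>z. f (boost e \<gamma> \<sigma> z) * ennreal (\<gamma> - \<sigma> * (z \<bullet> e / norm z))"]) measurable
  finally show ?thesis .
qed

section \<open>Integration along rays\<close>

lemma nn_integral_exp_below:
  fixes \<mu> :: real
  assumes n: "0 < n" and \<mu>: "0 < \<mu>"
  shows "(\<integral>\<^sup>+\<tau>. indicator {\<tau>. exp \<tau> * \<mu> < 1} \<tau> * ennreal (exp (real n * \<tau>)) \<partial>lborel) =
    ennreal ((1 / \<mu>) ^ n / real n)"
proof -
  \<comment> \<open>In the radius \<open>r = exp \<tau>\<close> this is the integral of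
    \<open>r ^ (n - 1)\<close> over \<open>0 < r < 1 / \<mu>\<close>.\<close>
  have "(\<integral>\<^sup>+\<tau>. indicator {\<tau>. exp \<tau> * \<mu> < 1} \<tau> * ennreal (exp (real n * \<tau>)) \<partial>lborel) =
      (\<integral>\<^sup>+\<tau>. ennreal (exp (real n * \<tau>)) * indicator {.. - ln \<mu>} \<tau> \<partial>lborel)"
  proof (rule nn_integral_cong_AE, rule eventually_mono[OF AE_lborel_singleton[of "- ln \<mu>"]])
    fix \<tau> assume "\<tau> \<noteq> - ln \<mu>"
    have "exp \<tau> * \<mu> = exp (\<tau> + ln \<mu>)" using \<mu> by (simp add: exp_add)
    then have "exp \<tau> * \<mu> < 1 \<longleftrightarrow> \<tau> < - ln \<mu>" by auto
    then show "indicator {\<tau>. exp \<tau> * \<mu> < 1} \<tau> * ennreal (exp (real n * \<tau>)) =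
        ennreal (exp (real n * \<tau>)) * indicator {.. - ln \<mu>} \<tau>"
      using \<open>\<tau> \<noteq> - ln \<mu>\<close> by (auto split: split_indicator)
  qed
  also have "\<dots> = (\<integral>\<^sup>+\<tau>. ennreal (exp (- real n * \<tau>)) * indicator {ln \<mu> ..} \<tau> \<partial>lborel)"
    by (subst nn_integral_real_affine[of _ "-1" 0])
      (auto intro!: nn_integral_cong split: split_indicator)
  also have "\<dots> = ennreal (0 - (- exp (- real n * ln \<mu>) / real n))"
  proof (rule nn_integral_FTC_atLeast)
    show "((\<lambda>\<tau>. - exp (- real n * \<tau>) / real n) has_real_derivative exp (- real n * \<tau>)) (at \<tau>)" for \<tau>
      using n by (auto intro!: derivative_eq_intros)
    show "((\<lambda>\<tau>. - exp (- real n * \<tau>) / real n) \<longlongrightarrow> 0) at_top" using n by real_asymp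
  qed auto
  also have "0 - (- exp (- real n * ln \<mu>) / real n) = (1 / \<mu>) ^ n / real n"
    using \<mu> by (simp add: exp_minus exp_of_nat_mult power_one_over inverse_eq_divide)
  finally show ?thesis .
qed

text \<open>The factor \<open>\<rho>\<^sup>-\<^sup>n\<close> is written as an integral over dilations, which are then moved from \<open>\<rho>\<close> to
  \<open>norm z\<close> by a change of variables; no polar coordinates are needed.\<close>

lemma nn_integral_star_body:
  fixes H :: "'a::euclidean_space \<Rightarrow> ennreal" and \<rho> :: "'a \<Rightarrow> real"
  assumes [measurable]: "H \<in> borel_measurable borel" "\<rho> \<in> borel_measurable borel"
    and hH: "\<And>c z. 0 < c \<Longrightarrow> H (c *\<^sub>R z) = H z"
    and h\<rho>: "\<And>c z. 0 < c \<Longrightarrow> \<rho> (c *\<^sub>R z) = \<rho> z" and pos: "\<And>z. 0 < \<rho> z"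
  shows "(\<integral>\<^sup>+z. indicator {z. norm z * \<rho> z < 1} z * H z \<partial>lborel) =
    (\<integral>\<^sup>+z. indicator (ball 0 1) z * H z * ennreal ((1 / \<rho> z) ^ DIM('a)) \<partial>lborel)"
proof -
  let ?n = "DIM('a)"
  \<comment> \<open>\<open>c\<close> is the dilation integral for \<open>\<mu> = 1\<close>; both
    sides acquire this factor and it is cancelled at the end.\<close>
  define c where "c = ennreal (1 / real ?n)"
  have c: "c \<noteq> 0" "c \<noteq> top" by (auto simp: c_def)
  have ball: "indicator (ball 0 1) = (indicator {z. norm z < 1} :: 'a \<Rightarrow> ennreal)"
    by (auto simp: indicator_def fun_eq_iff)
  have cint: "(\<integral>\<^sup>+\<tau>. indicator {\<tau>. exp \<tau> * \<mu> < 1} \<tau> * ennreal (exp (real ?n * \<tau>)) \<partial>lborel) =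
      c * ennreal ((1 / \<mu>) ^ ?n)" if "0 < \<mu>" for \<mu>
    using that by (subst nn_integral_exp_below) (auto simp: c_def simp flip: ennreal_mult)
  have scale: "(\<integral>\<^sup>+z. f z \<partial>lborel) * ennreal (exp (real ?n * \<tau>)) = (\<integral>\<^sup>+z. f (exp (- \<tau>) *\<^sub>R z) \<partial>lborel)"
    if [measurable]: "f \<in> borel_measurable borel" for f :: "'a \<Rightarrow> ennreal" and \<tau>
  proof -
    have "exp (- \<tau>) ^ ?n * exp (real ?n * \<tau>) = 1"
      by (simp add: exp_of_nat_mult flip: power_mult_distrib exp_add)
    then have "ennreal (exp (- \<tau>) ^ ?n) * ennreal (exp (real ?n * \<tau>)) = 1"
      by (simp flip: ennreal_mult)
    then show ?thesis
      using nn_integral_lborel_scale[of f "exp (- \<tau>)" 0]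
      by (simp add: mult.assoc mult.commute[of _ "ennreal (exp (real ?n * \<tau>))"])
        (simp add: mult.commute[of _ "ennreal (exp _)"] flip: mult.assoc)
  qed
  have "c * (\<integral>\<^sup>+z. indicator (ball 0 1) z * H z * ennreal ((1 / \<rho> z) ^ ?n) \<partial>lborel) =
      (\<integral>\<^sup>+z. \<integral>\<^sup>+\<tau>. indicator {z. norm z < 1} z * H z * (indicator {\<tau>. exp \<tau> * \<rho> z < 1} \<tau> * ennreal (exp (real ?n * \<tau>))) \<partial>lborel \<partial>lborel)"
    unfolding ball
    by (subst nn_integral_cmult[symmetric], measurable, rule nn_integral_cong, subst nn_integral_cmult, measurable,
        subst cint[OF pos]) (simp only: mult_ac)
  also have "\<dots> = (\<integral>\<^sup>+\<tau>. \<integral>\<^sup>+z. indicator {z. norm z < 1} z * H z * (indicator {\<tau>. exp \<tau> * \<rho> z < 1} \<tau> * ennreal (exp (real ?n * \<tau>))) \<partial>lborel \<partial>lborel)"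
    by (rule lborel_pair.Fubini'[symmetric]) measurable
  also have "\<dots> = (\<integral>\<^sup>+\<tau>. (\<integral>\<^sup>+z. indicator {z. norm z < 1} z * H z * indicator {\<tau>. exp \<tau> * \<rho> z < 1} \<tau> \<partial>lborel) * ennreal (exp (real ?n * \<tau>)) \<partial>lborel)"
    by (simp add: nn_integral_multc[symmetric] mult.assoc)
  also have "\<dots> = (\<integral>\<^sup>+\<tau>. \<integral>\<^sup>+z. indicator {z. norm z * exp (- \<tau>) < 1} z * H z * indicator {\<tau>. exp \<tau> * \<rho> z < 1} \<tau> \<partial>lborel \<partial>lborel)"
    by (subst scale) (auto simp: hH h\<rho> mult.commute indicator_def)
  also have "\<dots> = (\<integral>\<^sup>+z. \<integral>\<^sup>+\<tau>. indicator {z. norm z * exp (- \<tau>) < 1} z * H z * indicator {\<tau>. exp \<tau> * \<rho> z < 1} \<tau> \<partial>lborel \<partial>lborel)"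
    by (rule lborel_pair.Fubini') measurable
  \<comment> \<open>The shift of \<open>\<tau>\<close> by \<open>- ln (\<rho> z)\<close> depends on
    \<open>z\<close>, so the inner integral has to be the one over \<open>\<tau>\<close>. It takes
    \<open>\<rho>\<close> out of the cutoff in \<open>\<tau>\<close> and puts it into the cutoff in
    \<open>norm z\<close>.\<close>
  also have "\<dots> = (\<integral>\<^sup>+z. \<integral>\<^sup>+\<tau>. indicator {z. norm z * \<rho> z * exp (- \<tau>) < 1} z * H z * indicator {\<tau>. exp \<tau> < 1} \<tau> \<partial>lborel \<partial>lborel)"
  proof (rule nn_integral_cong)
    fix z
    have e: "exp (\<tau> - ln (\<rho> z)) * \<rho> z = exp \<tau>" "exp (ln (\<rho> z) - \<tau>) = \<rho> z * exp (- \<tau>)" for \<tau>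
      using pos[of z] by (auto simp: exp_diff exp_minus field_simps)
    show "(\<integral>\<^sup>+\<tau>. indicator {z. norm z * exp (- \<tau>) < 1} z * H z * indicator {\<tau>. exp \<tau> * \<rho> z < 1} \<tau> \<partial>lborel) =
        (\<integral>\<^sup>+\<tau>. indicator {z. norm z * \<rho> z * exp (- \<tau>) < 1} z * H z * indicator {\<tau>. exp \<tau> < 1} \<tau> \<partial>lborel)"
      by (subst nn_integral_lborel_translate[of _ "- ln (\<rho> z)", symmetric])
        (auto simp: e indicator_def mult.assoc)
  qed
  also have "\<dots> = (\<integral>\<^sup>+\<tau>. \<integral>\<^sup>+z. indicator {z. norm z * \<rho> z * exp (- \<tau>) < 1} z * H z * indicator {\<tau>. exp \<tau> < 1} \<tau> \<partial>lborel \<partial>lborel)"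
    by (rule lborel_pair.Fubini'[symmetric]) measurable
  also have "\<dots> = (\<integral>\<^sup>+\<tau>. (\<integral>\<^sup>+z. indicator {z. norm z * \<rho> z < 1} z * H z * indicator {\<tau>. exp \<tau> < 1} \<tau> \<partial>lborel) * ennreal (exp (real ?n * \<tau>)) \<partial>lborel)"
    by (subst scale) (auto simp: hH h\<rho> mult_ac indicator_def)
  also have "\<dots> = (\<integral>\<^sup>+\<tau>. (\<integral>\<^sup>+z. indicator {z. norm z * \<rho> z < 1} z * H z \<partial>lborel) * (indicator {\<tau>. exp \<tau> * 1 < 1} \<tau> * ennreal (exp (real ?n * \<tau>))) \<partial>lborel)"
    by (rule nn_integral_cong, subst nn_integral_multc, measurable, simp only: mult_1_right mult.assoc)
  also have "\<dots> = c * (\<integral>\<^sup>+z. indicator {z. norm z * \<rho> z < 1} z * H z \<partial>lborel)"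
    by (subst nn_integral_cmult, measurable, subst cint) (auto simp: mult.commute)
  finally show ?thesis using c by (simp add: ennreal_mult_cancel_left)
qed

text \<open>Stereographic projection, obtained from the parametrization
  \<open>z = exp \<tau> * (w, (norm w ^ 2 - 1) / 2)\<close> by null coordinates.\<close>

lemma nn_integral_stereographic:
  fixes g :: "'a::euclidean_space \<times> real \<Rightarrow> ennreal"
  assumes [measurable]: "g \<in> borel_measurable borel"
    and hom: "\<And>c z. 0 < c \<Longrightarrow> g (c *\<^sub>R z) = g z"
  shows "(\<integral>\<^sup>+z. indicator (ball 0 1) z * g z \<partial>lborel) =
    ennreal (1 / DIM('a \<times> real)) *
    (\<integral>\<^sup>+w. g (w, ((norm w)\<^sup>2 - 1) / 2) * ennreal ((2 / ((norm w)\<^sup>2 + 1)) ^ DIM('a)) \<partial>lborel)"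
proof -
  let ?d = "DIM('a)"
  define f where "f z = indicator {z. norm z < 1} z * g z" for z
  have [measurable]: "f \<in> borel_measurable borel" unfolding f_def by measurable
  have S: "(norm w)\<^sup>2 + 1 > 0" for w :: 'a by (simp add: add_nonneg_pos)
  have "(\<integral>\<^sup>+z. indicator (ball 0 1) z * g z \<partial>lborel) = (\<integral>\<^sup>+z. f z \<partial>lborel)"
    by (simp add: f_def ball_def)
  also have "\<dots> = (\<integral>\<^sup>+w. \<integral>\<^sup>+t. f (w, t) \<partial>lborel \<partial>lborel)"
    by (rule nn_integral_lborel_Pair) measurable
  also have "\<dots> = (\<integral>\<^sup>+w. \<integral>\<^sup>+\<tau>. f (w, ((norm w)\<^sup>2 * exp (- \<tau>) - exp \<tau>) / 2) *
      ennreal ((exp \<tau> + (norm w)\<^sup>2 * exp (- \<tau>)) / 2) \<partial>lborel \<partial>lborel)"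
  proof (rule nn_integral_cong_AE, rule eventually_mono[OF AE_lborel_singleton[of 0]])
    fix w :: 'a assume w: "w \<noteq> 0"
    \<comment> \<open>Reversing \<open>t\<close> makes \<open>exp \<tau>\<close> equal to
      \<open>norm z\<close> minus the last coordinate of \<open>z\<close>, which corresponds to
      projecting from the pole \<open>(0, 1)\<close>.\<close>
    have "(\<integral>\<^sup>+t. f (w, t) \<partial>lborel) = (\<integral>\<^sup>+t. f (w, - t) \<partial>lborel)"
      by (subst nn_integral_real_affine[of _ "-1" 0]) auto
    also have "\<dots> = (\<integral>\<^sup>+\<tau>. f (w, ((norm w)\<^sup>2 * exp (- \<tau>) - exp \<tau>) / 2) *
        ennreal ((exp \<tau> + (norm w)\<^sup>2 * exp (- \<tau>)) / 2) \<partial>lborel)"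
      by (subst nn_integral_null_coordinate[of _ "(norm w)\<^sup>2"])
        (measurable, use w in simp, simp only: minus_divide_left minus_diff_eq)
    finally show "(\<integral>\<^sup>+t. f (w, t) \<partial>lborel) = (\<integral>\<^sup>+\<tau>. f (w, ((norm w)\<^sup>2 * exp (- \<tau>) - exp \<tau>) / 2) *
        ennreal ((exp \<tau> + (norm w)\<^sup>2 * exp (- \<tau>)) / 2) \<partial>lborel)" .
  qed
  also have "\<dots> = (\<integral>\<^sup>+\<tau>. \<integral>\<^sup>+w. f (w, ((norm w)\<^sup>2 * exp (- \<tau>) - exp \<tau>) / 2) *
      ennreal ((exp \<tau> + (norm w)\<^sup>2 * exp (- \<tau>)) / 2) \<partial>lborel \<partial>lborel)"
    by (rule lborel_pair.Fubini'[symmetric]) measurable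
  also have "\<dots> = (\<integral>\<^sup>+\<tau>. \<integral>\<^sup>+w. f (exp \<tau> *\<^sub>R (w, ((norm w)\<^sup>2 - 1) / 2)) *
      ennreal (((norm w)\<^sup>2 + 1) / 2 * exp (real (?d + 1) * \<tau>)) \<partial>lborel \<partial>lborel)"
  proof (rule nn_integral_cong)
    fix \<tau> :: real
    have e: "(norm (exp \<tau> *\<^sub>R w))\<^sup>2 * exp (- \<tau>) = exp \<tau> * (norm w)\<^sup>2" for w :: 'a
    proof -
      have "exp \<tau> * exp (- \<tau>) = 1" by (simp add: mult_exp_exp)
      then show ?thesis unfolding norm_scaleR abs_exp_cancel by algebra
    qed
    have e2: "exp \<tau> ^ ?d * exp \<tau> = exp (real (?d + 1) * \<tau>)"
      by (simp flip: exp_of_nat_mult exp_add add: algebra_simps)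
    \<comment> \<open>At fixed \<open>\<tau>\<close>, rescaling \<open>w\<close> by
      \<open>exp \<tau>\<close> makes \<open>exp \<tau>\<close> a common factor of both coordinates,
      so that \<open>\<tau>\<close> parametrizes a ray.\<close>
    have "(\<integral>\<^sup>+w. f (w, ((norm w)\<^sup>2 * exp (- \<tau>) - exp \<tau>) / 2) *
          ennreal ((exp \<tau> + (norm w)\<^sup>2 * exp (- \<tau>)) / 2) \<partial>lborel) =
        (\<integral>\<^sup>+w. ennreal (exp \<tau> ^ ?d) * (f (exp \<tau> *\<^sub>R w, ((norm (exp \<tau> *\<^sub>R w))\<^sup>2 * exp (- \<tau>) - exp \<tau>) / 2) *
          ennreal ((exp \<tau> + (norm (exp \<tau> *\<^sub>R w))\<^sup>2 * exp (- \<tau>)) / 2)) \<partial>lborel)"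
      by (subst nn_integral_lborel_scale[of _ "exp \<tau>" 0], measurable, subst nn_integral_cmult) auto
    also have "\<dots> = (\<integral>\<^sup>+w. f (exp \<tau> *\<^sub>R (w, ((norm w)\<^sup>2 - 1) / 2)) *
      ennreal (((norm w)\<^sup>2 + 1) / 2 * exp (real (?d + 1) * \<tau>)) \<partial>lborel)"
    proof (rule nn_integral_cong)
      fix w :: 'a
      have 1: "((norm (exp \<tau> *\<^sub>R w))\<^sup>2 * exp (- \<tau>) - exp \<tau>) / 2 = exp \<tau> * (((norm w)\<^sup>2 - 1) / 2)"
        unfolding e by (simp add: field_simps)
      have 2: "(exp \<tau> + (norm (exp \<tau> *\<^sub>R w))\<^sup>2 * exp (- \<tau>)) / 2 = exp \<tau> * (((norm w)\<^sup>2 + 1) / 2)"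
        unfolding e by (simp add: field_simps)
      have 3: "ennreal (exp \<tau> ^ ?d) * ennreal (exp \<tau> * (((norm w)\<^sup>2 + 1) / 2)) =
          ennreal (((norm w)\<^sup>2 + 1) / 2 * exp (real (?d + 1) * \<tau>))"
        unfolding e2[symmetric] by (subst ennreal_mult[symmetric]) (auto simp: mult_ac)
      show "ennreal (exp \<tau> ^ ?d) * (f (exp \<tau> *\<^sub>R w, ((norm (exp \<tau> *\<^sub>R w))\<^sup>2 * exp (- \<tau>) - exp \<tau>) / 2) *
          ennreal ((exp \<tau> + (norm (exp \<tau> *\<^sub>R w))\<^sup>2 * exp (- \<tau>)) / 2)) =
          f (exp \<tau> *\<^sub>R (w, ((norm w)\<^sup>2 - 1) / 2)) *
          ennreal (((norm w)\<^sup>2 + 1) / 2 * exp (real (?d + 1) * \<tau>))"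
        unfolding 1 2 by (simp only: scaleR_Pair real_scaleR_def 3[symmetric] mult.left_commute)
    qed
    finally show "(\<integral>\<^sup>+w. f (w, ((norm w)\<^sup>2 * exp (- \<tau>) - exp \<tau>) / 2) *
          ennreal ((exp \<tau> + (norm w)\<^sup>2 * exp (- \<tau>)) / 2) \<partial>lborel) =
        (\<integral>\<^sup>+w. f (exp \<tau> *\<^sub>R (w, ((norm w)\<^sup>2 - 1) / 2)) *
          ennreal (((norm w)\<^sup>2 + 1) / 2 * exp (real (?d + 1) * \<tau>)) \<partial>lborel)" .
  qed
  also have "\<dots> = (\<integral>\<^sup>+w. \<integral>\<^sup>+\<tau>. f (exp \<tau> *\<^sub>R (w, ((norm w)\<^sup>2 - 1) / 2)) *
      ennreal (((norm w)\<^sup>2 + 1) / 2 * exp (real (?d + 1) * \<tau>)) \<partial>lborel \<partial>lborel)"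
    by (rule lborel_pair.Fubini') measurable
  also have "\<dots> = (\<integral>\<^sup>+w. ennreal (1 / DIM('a \<times> real)) * (g (w, ((norm w)\<^sup>2 - 1) / 2) *
      ennreal ((2 / ((norm w)\<^sup>2 + 1)) ^ ?d)) \<partial>lborel)"
  proof (rule nn_integral_cong)
    fix w :: 'a
    \<comment> \<open>\<open>\<mu>\<close> is the norm of the point at \<open>\<tau> = 0\<close>, so
      the ball cuts the ray at \<open>exp \<tau> * \<mu> < 1\<close>. The ray contributes the power
      \<open>?d + 1\<close> of \<open>1 / \<mu>\<close>, and the factor \<open>\<mu>\<close> of the
      Jacobian lowers it to \<open>?d\<close>.\<close>
    define \<mu> where "\<mu> = ((norm w)\<^sup>2 + 1) / 2"
    have \<mu>: "\<mu> > 0" using S[of w] by (simp add: \<mu>_def)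
    have "(norm (w, ((norm w)\<^sup>2 - 1) / 2))\<^sup>2 = \<mu>\<^sup>2"
      by (simp add: norm_Pair \<mu>_def power2_eq_square field_simps)
    then have nrm: "norm (w, ((norm w)\<^sup>2 - 1) / 2) = \<mu>"
      by (rule power2_eq_imp_eq) (use \<mu> in auto)
    have f: "f (exp \<tau> *\<^sub>R (w, ((norm w)\<^sup>2 - 1) / 2)) =
        indicator {\<tau>. exp \<tau> * \<mu> < 1} \<tau> * g (w, ((norm w)\<^sup>2 - 1) / 2)" for \<tau>
      unfolding f_def by (simp only: hom exp_gt_zero) (simp add: indicator_def nrm del: scaleR_Pair)
    have "(\<integral>\<^sup>+\<tau>. f (exp \<tau> *\<^sub>R (w, ((norm w)\<^sup>2 - 1) / 2)) *
        ennreal (\<mu> * exp (real (?d + 1) * \<tau>)) \<partial>lborel) =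
      (\<integral>\<^sup>+\<tau>. (ennreal \<mu> * g (w, ((norm w)\<^sup>2 - 1) / 2)) *
        (indicator {\<tau>. exp \<tau> * \<mu> < 1} \<tau> * ennreal (exp (real (?d + 1) * \<tau>))) \<partial>lborel)"
      unfolding f using \<mu> by (simp add: ennreal_mult mult_ac)
    also have "\<dots> = (ennreal \<mu> * g (w, ((norm w)\<^sup>2 - 1) / 2)) * ennreal ((1 / \<mu>) ^ (?d + 1) / real (?d + 1))"
      by (subst nn_integral_cmult, measurable, subst nn_integral_exp_below) (use \<mu> in auto)
    also have "\<dots> = g (w, ((norm w)\<^sup>2 - 1) / 2) * ennreal (\<mu> * ((1 / \<mu>) ^ (?d + 1) / real (?d + 1)))"
    proof -
      have "0 \<le> (1 / \<mu>) ^ (?d + 1) / real (?d + 1)" using \<mu> by simp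
      then show ?thesis using \<mu> by (simp only: ennreal_mult less_imp_le mult_ac)
    qed
    also have "\<mu> * ((1 / \<mu>) ^ (?d + 1) / real (?d + 1)) = (1 / DIM('a \<times> real)) * (1 / \<mu>) ^ ?d"
      using \<mu> by simp
    also have "ennreal \<dots> = ennreal (1 / DIM('a \<times> real)) * ennreal ((1 / \<mu>) ^ ?d)"
      using \<mu> by (subst ennreal_mult) auto
    finally show "(\<integral>\<^sup>+\<tau>. f (exp \<tau> *\<^sub>R (w, ((norm w)\<^sup>2 - 1) / 2)) *
        ennreal (((norm w)\<^sup>2 + 1) / 2 * exp (real (?d + 1) * \<tau>)) \<partial>lborel) =
        ennreal (1 / DIM('a \<times> real)) * (g (w, ((norm w)\<^sup>2 - 1) / 2) *
        ennreal ((2 / ((norm w)\<^sup>2 + 1)) ^ ?d))"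
      by (simp only: mult.left_commute) (simp add: \<mu>_def)
  qed
  also have "\<dots> = ennreal (1 / DIM('a \<times> real)) *
    (\<integral>\<^sup>+w. g (w, ((norm w)\<^sup>2 - 1) / 2) * ennreal ((2 / ((norm w)\<^sup>2 + 1)) ^ DIM('a)) \<partial>lborel)"
    by (rule nn_integral_cmult) measurable
  finally show ?thesis .
qed

section \<open>Directional moments on the sphere\<close>

abbreviation unit_ball_measure :: "'a::euclidean_space measure" where
  "unit_ball_measure \<equiv> uniform_measure lborel (ball 0 1)"

lemma prob_space_unit_ball_measure: "prob_space (unit_ball_measure :: 'a::euclidean_space measure)"
  by (intro prob_space_uniform_measure) (auto simp: emeasure_unit_ball)

lemma nn_integral_unit_ball_measure:
  fixes f :: "'a::euclidean_space \<Rightarrow> ennreal"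
  assumes "f \<in> borel_measurable borel"
  shows "(\<integral>\<^sup>+z. f z \<partial>unit_ball_measure) =
    (\<integral>\<^sup>+z. indicator (ball 0 1) z * f z \<partial>lborel) / emeasure lborel (ball (0::'a) 1)"
  using assms by (subst nn_integral_uniform_measure) (auto simp: mult.commute)

lemma distr_unit_ball_measure_isometry:
  fixes R :: "'a::euclidean_space \<Rightarrow> 'a"
  assumes lin: "linear R" and inv: "\<And>x. R (R x) = x" and nrm: "\<And>x. norm (R x) = norm x"
  shows "distr unit_ball_measure borel R = unit_ball_measure"
proof (rule measure_eqI)
  have [measurable]: "R \<in> borel_measurable borel"
    using lin by (simp add: borel_measurable_continuous_onI linear_continuous_on linear_conv_bounded_linear)
  fix A assume "A \<in> sets (distr unit_ball_measure borel R)"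
  then have A[measurable]: "A \<in> sets borel" by simp
  have "emeasure (distr unit_ball_measure borel R) A = (\<integral>\<^sup>+z. indicator A (R z) \<partial>unit_ball_measure)"
    by (subst nn_integral_indicator[symmetric], simp, subst nn_integral_distr) auto
  also have "\<dots> = (\<integral>\<^sup>+z. indicator (ball 0 1) (R z) * indicator A (R z) \<partial>lborel) / emeasure lborel (ball (0::'a) 1)"
    by (subst nn_integral_unit_ball_measure) (auto simp: nrm indicator_def)
  also have "\<dots> = (\<integral>\<^sup>+z. indicator (ball 0 1) z * indicator A z \<partial>lborel) / emeasure lborel (ball (0::'a) 1)"
    by (subst nn_integral_lborel_involutive_isometry[OF _ lin inv nrm, of "\<lambda>z. indicator (ball 0 1) z * indicator A z"])
      (intro borel_measurable_times_ennreal borel_measurable_indicator, use A in auto)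
  also have "\<dots> = (\<integral>\<^sup>+z. indicator A z \<partial>unit_ball_measure)"
    by (subst nn_integral_unit_ball_measure) auto
  finally show "emeasure (distr unit_ball_measure borel R) A = emeasure unit_ball_measure A"
    by simp
qed simp

lemma integral_unit_ball_measure_isometry:
  fixes R :: "'a::euclidean_space \<Rightarrow> 'a" and f :: "'a \<Rightarrow> real"
  assumes lin: "linear R" and inv: "\<And>x. R (R x) = x" and nrm: "\<And>x. norm (R x) = norm x"
    and [measurable]: "f \<in> borel_measurable borel"
  shows "(\<integral>z. f (R z) \<partial>unit_ball_measure) = (\<integral>z. f z \<partial>unit_ball_measure)"
proof -
  have [measurable]: "R \<in> borel_measurable borel"
    using lin by (simp add: borel_measurable_continuous_onI linear_continuous_on linear_conv_bounded_linear)
  have "(\<integral>z. f z \<partial>unit_ball_measure) = (\<integral>z. f z \<partial>distr unit_ball_measure borel R)"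
    by (simp only: distr_unit_ball_measure_isometry[OF lin inv nrm])
  then show ?thesis by (subst (asm) integral_distr) simp_all
qed

lemma integrable_unit_ball_measure_bounded:
  fixes f :: "'a::euclidean_space \<Rightarrow> real"
  assumes "f \<in> borel_measurable borel" "\<And>z. \<bar>f z\<bar> \<le> B"
  shows "integrable unit_ball_measure f"
proof -
  interpret prob_space "unit_ball_measure :: 'a measure" by (rule prob_space_unit_ball_measure)
  show ?thesis using assms by (intro integrable_const_bound[of _ B]) auto
qed

text \<open>Integrating the nonnegative product of differences suffices: by invariance the two
  unmixed terms have equal integrals, and so do the two mixed ones.\<close>

lemma integral_polarization:
  fixes F G :: "'a::euclidean_space \<Rightarrow> real"
  assumes [measurable]: "F \<in> borel_measurable borel" "G \<in> borel_measurable borel"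
    and bF: "\<And>z. \<bar>F z\<bar> \<le> a" and bG: "\<And>z. \<bar>G z\<bar> \<le> b"
    and le: "\<And>z. 0 \<le> (F z - F (reflection v z)) * (G z - G (reflection v z))"
  shows "(\<integral>z. F (reflection v z) * G z \<partial>unit_ball_measure) \<le> (\<integral>z. F z * G z \<partial>unit_ball_measure)"
proof -
  let ?R = "reflection v"
  have b: "\<bar>F x * G y\<bar> \<le> a * b" for x y
    unfolding abs_mult using bF[of x] bG[of y] by (intro mult_mono) auto
  have i: "integrable unit_ball_measure (\<lambda>z. F z * G z)"
    "integrable unit_ball_measure (\<lambda>z. F (?R z) * G z)"
    "integrable unit_ball_measure (\<lambda>z. F z * G (?R z))"
    "integrable unit_ball_measure (\<lambda>z. F (?R z) * G (?R z))"
    by (rule integrable_unit_ball_measure_bounded[OF _ b]; measurable)+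
  note R = integral_unit_ball_measure_isometry[OF linear_reflection reflection_reflection norm_reflection]
  have "0 \<le> (\<integral>z. (F z - F (?R z)) * (G z - G (?R z)) \<partial>unit_ball_measure)"
    using le by (rule Bochner_Integration.integral_nonneg)
  also have "\<dots> = (\<integral>z. F z * G z - F (?R z) * G z - F z * G (?R z) + F (?R z) * G (?R z) \<partial>unit_ball_measure)"
    by (simp add: algebra_simps)
  also have "\<dots> = (\<integral>z. F z * G z \<partial>unit_ball_measure) - (\<integral>z. F (?R z) * G z \<partial>unit_ball_measure)
      - (\<integral>z. F z * G (?R z) \<partial>unit_ball_measure) + (\<integral>z. F (?R z) * G (?R z) \<partial>unit_ball_measure)"
    using i by simp
  also have "(\<integral>z. F (?R z) * G (?R z) \<partial>unit_ball_measure) = (\<integral>z. F z * G z \<partial>unit_ball_measure)"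
    by (rule R) measurable
  also have "(\<integral>z. F z * G (?R z) \<partial>unit_ball_measure) = (\<integral>z. F (?R z) * G z \<partial>unit_ball_measure)"
    using R[of "\<lambda>z. F (?R z) * G z" v] by (simp add: reflection_reflection)
  finally show ?thesis by simp
qed

lemma sgn_reflection: "sgn (reflection v z) = reflection v (sgn z)"
  by (simp add: sgn_div_norm norm_reflection linear_scale[OF linear_reflection])

lemma inner_sgn_reflection: "sgn (reflection v z) \<bullet> e = sgn z \<bullet> reflection v e"
  by (simp add: sgn_reflection inner_reflection)

lemma abs_inner_sgn_le: "norm e = 1 \<Longrightarrow> \<bar>sgn z \<bullet> e\<bar> \<le> 1"
  using Cauchy_Schwarz_ineq2[of "sgn z" e] by (auto simp: norm_sgn split: if_splits)

lemma borel_measurable_sgn_vector[measurable]: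
  "sgn \<in> borel_measurable (borel :: 'a::euclidean_space measure)"
  unfolding sgn_div_norm by measurable

definition directional_moment :: "(real \<Rightarrow> real) \<Rightarrow> real \<Rightarrow> 'a::euclidean_space \<Rightarrow> 'a \<Rightarrow> real" where
  "directional_moment f q e l = (\<integral>z. f (sgn z \<bullet> e) * \<bar>sgn z \<bullet> l\<bar> powr q \<partial>unit_ball_measure)"

text \<open>Monotonicity is asked of \<open>f s + f (- s)\<close> rather than of \<open>f\<close>,
  because \<open>f\<close> will be integrated against an even function; arguments stay in [-1, 1]
  since they are inner products of unit vectors.\<close>

locale even_increasing =
  fixes f :: "real \<Rightarrow> real" and q B :: real
  assumes meas[measurable]: "f \<in> borel_measurable borel"
    and q: "0 \<le> q"
    and bound: "\<And>s. \<bar>s\<bar> \<le> 1 \<Longrightarrow> \<bar>f s\<bar> \<le> B"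
    and mono: "\<And>s t. \<bar>s\<bar> \<le> \<bar>t\<bar> \<Longrightarrow> \<bar>t\<bar> \<le> 1 \<Longrightarrow> f s + f (- s) \<le> f t + f (- t)"
begin

definition even_part :: "real \<Rightarrow> real" where
  "even_part s = (f s + f (- s)) / 2"

lemma borel_measurable_even_part[measurable]: "even_part \<in> borel_measurable borel"
  unfolding even_part_def by measurable

lemma abs_even_part_le: "\<bar>s\<bar> \<le> 1 \<Longrightarrow> \<bar>even_part s\<bar> \<le> B"
  using bound[of s] bound[of "- s"] unfolding even_part_def by (simp add: abs_le_iff)

lemma even_part_mono: "\<bar>s\<bar> \<le> \<bar>t\<bar> \<Longrightarrow> \<bar>t\<bar> \<le> 1 \<Longrightarrow> even_part s \<le> even_part t"
  using mono[of s t] by (simp add: even_part_def)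

lemma powr_le_1: "\<bar>s\<bar> \<le> 1 \<Longrightarrow> \<bar>\<bar>s\<bar> powr q\<bar> \<le> 1"
  using q powr_mono2[of q "\<bar>s\<bar>" 1] by simp

text \<open>The condition on squares says that passing from \<open>s\<close> to \<open>s'\<close>
  and from \<open>r\<close> to \<open>r'\<close> changes the squares by the same amount, so
  \<open>\<bar>s\<bar>\<close> and \<open>\<bar>r\<bar>\<close> move in the same direction and both
  factors have the same sign.\<close>

lemma comonotone:
  assumes "\<bar>s\<bar> \<le> 1" "\<bar>s'\<bar> \<le> 1" and "s\<^sup>2 - s'\<^sup>2 = r\<^sup>2 - r'\<^sup>2"
  shows "0 \<le> (even_part s - even_part s') * (\<bar>r\<bar> powr q - \<bar>r'\<bar> powr q)"
proof (cases "\<bar>s\<bar> \<le> \<bar>s'\<bar>")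
  case True
  then have "r\<^sup>2 \<le> r'\<^sup>2" using assms(3) abs_le_square_iff[of s s'] by linarith
  then have "\<bar>r\<bar> powr q \<le> \<bar>r'\<bar> powr q" using q by (intro powr_mono2) (auto simp: abs_le_square_iff)
  then show ?thesis using even_part_mono[OF True assms(2)] by (intro mult_nonpos_nonpos) auto
next
  case False
  then have "r'\<^sup>2 \<le> r\<^sup>2" using assms(3) abs_le_square_iff[of s' s] by linarith
  then have "\<bar>r'\<bar> powr q \<le> \<bar>r\<bar> powr q" using q by (intro powr_mono2) (auto simp: abs_le_square_iff)
  then show ?thesis using even_part_mono[of s' s] False assms(1) by (intro mult_nonneg_nonneg) auto
qed

lemma integrable_moment:
  assumes "norm e = 1" "norm l = 1"
  shows "integrable unit_ball_measure (\<lambda>z::'a::euclidean_space. f (sgn z \<bullet> e) * \<bar>sgn z \<bullet> l\<bar> powr q)"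
proof (rule integrable_unit_ball_measure_bounded[where B = "B * 1"])
  fix z :: 'a
  show "\<bar>f (sgn z \<bullet> e) * \<bar>sgn z \<bullet> l\<bar> powr q\<bar> \<le> B * 1"
    unfolding abs_mult using assms bound[OF abs_inner_sgn_le, of e z] powr_le_1[OF abs_inner_sgn_le, of l z]
    by (intro mult_mono) auto
qed measurable

text \<open>The antipodal map preserves the measure and
  \<open>\<bar>sgn z \<bullet> l\<bar>\<close>, so averaging over it replaces \<open>f\<close> by
  its even part.\<close>

lemma directional_moment_even_part:
  fixes e l :: "'a::euclidean_space"
  assumes "norm e = 1" "norm l = 1"
  shows "directional_moment f q e l = directional_moment even_part q e l"
proof -
  let ?F = "\<lambda>z::'a. f (sgn z \<bullet> e) * \<bar>sgn z \<bullet> l\<bar> powr q"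
  have "linear (uminus :: 'a \<Rightarrow> 'a)" by (rule linearI) auto
  then have eq: "(\<integral>z. ?F (- z) \<partial>unit_ball_measure) = (\<integral>z. ?F z \<partial>unit_ball_measure)"
    by (intro integral_unit_ball_measure_isometry) auto
  have i: "integrable unit_ball_measure ?F" by (rule integrable_moment[OF assms])
  have i2: "integrable unit_ball_measure (\<lambda>z. ?F (- z))"
    using integrable_moment[of "- e" l] assms by (simp add: sgn_minus)
  have "directional_moment even_part q e l = (\<integral>z. (?F z + ?F (- z)) / 2 \<partial>unit_ball_measure)"
    unfolding directional_moment_def even_part_def by (simp add: sgn_minus field_simps)
  also have "\<dots> = ((\<integral>z. ?F z \<partial>unit_ball_measure) + (\<integral>z. ?F (- z) \<partial>unit_ball_measure)) / 2"
    using i i2 by simp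
  finally show ?thesis unfolding eq by (simp add: directional_moment_def)
qed

lemma directional_moment_reflection:
  fixes e l :: "'a::euclidean_space"
  assumes "g \<in> borel_measurable borel"
  shows "directional_moment g q (reflection v e) (reflection v l) = directional_moment g q e l"
proof -
  note [measurable] = assms
  have "(\<integral>z. g (sgn (reflection v z) \<bullet> e) * \<bar>sgn (reflection v z) \<bullet> l\<bar> powr q \<partial>unit_ball_measure) =
      directional_moment g q e l"
    unfolding directional_moment_def
    by (rule integral_unit_ball_measure_isometry[OF linear_reflection reflection_reflection norm_reflection]) measurable
  then show ?thesis unfolding directional_moment_def inner_sgn_reflection .
qed

text \<open>The hypothesis is exactly what \<open>comonotone\<close> needs at the two mirror points
  \<open>z\<close> and \<open>reflection v z\<close>; polarization then shows that replacing
  \<open>l\<close> by its mirror image cannot increase the moment.\<close>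

lemma directional_moment_polarization:
  fixes e l :: "'a::euclidean_space"
  assumes [simp]: "norm e = 1" "norm l = 1"
    and "\<And>z. (z \<bullet> e)\<^sup>2 - (z \<bullet> reflection v e)\<^sup>2 = (z \<bullet> l)\<^sup>2 - (z \<bullet> reflection v l)\<^sup>2"
  shows "directional_moment f q e (reflection v l) \<le> directional_moment f q e l"
proof -
  have "directional_moment even_part q (reflection v e) l \<le> directional_moment even_part q e l"
    unfolding directional_moment_def inner_sgn_reflection[symmetric]
  proof (rule integral_polarization)
    fix z :: 'a
    show "\<bar>even_part (sgn z \<bullet> e)\<bar> \<le> B" by (intro abs_even_part_le abs_inner_sgn_le) simp
    show "\<bar>\<bar>sgn z \<bullet> l\<bar> powr q\<bar> \<le> 1" by (intro powr_le_1 abs_inner_sgn_le) simp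
    show "0 \<le> (even_part (sgn z \<bullet> e) - even_part (sgn (reflection v z) \<bullet> e)) *
        (\<bar>sgn z \<bullet> l\<bar> powr q - \<bar>sgn (reflection v z) \<bullet> l\<bar> powr q)"
      unfolding inner_sgn_reflection using assms(3)
      by (intro comonotone abs_inner_sgn_le) (auto simp: norm_reflection)
  qed measurable
  \<comment> \<open>Reflecting both vectors at once transfers the reflection from \<open>e\<close>
    to \<open>l\<close>.\<close>
  moreover have "directional_moment even_part q (reflection v e) l = directional_moment even_part q e (reflection v l)"
    using directional_moment_reflection[of even_part v e "reflection v l"] by (simp add: reflection_reflection)
  ultimately show ?thesis by (simp add: directional_moment_even_part norm_reflection)
qed

text \<open>With \<open>e\<close> in both slots the condition on squares is a tautology, and the
  reflection in \<open>e - l\<close> takes \<open>e\<close> to \<open>l\<close>.\<close>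

lemma directional_moment_le_parallel:
  fixes e l :: "'a::euclidean_space"
  assumes "norm e = 1" "norm l = 1"
  shows "directional_moment f q e l \<le> directional_moment f q e e"
  using directional_moment_polarization[of e e "e - l"] assms by (simp add: reflection_swap)

text \<open>All unit vectors orthogonal to \<open>e\<close> give the same moment, since reflections
  fixing \<open>e\<close> exchange them. So \<open>l\<close> need only be compared with the unit
  vector \<open>s\<close> orthogonal to \<open>e\<close> in the plane of \<open>e\<close> and
  \<open>l\<close>.\<close>

lemma directional_moment_orthogonal_le:
  fixes e l t :: "'a::euclidean_space"
  assumes e: "norm e = 1" and l: "norm l = 1" and t: "norm t = 1" and te: "t \<bullet> e = 0"
  shows "directional_moment f q e t \<le> directional_moment f q e l"
proof -
  define m where "m = l - (l \<bullet> e) *\<^sub>R e"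
  \<comment> \<open>If \<open>l\<close> is parallel to \<open>e\<close> there is no distinguished
    orthogonal direction, and \<open>t\<close> itself is taken.\<close>
  define s where "s = (if m = 0 then t else sgn m)"
  define \<alpha> \<beta> where "\<alpha> = l \<bullet> e" and "\<beta> = norm m"
  have ee: "e \<bullet> e = 1" using e by (simp add: dot_square_norm)
  have me: "m \<bullet> e = 0" by (simp add: m_def inner_simps ee)
  have s: "norm s = 1" "s \<bullet> e = 0" using t te me by (auto simp: s_def norm_sgn sgn_div_norm)
  have ss: "s \<bullet> s = 1" using s by (simp add: dot_square_norm)
  have lsum: "l = \<alpha> *\<^sub>R e + \<beta> *\<^sub>R s" by (auto simp: \<alpha>_def \<beta>_def s_def m_def sgn_div_norm)
  have "l \<bullet> l = \<alpha>\<^sup>2 + \<beta>\<^sup>2"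
    unfolding lsum using s(2) by (simp add: inner_simps ee ss inner_commute power2_eq_square)
  then have ab: "\<alpha>\<^sup>2 + \<beta>\<^sup>2 = 1" using l by (simp add: dot_square_norm)
  have "directional_moment f q e s = directional_moment f q e t"
  proof -
    have "reflection (s - t) e = e" using s te by (intro reflection_orthogonal) (simp add: inner_simps inner_commute)
    then show ?thesis
      using directional_moment_reflection[of f "s - t" e t] s t by (simp add: reflection_swap)
  qed
  moreover have "directional_moment f q e s \<le> directional_moment f q e l"
  proof -
    let ?v = "l - s"
    have Rl: "reflection ?v l = s" using l s by (simp add: reflection_swap)
    \<comment> \<open>Both \<open>e\<close>, \<open>s\<close> and their mirror images
      \<open>reflection ?v e\<close>, \<open>l\<close> are orthonormal bases of the same plane, so
      the squared coordinates of \<open>z\<close> have equal sums. This is the required identity,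
      rearranged.\<close>
    have "(z \<bullet> e)\<^sup>2 - (z \<bullet> reflection ?v e)\<^sup>2 = (z \<bullet> l)\<^sup>2 - (z \<bullet> reflection ?v l)\<^sup>2" for z
    proof (cases "\<beta> = 1")
      \<comment> \<open>Here \<open>l = s\<close>, the normal vector \<open>?v\<close> vanishes, and
        the denominator \<open>2 * (1 - \<beta>)\<close> of the other case would be zero.\<close>
      case True
      then have "\<alpha> = 0" using ab by simp
      then have "l = s" using True lsum by simp
      then show ?thesis using Rl by (simp add: reflection_def)
    next
      case False
      have ev: "e \<bullet> ?v = \<alpha>" using s(2) by (simp add: inner_simps \<alpha>_def inner_commute)
      have "l \<bullet> s = \<beta>" unfolding lsum using s(2) by (simp add: inner_simps ss inner_commute)
      then have vv: "?v \<bullet> ?v = 2 * (1 - \<beta>)"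
        using l ss unfolding inner_diff_left inner_diff_right by (simp add: inner_commute dot_square_norm)
      define k where "k = 2 * \<alpha> / (2 * (1 - \<beta>))"
      have k: "k * (1 - \<beta>) = \<alpha>" using False by (simp add: k_def field_simps)
      have zl: "z \<bullet> l = \<alpha> * (z \<bullet> e) + \<beta> * (z \<bullet> s)" by (subst lsum) (simp add: inner_simps)
      have ze: "z \<bullet> reflection ?v e = z \<bullet> e - k * (z \<bullet> l - z \<bullet> s)"
        unfolding reflection_def ev vv k_def by (simp add: inner_simps)
      have ka: "k * \<alpha> = 1 + \<beta>"
      proof -
        have "(1 - \<beta>) * (k * \<alpha>) = k * (1 - \<beta>) * \<alpha>" by simp
        also have "\<dots> = (1 - \<beta>) * (1 + \<beta>)" unfolding k using ab by (simp add: power2_eq_square algebra_simps)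
        finally show ?thesis using False by simp
      qed
      have "k * (z \<bullet> l - z \<bullet> s) = k * \<alpha> * (z \<bullet> e) - k * (1 - \<beta>) * (z \<bullet> s)"
        unfolding zl by (simp add: algebra_simps)
      then have "z \<bullet> reflection ?v e = \<alpha> * (z \<bullet> s) - \<beta> * (z \<bullet> e)"
        unfolding ze k ka by (simp add: algebra_simps)
      moreover have "(z \<bullet> e)\<^sup>2 - (\<alpha> * (z \<bullet> s) - \<beta> * (z \<bullet> e))\<^sup>2 - ((\<alpha> * (z \<bullet> e) + \<beta> * (z \<bullet> s))\<^sup>2 - (z \<bullet> s)\<^sup>2)
          = (1 - (\<alpha>\<^sup>2 + \<beta>\<^sup>2)) * ((z \<bullet> e)\<^sup>2 + (z \<bullet> s)\<^sup>2)"
        by (simp add: power2_eq_square algebra_simps)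
      ultimately show ?thesis unfolding Rl zl ab by simp
    qed
    from directional_moment_polarization[OF e l this] show ?thesis by (simp add: Rl)
  qed
  ultimately show ?thesis by simp
qed

end

section \<open>Duality of Lebesgue spaces\<close>

lemma conjugate_exponent_1: "conjugate_exponent (ennreal 1) = \<infinity>"
  by (simp add: conjugate_exponent_def)

lemma conjugate_exponent_real:
  assumes "1 < q" shows "conjugate_exponent (ennreal q) = ennreal (q / (q - 1))"
proof -
  have "1 - inverse (ennreal q) = ennreal ((q - 1) / q)"
    using assms by (simp add: inverse_ennreal ennreal_minus field_simps flip: ennreal_1)
  then show ?thesis using assms by (simp add: conjugate_exponent_def inverse_ennreal)
qed

lemma Lp_norm_nonneg: "0 \<le> Lp_norm p M f"
  by (simp add: Lp_norm_def)

lemma Lp_space_infinity_AE: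
  assumes "f \<in> Lp_space \<infinity> M"
  shows "AE y in M. \<bar>f y\<bar> \<le> Lp_norm \<infinity> M f"
  using esssup_AE[of "\<lambda>y. ennreal \<bar>f y\<bar>" M]
proof eventually_elim
  case (elim y)
  have "esssup M (\<lambda>y. ennreal \<bar>f y\<bar>) < top" using assms by (simp add: Lp_space_def)
  then have "ennreal \<bar>f y\<bar> \<le> ennreal (Lp_norm \<infinity> M f)" using elim by (simp add: Lp_norm_def)
  then show ?case by (simp add: Lp_norm_nonneg ennreal_le_iff)
qed

lemma Hoelder_integrable:
  fixes k \<phi> :: "'b \<Rightarrow> real"
  assumes q: "1 \<le> q" and [measurable]: "k \<in> borel_measurable M"
    and k: "integrable M (\<lambda>y. \<bar>k y\<bar> powr q)"
    and \<phi>: "\<phi> \<in> Lp_space (conjugate_exponent (ennreal q)) M"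
  shows "integrable M (\<lambda>y. k y * \<phi> y)"
proof (cases "q = 1")
  case True
  then have \<phi>: "\<phi> \<in> Lp_space \<infinity> M" using \<phi> conjugate_exponent_1 by simp
  then have [measurable]: "\<phi> \<in> borel_measurable M" by (simp add: Lp_space_def)
  have "integrable M (\<lambda>y. \<bar>k y\<bar> * Lp_norm \<infinity> M \<phi>)" using k True by simp
  then show ?thesis
  proof (rule Bochner_Integration.integrable_bound)
    show "AE y in M. norm (k y * \<phi> y) \<le> norm (\<bar>k y\<bar> * Lp_norm \<infinity> M \<phi>)"
      using Lp_space_infinity_AE[OF \<phi>]
      by eventually_elim (auto simp: abs_mult Lp_norm_nonneg intro!: mult_left_mono)
  qed measurable
next
  case False
  define p where "p = q / (q - 1)"
  have q1: "1 < q" using q False by simp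
  have p: "1 < p" "1 / q + 1 / p = 1" using q1 by (auto simp: p_def field_simps)
  have \<phi>: "\<phi> \<in> Lp_space (ennreal p) M" using \<phi> conjugate_exponent_real[OF q1] by (simp add: p_def)
  then have [measurable]: "\<phi> \<in> borel_measurable M" by (simp add: Lp_space_def)
  have i: "integrable M (\<lambda>y. \<bar>\<phi> y\<bar> powr p)" using \<phi> p by (simp add: Lp_space_def)
  have "integrable M (\<lambda>y. \<bar>k y\<bar> powr q / q + \<bar>\<phi> y\<bar> powr p / p)" using k i by simp
  then show ?thesis
  proof (rule Bochner_Integration.integrable_bound)
    show "AE y in M. norm (k y * \<phi> y) \<le> norm (\<bar>k y\<bar> powr q / q + \<bar>\<phi> y\<bar> powr p / p)"
      using Youngs_inequality[OF q1 p] by (auto simp: abs_mult intro!: AE_I2 order_trans[OF _ abs_ge_self])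
  qed measurable
qed

text \<open>Young's inequality is applied after both factors are divided by their norms; for
  \<open>q = 1\<close> the dual exponent is infinite and the essential bound is used
  directly.\<close>

lemma Hoelder_inequality:
  fixes k \<phi> :: "'b \<Rightarrow> real"
  assumes q: "1 \<le> q" and [measurable]: "k \<in> borel_measurable M"
    and k: "integrable M (\<lambda>y. \<bar>k y\<bar> powr q)"
    and \<phi>: "\<phi> \<in> Lp_space (conjugate_exponent (ennreal q)) M"
  shows "\<bar>\<integral>y. k y * \<phi> y \<partial>M\<bar> \<le>
    (\<integral>y. \<bar>k y\<bar> powr q \<partial>M) powr (1 / q) * Lp_norm (conjugate_exponent (ennreal q)) M \<phi>"
proof (cases "q = 1")
  case True
  then have \<phi>': "\<phi> \<in> Lp_space \<infinity> M" using \<phi> conjugate_exponent_1 by simp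
  have [measurable]: "\<phi> \<in> borel_measurable M" using \<phi> by (simp add: Lp_space_def)
  have ki: "integrable M (\<lambda>y. \<bar>k y\<bar>)" using k True by simp
  have "\<bar>\<integral>y. k y * \<phi> y \<partial>M\<bar> \<le> (\<integral>y. \<bar>k y * \<phi> y\<bar> \<partial>M)" by (rule integral_abs_bound)
  also have "\<dots> \<le> (\<integral>y. \<bar>k y\<bar> * Lp_norm \<infinity> M \<phi> \<partial>M)"
  proof (rule integral_mono_AE)
    show "AE y in M. \<bar>k y * \<phi> y\<bar> \<le> \<bar>k y\<bar> * Lp_norm \<infinity> M \<phi>"
      using Lp_space_infinity_AE[OF \<phi>'] by eventually_elim (auto simp: abs_mult intro!: mult_left_mono)
    show "integrable M (\<lambda>y. \<bar>k y * \<phi> y\<bar>)"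
      using Hoelder_integrable[OF q _ k \<phi>] by simp
  qed (use ki in simp)
  also have "\<dots> = (\<integral>y. \<bar>k y\<bar> \<partial>M) * Lp_norm \<infinity> M \<phi>" by simp
  finally show ?thesis using True conjugate_exponent_1 by simp
next
  case False
  define p where "p = q / (q - 1)"
  have q1: "1 < q" using q False by simp
  have p: "1 < p" "1 / q + 1 / p = 1" using q1 by (auto simp: p_def field_simps)
  have cp: "conjugate_exponent (ennreal q) = ennreal p" using conjugate_exponent_real[OF q1] by (simp add: p_def)
  have \<phi>': "\<phi> \<in> Lp_space (ennreal p) M" using \<phi> cp by simp
  then have [measurable]: "\<phi> \<in> borel_measurable M" by (simp add: Lp_space_def)
  have i: "integrable M (\<lambda>y. \<bar>\<phi> y\<bar> powr p)" using \<phi>' p by (simp add: Lp_space_def)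
  define X Y where "X = (\<integral>y. \<bar>k y\<bar> powr q \<partial>M)" and "Y = (\<integral>y. \<bar>\<phi> y\<bar> powr p \<partial>M)"
  have nn: "0 \<le> X" "0 \<le> Y" by (simp_all add: X_def Y_def)
  have norm: "Lp_norm (conjugate_exponent (ennreal q)) M \<phi> = Y powr (1 / p)"
    using p by (simp add: cp Lp_norm_def Y_def)
  have kp: "integrable M (\<lambda>y. k y * \<phi> y)" by (rule Hoelder_integrable[OF q _ k \<phi>]) simp
  have "\<bar>\<integral>y. k y * \<phi> y \<partial>M\<bar> \<le> X powr (1 / q) * Y powr (1 / p)"
  proof (cases "X = 0 \<or> Y = 0")
    case True
    \<comment> \<open>The normalization is impossible when a norm is zero, but then the product
      vanishes almost everywhere.\<close>
    then have "AE y in M. k y * \<phi> y = 0"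
    proof
      assume "X = 0"
      then have "AE y in M. \<bar>k y\<bar> powr q = 0"
        using k by (subst integral_nonneg_eq_0_iff_AE[symmetric]) (auto simp: X_def)
      then show ?thesis by eventually_elim simp
    next
      assume "Y = 0"
      then have "AE y in M. \<bar>\<phi> y\<bar> powr p = 0"
        using i by (subst integral_nonneg_eq_0_iff_AE[symmetric]) (auto simp: Y_def)
      then show ?thesis by eventually_elim simp
    qed
    then have "(\<integral>y. k y * \<phi> y \<partial>M) = 0" by (subst integral_cong_AE[where g = "\<lambda>_. 0"]) auto
    then show ?thesis by simp
  next
    case False
    define a b where "a = X powr (1 / q)" and "b = Y powr (1 / p)"
    have ab: "0 < a" "0 < b" using False nn by (auto simp: a_def b_def)
    have pw: "a powr q = X" "b powr p = Y" using nn q1 p by (auto simp: a_def b_def powr_powr)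
    have "(\<integral>y. \<bar>k y * \<phi> y\<bar> \<partial>M) / (a * b) = (\<integral>y. (\<bar>k y\<bar> / a) * (\<bar>\<phi> y\<bar> / b) \<partial>M)"
      by (simp add: abs_mult)
    also have "\<dots> \<le> (\<integral>y. \<bar>k y\<bar> powr q / (X * q) + \<bar>\<phi> y\<bar> powr p / (Y * p) \<partial>M)"
    proof (rule integral_mono)
      show "integrable M (\<lambda>y. (\<bar>k y\<bar> / a) * (\<bar>\<phi> y\<bar> / b))"
        using integrable_abs[OF kp] by (simp add: abs_mult)
      show "integrable M (\<lambda>y. \<bar>k y\<bar> powr q / (X * q) + \<bar>\<phi> y\<bar> powr p / (Y * p))" using k i by simp
      show "\<bar>k y\<bar> / a * (\<bar>\<phi> y\<bar> / b) \<le> \<bar>k y\<bar> powr q / (X * q) + \<bar>\<phi> y\<bar> powr p / (Y * p)" for y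
        using Youngs_inequality[OF q1 p, of "\<bar>k y\<bar> / a" "\<bar>\<phi> y\<bar> / b"] ab
        by (simp add: powr_divide pw)
    qed
    also have "\<dots> = X / (X * q) + Y / (Y * p)" using k i by (simp add: X_def Y_def)
    also have "\<dots> = 1" using False p by simp
    finally have "(\<integral>y. \<bar>k y * \<phi> y\<bar> \<partial>M) \<le> a * b" using ab by (simp add: field_simps)
    moreover have "\<bar>\<integral>y. k y * \<phi> y \<partial>M\<bar> \<le> (\<integral>y. \<bar>k y * \<phi> y\<bar> \<partial>M)" by (rule integral_abs_bound)
    ultimately show ?thesis unfolding a_def[symmetric] b_def[symmetric] by linarith
  qed
  then show ?thesis unfolding norm by (simp add: X_def)
qed

text \<open>This forces admissible constants to be nonnegative. If every norm were zero, the
  estimates would hold for all real constants and there would be no least one.\<close>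

lemma ex_Lp_norm_pos:
  assumes q: "1 \<le> q" and A: "A \<in> sets M" "emeasure M A \<noteq> 0" "emeasure M A \<noteq> top"
  shows "\<exists>\<phi> \<in> Lp_space (conjugate_exponent (ennreal q)) M.
    0 < Lp_norm (conjugate_exponent (ennreal q)) M \<phi>"
proof -
  let ?I = "indicator A :: _ \<Rightarrow> real"
  have pw: "?I y powr p = ?I y" if "p > 0" for y p using that by (simp add: indicator_def)
  have i: "integrable M ?I" using A by (simp add: less_top)
  show ?thesis
  proof (cases "q = 1")
    case True
    have le: "esssup M (\<lambda>y. ennreal \<bar>?I y\<bar>) \<le> 1"
      using A(1) by (intro esssup_I) (auto simp: indicator_def)
    then have mem: "?I \<in> Lp_space \<infinity> M" using A(1) by (auto simp: Lp_space_def intro: le_less_trans)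
    have "Lp_norm \<infinity> M ?I \<noteq> 0"
    proof
      assume "Lp_norm \<infinity> M ?I = 0"
      then have "AE y in M. y \<notin> A"
        using Lp_space_infinity_AE[OF mem] by (auto elim!: eventually_mono simp: indicator_def split: if_splits)
      then show False using A by (simp add: AE_iff_null_sets[OF A(1), symmetric] null_sets_def)
    qed
    then show ?thesis
      using mem True Lp_norm_nonneg[of \<infinity> M ?I]
      by (intro bexI[of _ ?I]) (auto simp: conjugate_exponent_1 simp del: ennreal_1)
  next
    case False
    then have "1 < q" using q by simp
    moreover from this have "0 < q / (q - 1)" by simp
    ultimately show ?thesis using A i
      by (intro bexI[of _ ?I])
        (auto simp: conjugate_exponent_real Lp_norm_def Lp_space_def pw measure_def enn2real_eq_0_iff)
  qed
qed

text \<open>The extremal function is \<open>sgn k * \<bar>k\<bar> powr (q - 1)\<close>.\<close>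

lemma Lp_operator_norm_iff:
  fixes k :: "'b \<Rightarrow> real"
  assumes q: "1 \<le> q" and [measurable]: "k \<in> borel_measurable M"
    and k: "integrable M (\<lambda>y. \<bar>k y\<bar> powr q)"
    and A: "A \<in> sets M" "emeasure M A \<noteq> 0" "emeasure M A \<noteq> top"
  shows "(\<forall>\<phi>\<in>Lp_space (conjugate_exponent (ennreal q)) M.
      \<bar>\<integral>y. k y * \<phi> y \<partial>M\<bar> \<le> C * Lp_norm (conjugate_exponent (ennreal q)) M \<phi>) \<longleftrightarrow>
    (\<integral>y. \<bar>k y\<bar> powr q \<partial>M) powr (1 / q) \<le> C"
    (is "?L \<longleftrightarrow> ?N \<le> C")
proof
  assume "?N \<le> C"
  then show ?L
    using Hoelder_inequality[OF q _ k] by (meson Lp_norm_nonneg assms(2) mult_right_mono order_trans)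
next
  assume L: ?L
  let ?p = "conjugate_exponent (ennreal q)"
  define X where "X = (\<integral>y. \<bar>k y\<bar> powr q \<partial>M)"
  have X: "0 \<le> X" by (simp add: X_def)
  have C: "0 \<le> C"
  proof -
    obtain \<phi> where "\<phi> \<in> Lp_space ?p M" "0 < Lp_norm ?p M \<phi>" using ex_Lp_norm_pos[OF q A] by blast
    then show ?thesis using L by (metis abs_ge_zero order_trans zero_le_mult_iff not_less)
  qed
  define \<phi> where "\<phi> y = sgn (k y) * \<bar>k y\<bar> powr (q - 1)" for y
  have [measurable]: "\<phi> \<in> borel_measurable M" unfolding \<phi>_def by measurable
  have prod: "k y * \<phi> y = \<bar>k y\<bar> powr q" for y
  proof -
    have "k y * \<phi> y = \<bar>k y\<bar> * \<bar>k y\<bar> powr (q - 1)" by (simp add: \<phi>_def sgn_if)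
    also have "\<dots> = \<bar>k y\<bar> powr q" by (cases "k y = 0") (auto simp: powr_mult_base)
    finally show ?thesis .
  qed
  \<comment> \<open>For \<open>q = 1\<close> the function \<open>\<phi>\<close> is the sign of
    \<open>k\<close> and the bound reads \<open>X powr 0\<close>, which equals 1 only for nonzero
    \<open>X\<close>.\<close>
  have \<phi>: "\<phi> \<in> Lp_space ?p M \<and> Lp_norm ?p M \<phi> \<le> X powr ((q - 1) / q)" if "X \<noteq> 0"
  proof (cases "q = 1")
    case True
    have "\<bar>\<phi> y\<bar> \<le> 1" for y using True by (auto simp: \<phi>_def sgn_if)
    then have "esssup M (\<lambda>y. ennreal \<bar>\<phi> y\<bar>) \<le> 1" by (intro esssup_I) auto
    moreover from this have "enn2real (esssup M (\<lambda>y. ennreal \<bar>\<phi> y\<bar>)) \<le> 1"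
      by (metis enn2real_mono enn2real_1 ennreal_one_less_top)
    ultimately show ?thesis
      using True that by (auto simp: conjugate_exponent_1 Lp_space_def Lp_norm_def simp del: ennreal_1 intro: le_less_trans)
  next
    case False
    define p where "p = q / (q - 1)"
    have q1: "1 < q" using q False by simp
    have p: "1 < p" using q1 by (auto simp: p_def field_simps)
    have cp: "?p = ennreal p" using conjugate_exponent_real[OF q1] by (simp add: p_def)
    have "\<bar>\<phi> y\<bar> = \<bar>k y\<bar> powr (q - 1)" for y by (auto simp: \<phi>_def abs_mult sgn_if)
    then have "\<bar>\<phi> y\<bar> powr p = \<bar>k y\<bar> powr q" for y using q1 by (simp add: powr_powr p_def)
    then show ?thesis unfolding cp using k p q1
      by (auto simp: Lp_space_def Lp_norm_def X_def p_def)
  qed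
  show "?N \<le> C"
  proof (cases "X = 0")
    case True
    then show ?thesis using C by (simp add: X_def)
  next
    case False
    have "X = \<bar>\<integral>y. k y * \<phi> y \<partial>M\<bar>" unfolding prod X_def[symmetric] using X by simp
    also have "\<dots> \<le> C * Lp_norm ?p M \<phi>" using L \<phi>[OF False] by blast
    also have "\<dots> \<le> C * X powr ((q - 1) / q)" using C \<phi>[OF False] by (intro mult_left_mono) auto
    finally have le: "X \<le> C * X powr ((q - 1) / q)" .
    have "X powr (1 / q) * X powr ((q - 1) / q) = X"
      using False X q by (simp flip: powr_add add_divide_distrib)
    with le have "X powr (1 / q) * X powr ((q - 1) / q) \<le> C * X powr ((q - 1) / q)" by simp
    moreover have "0 < X powr ((q - 1) / q)" using False by simp
    ultimately show ?thesis unfolding X_def by (simp only: mult_le_cancel_right_pos)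
  qed
qed

text \<open>The admissible constants form a closed half-line, whose left end is the norm of the
  functional dual to \<open>K y \<bullet> l\<close>; hence \<open>LEAST\<close> is attained.\<close>

lemma sharp_const_dir_eq:
  fixes K :: "'b \<Rightarrow> 'a::euclidean_space"
  assumes q: "1 \<le> q" and [measurable]: "K \<in> borel_measurable M"
    and K: "\<And>l. integrable M (\<lambda>y. \<bar>K y \<bullet> l\<bar> powr q)"
    and A: "A \<in> sets M" "emeasure M A \<noteq> 0" "emeasure M A \<noteq> top"
    and grad: "\<And>\<phi> l. \<phi> \<in> Lp_space (conjugate_exponent (ennreal q)) M \<Longrightarrow>
      grad (P \<phi>) x \<bullet> l = (\<integral>y. (K y \<bullet> l) * \<phi> y \<partial>M)"
  shows "sharp_const_dir M P (ennreal q) x l = (\<integral>y. \<bar>K y \<bullet> l\<bar> powr q \<partial>M) powr (1 / q)"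
proof -
  have "(\<forall>\<phi>\<in>Lp_space (conjugate_exponent (ennreal q)) M.
      \<bar>grad (P \<phi>) x \<bullet> l\<bar> \<le> C * Lp_norm (conjugate_exponent (ennreal q)) M \<phi>) \<longleftrightarrow>
      (\<integral>y. \<bar>K y \<bullet> l\<bar> powr q \<partial>M) powr (1 / q) \<le> C" for C
    by (subst Lp_operator_norm_iff[OF q _ K A, symmetric]) (auto simp: grad)
  then show ?thesis unfolding sharp_const_dir_def by (auto intro!: Least_equality)
qed

text \<open>The norm of a gradient is its component along its own direction. That direction varies
  with \<open>\<phi>\<close>, but by \<open>max\<close> its constant never exceeds the one for
  \<open>e\<close>; Cauchy-Schwarz gives the converse.\<close>

lemma sharp_const_eq:
  fixes K :: "'b \<Rightarrow> 'a::euclidean_space"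
  assumes q: "1 \<le> q" and [measurable]: "K \<in> borel_measurable M"
    and K: "\<And>l. integrable M (\<lambda>y. \<bar>K y \<bullet> l\<bar> powr q)"
    and A: "A \<in> sets M" "emeasure M A \<noteq> 0" "emeasure M A \<noteq> top"
    and grad: "\<And>\<phi> l. \<phi> \<in> Lp_space (conjugate_exponent (ennreal q)) M \<Longrightarrow>
      grad (P \<phi>) x \<bullet> l = (\<integral>y. (K y \<bullet> l) * \<phi> y \<partial>M)"
    and e: "norm e = 1" and max: "\<And>l. norm l = 1 \<Longrightarrow>
      (\<integral>y. \<bar>K y \<bullet> l\<bar> powr q \<partial>M) \<le> (\<integral>y. \<bar>K y \<bullet> e\<bar> powr q \<partial>M)"
  shows "sharp_const M P (ennreal q) x = (\<integral>y. \<bar>K y \<bullet> e\<bar> powr q \<partial>M) powr (1 / q)"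
proof -
  let ?p = "conjugate_exponent (ennreal q)" and ?N = "\<lambda>l. (\<integral>y. \<bar>K y \<bullet> l\<bar> powr q \<partial>M) powr (1 / q)"
  have dir: "(\<forall>\<phi>\<in>Lp_space ?p M. \<bar>grad (P \<phi>) x \<bullet> l\<bar> \<le> C * Lp_norm ?p M \<phi>) \<longleftrightarrow> ?N l \<le> C" for C l
    by (subst Lp_operator_norm_iff[OF q _ K A, symmetric]) (auto simp: grad)
  have "(\<forall>\<phi>\<in>Lp_space ?p M. norm (grad (P \<phi>) x) \<le> C * Lp_norm ?p M \<phi>) \<longleftrightarrow> ?N e \<le> C" for C
  proof
    assume "\<forall>\<phi>\<in>Lp_space ?p M. norm (grad (P \<phi>) x) \<le> C * Lp_norm ?p M \<phi>"
    then have "\<forall>\<phi>\<in>Lp_space ?p M. \<bar>grad (P \<phi>) x \<bullet> e\<bar> \<le> C * Lp_norm ?p M \<phi>"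
      using Cauchy_Schwarz_ineq2[of _ e] e by (fastforce intro: order_trans)
    then show "?N e \<le> C" using dir by simp
  next
    assume C: "?N e \<le> C"
    show "\<forall>\<phi>\<in>Lp_space ?p M. norm (grad (P \<phi>) x) \<le> C * Lp_norm ?p M \<phi>"
    proof
      fix \<phi> assume \<phi>: "\<phi> \<in> Lp_space ?p M"
      let ?g = "grad (P \<phi>) x"
      show "norm ?g \<le> C * Lp_norm ?p M \<phi>"
      proof (cases "?g = 0")
        case True
        have "0 \<le> C" using C by (rule order_trans[rotated]) simp
        then show ?thesis using True by (simp add: Lp_norm_nonneg)
      next
        case False
        then have n: "norm (sgn ?g) = 1" by (simp add: norm_sgn)
        have "?N (sgn ?g) \<le> ?N e" using max[OF n] q by (intro powr_mono2) auto
        then have "\<bar>?g \<bullet> sgn ?g\<bar> \<le> C * Lp_norm ?p M \<phi>" using dir C \<phi> by (meson order_trans)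
        moreover have "?g \<bullet> sgn ?g = norm ?g"
          using False by (simp add: sgn_div_norm dot_square_norm power2_eq_square)
        ultimately show ?thesis by simp
      qed
    qed
  qed
  then show ?thesis unfolding sharp_const_def by (auto intro!: Least_equality)
qed

section \<open>Kernels with conformal gradient\<close>

text \<open>Both \<open>c + u\<close> and \<open>c - u\<close> are convex combinations of
  \<open>c + v\<close> and \<open>c - v\<close>, with weights exchanged. Convexity is used on the
  open half-line, so \<open>v = c\<close> is treated apart, through
  \<open>s powr a + (1 - s) powr a \<le> 1\<close>.\<close>

lemma sum_powr_symmetric_mono:
  fixes a c u v :: real
  assumes a: "1 \<le> a" and uv: "0 \<le> u" "u \<le> v" "v \<le> c"
  shows "(c + u) powr a + (c - u) powr a \<le> (c + v) powr a + (c - v) powr a"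
proof (cases "u = v")
  case False
  then have v: "0 < v" "u < v" using uv by auto
  define s where "s = (v + u) / (2 * v)"
  have s: "0 \<le> s" "s \<le> 1" "0 \<le> 1 - s" using uv v by (auto simp: s_def field_simps)
  have sv: "2 * (s * v) = v + u" using v by (simp add: s_def)
  show ?thesis
  proof (cases "v = c")
    case True
    have le: "x powr a \<le> x" if "0 \<le> x" "x \<le> 1" for x :: real
      using powr_mono'[of 1 a x] a that by simp
    have "c + u = s * (2 * c)" "c - u = (1 - s) * (2 * c)" using sv True by (auto simp: algebra_simps)
    moreover have "(s * (2 * c)) powr a = s powr a * (2 * c) powr a"
      "((1 - s) * (2 * c)) powr a = (1 - s) powr a * (2 * c) powr a"
      using s uv by (auto intro!: powr_mult)
    ultimately have "(c + u) powr a + (c - u) powr a = (s powr a + (1 - s) powr a) * (2 * c) powr a"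
      by (simp only: distrib_right)
    also have "\<dots> \<le> 1 * (2 * c) powr a"
      using le[of s] le[of "1 - s"] s by (intro mult_right_mono) auto
    finally show ?thesis using True by simp
  next
    case False
    then have pos: "c + v \<in> {0<..}" "c - v \<in> {0<..}" using uv v by auto
    have e: "(1 - s) * (c + v) + s * (c - v) = c - u" "(1 - s) * (c - v) + s * (c + v) = c + u"
      using sv by (auto simp: algebra_simps)
    have "(c - u) powr a \<le> (1 - s) * (c + v) powr a + s * (c - v) powr a"
      using convex_onD[OF powr_convex[OF a] s(1,2) pos] by (simp add: e)
    moreover have "(c + u) powr a \<le> (1 - s) * (c - v) powr a + s * (c + v) powr a"
      using convex_onD[OF powr_convex[OF a] s(1,2) pos(2,1)] by (simp add: e)
    ultimately show ?thesis by (simp add: algebra_simps)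
  qed
qed simp

text \<open>The case \<open>a = 0\<close> is separate because \<open>0 powr 0 = 0\<close> would make the even part decrease at the
  boundary when \<open>\<bar>\<sigma>\<bar> = \<gamma>\<close>.\<close>

definition boundary_weight :: "real \<Rightarrow> real \<Rightarrow> real \<Rightarrow> real \<Rightarrow> real" where
  "boundary_weight \<gamma> \<sigma> a s = (if a = 0 then 1 else (\<gamma> + \<sigma> * s) powr a)"

text \<open>On [-1, 1] the base lies between 0 and \<open>2 * \<gamma>\<close>, and the extra 1 in
  the bound covers \<open>a = 0\<close>. For \<open>a \<ge> 1\<close> the even part is a symmetric
  sum of powers about \<open>\<gamma>\<close> with offset
  \<open>\<bar>\<sigma> * s\<bar>\<close>.\<close>

lemma even_increasing_boundary_weight:
  assumes g: "\<bar>\<sigma>\<bar> \<le> \<gamma>" and a: "a = 0 \<or> 1 \<le> a" and q: "0 \<le> q"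
  shows "even_increasing (boundary_weight \<gamma> \<sigma> a) q (1 + (2 * \<gamma>) powr a)"
proof
  have sb: "\<bar>\<sigma> * s\<bar> \<le> \<gamma>" if "\<bar>s\<bar> \<le> 1" for s
    using that g mult_mono[of "\<bar>\<sigma>\<bar>" \<gamma> "\<bar>s\<bar>" 1] by (simp add: abs_mult)
  show "boundary_weight \<gamma> \<sigma> a \<in> borel_measurable borel" unfolding boundary_weight_def by measurable
  show "\<bar>boundary_weight \<gamma> \<sigma> a s\<bar> \<le> 1 + (2 * \<gamma>) powr a" if "\<bar>s\<bar> \<le> 1" for s
  proof (cases "a = 0")
    case False
    have "(\<gamma> + \<sigma> * s) powr a \<le> (2 * \<gamma>) powr a" using sb[OF that] a False by (intro powr_mono2) auto
    then show ?thesis using False by (simp add: boundary_weight_def)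
  qed (simp add: boundary_weight_def)
  show "boundary_weight \<gamma> \<sigma> a s + boundary_weight \<gamma> \<sigma> a (- s) \<le> boundary_weight \<gamma> \<sigma> a t + boundary_weight \<gamma> \<sigma> a (- t)"
    if "\<bar>s\<bar> \<le> \<bar>t\<bar>" "\<bar>t\<bar> \<le> 1" for s t
  proof (cases "a = 0")
    case False
    have e: "boundary_weight \<gamma> \<sigma> a r + boundary_weight \<gamma> \<sigma> a (- r) = (\<gamma> + \<bar>\<sigma> * r\<bar>) powr a + (\<gamma> - \<bar>\<sigma> * r\<bar>) powr a" for r
      using False by (auto simp: boundary_weight_def abs_if)
    show ?thesis unfolding e
      using that sb[of t] a False by (intro sum_powr_symmetric_mono) (auto simp: abs_mult intro: mult_left_mono)
  qed (simp add: boundary_weight_def)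
qed (fact q)

text \<open>A kernel whose gradient has, up to a constant, the length \<open>P y ^ m\<close> and the direction \<open>\<omega> y\<close>, where
  \<open>\<omega>\<close> carries the measure \<open>P y ^ m dM\<close> to a multiple of the uniform measure on the sphere.\<close>

locale conformal_kernel = even_increasing "boundary_weight \<gamma> \<sigma> (real m * (q - 1))" q B
  for \<gamma> \<sigma> q B :: real and m :: nat +
  fixes M :: "'b measure" and P :: "'b \<Rightarrow> real" and \<omega> :: "'b \<Rightarrow> 'a::euclidean_space" and e :: 'a and b C :: real
  assumes q1: "1 \<le> q" and P_meas[measurable]: "P \<in> borel_measurable M"
    and \<omega>_meas[measurable]: "\<omega> \<in> borel_measurable M"
    and P_pos: "\<And>y. y \<in> space M \<Longrightarrow> 0 < P y" and b: "0 < b" and C: "0 \<le> C"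
    and P_eq: "\<And>y. y \<in> space M \<Longrightarrow> P y = b * (\<gamma> + \<sigma> * (\<omega> y \<bullet> e))"
    and norm_e: "norm e = 1"
    and push: "\<And>H. H \<in> borel_measurable borel \<Longrightarrow>
      (\<integral>\<^sup>+y. ennreal (P y ^ m) * H (\<omega> y) \<partial>M) = ennreal C * (\<integral>\<^sup>+z. H (sgn z) \<partial>unit_ball_measure)"
begin

abbreviation "weight \<equiv> boundary_weight \<gamma> \<sigma> (real m * (q - 1))"

text \<open>This is the source of the exponent \<open>m * (q - 1)\<close>: one factor
  \<open>P y ^ m\<close> is kept for the change of measure, and the rest becomes the weight through
  the affine relation \<open>P_eq\<close>.\<close>

lemma power_powr_eq:
  assumes "y \<in> space M"
  shows "(P y ^ m) powr q = P y ^ m * (b powr (real m * (q - 1)) * weight (\<omega> y \<bullet> e))"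
proof -
  have P: "0 < P y" by (rule P_pos[OF assms])
  have "0 < \<gamma> + \<sigma> * (\<omega> y \<bullet> e)" using P b P_eq[OF assms] by (simp add: zero_less_mult_iff)
  then have "P y powr (real m * (q - 1)) = b powr (real m * (q - 1)) * weight (\<omega> y \<bullet> e)"
    using b by (auto simp: P_eq[OF assms] boundary_weight_def powr_mult)
  moreover have "(P y ^ m) powr q = P y ^ m * P y powr (real m * (q - 1))"
    using P by (simp add: powr_powr algebra_simps flip: powr_realpow powr_add)
  ultimately show ?thesis by simp
qed

lemma weight_nonneg: "0 \<le> weight s"
  by (simp add: boundary_weight_def)

lemma weight_moment_bounded: "weight (sgn z \<bullet> e) * \<bar>sgn z \<bullet> l\<bar> powr q \<le> B * norm l powr q"
proof -
  have "\<bar>sgn z \<bullet> l\<bar> \<le> norm (sgn z) * norm l" by (rule Cauchy_Schwarz_ineq2)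
  also have "\<dots> \<le> 1 * norm l" by (intro mult_right_mono) (auto simp: norm_sgn)
  finally have "\<bar>sgn z \<bullet> l\<bar> powr q \<le> norm l powr q" using q by (intro powr_mono2) auto
  moreover have "weight (sgn z \<bullet> e) \<le> B" using bound[OF abs_inner_sgn_le[OF norm_e]] by (simp add: abs_le_iff)
  ultimately show ?thesis using weight_nonneg by (intro mult_mono) (auto intro: order_trans[OF weight_nonneg])
qed

text \<open>It supplies the dominating function on the half-space, whose boundary has infinite
  measure, so that constants are not integrable there.\<close>

lemma integrable_power: "integrable M (\<lambda>y. \<bar>P y ^ m\<bar> powr q)"
proof -
  have "(\<integral>\<^sup>+y. ennreal (\<bar>P y ^ m\<bar> powr q) \<partial>M) =
      (\<integral>\<^sup>+y. ennreal (P y ^ m) * ennreal (b powr (real m * (q - 1)) * weight (\<omega> y \<bullet> e)) \<partial>M)"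
    using P_pos by (intro nn_integral_cong)
      (auto simp: power_powr_eq less_imp_le weight_nonneg simp flip: ennreal_mult)
  also have "\<dots> = ennreal C * (\<integral>\<^sup>+z. ennreal (b powr (real m * (q - 1)) * weight (sgn z \<bullet> e)) \<partial>unit_ball_measure)"
    by (rule push) measurable
  also have "\<dots> \<le> ennreal C * (\<integral>\<^sup>+z. ennreal (b powr (real m * (q - 1)) * B) \<partial>(unit_ball_measure :: 'a measure))"
    using bound[OF abs_inner_sgn_le[OF norm_e]]
    by (intro mult_left_mono nn_integral_mono ennreal_leI) (auto simp: abs_le_iff)
  also have "\<dots> < \<infinity>"
  proof -
    interpret prob_space "unit_ball_measure :: 'a measure" by (rule prob_space_unit_ball_measure)
    show ?thesis by (simp only: nn_integral_const emeasure_space_1) (simp add: ennreal_mult_less_top)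
  qed
  finally show ?thesis by (intro integrableI_bounded) auto
qed

lemma integrable_directional_moment:
  "integrable unit_ball_measure (\<lambda>z. weight (sgn z \<bullet> e) * \<bar>sgn z \<bullet> l\<bar> powr q)"
  by (rule integrable_unit_ball_measure_bounded[where B = "B * norm l powr q"])
    (measurable, use weight_moment_bounded weight_nonneg in \<open>auto simp: abs_mult\<close>)

lemma has_integral_kernel:
  fixes \<kappa> :: real and l :: 'a
  defines "D \<equiv> \<bar>\<kappa>\<bar> powr q * b powr (real m * (q - 1)) * C"
  shows "integrable M (\<lambda>y. \<bar>((\<kappa> * P y ^ m) *\<^sub>R \<omega> y) \<bullet> l\<bar> powr q)"
    and "(\<integral>y. \<bar>((\<kappa> * P y ^ m) *\<^sub>R \<omega> y) \<bullet> l\<bar> powr q \<partial>M) = D * directional_moment weight q e l"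
proof -
  let ?c = "\<bar>\<kappa>\<bar> powr q * b powr (real m * (q - 1))"
  let ?J = "directional_moment weight q e l"
  have D: "0 \<le> D" using C by (simp add: D_def)
  have J: "0 \<le> ?J" unfolding directional_moment_def by (simp add: weight_nonneg)
  have eq: "\<bar>((\<kappa> * P y ^ m) *\<^sub>R \<omega> y) \<bullet> l\<bar> powr q =
      P y ^ m * (?c * (weight (\<omega> y \<bullet> e) * \<bar>\<omega> y \<bullet> l\<bar> powr q))" if "y \<in> space M" for y
  proof -
    have "\<bar>((\<kappa> * P y ^ m) *\<^sub>R \<omega> y) \<bullet> l\<bar> = \<bar>\<kappa>\<bar> * P y ^ m * \<bar>\<omega> y \<bullet> l\<bar>"
      using P_pos[OF that] by (simp add: abs_mult)
    then show ?thesis using P_pos[OF that] by (simp add: powr_mult power_powr_eq[OF that])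
  qed
  have "(\<integral>\<^sup>+y. ennreal (\<bar>((\<kappa> * P y ^ m) *\<^sub>R \<omega> y) \<bullet> l\<bar> powr q) \<partial>M) =
      (\<integral>\<^sup>+y. ennreal (P y ^ m) * ennreal (?c * (weight (\<omega> y \<bullet> e) * \<bar>\<omega> y \<bullet> l\<bar> powr q)) \<partial>M)"
    unfolding ennreal_mult'[symmetric, OF mult_nonneg_nonneg[OF mult_nonneg_nonneg[OF powr_ge_zero powr_ge_zero] mult_nonneg_nonneg[OF weight_nonneg powr_ge_zero]]]
    using eq P_pos by (intro nn_integral_cong) (simp add: less_imp_le weight_nonneg flip: ennreal_mult)
  also have "\<dots> = ennreal C * (\<integral>\<^sup>+z. ennreal (?c * (weight (sgn z \<bullet> e) * \<bar>sgn z \<bullet> l\<bar> powr q)) \<partial>unit_ball_measure)"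
    by (rule push) measurable
  also have "(\<integral>\<^sup>+z. ennreal (?c * (weight (sgn z \<bullet> e) * \<bar>sgn z \<bullet> l\<bar> powr q)) \<partial>unit_ball_measure) = ennreal (?c * ?J)"
    unfolding directional_moment_def using integrable_directional_moment[of l]
    by (subst nn_integral_eq_integral) (auto simp: weight_nonneg)
  also have "ennreal C * ennreal (?c * ?J) = ennreal (D * ?J)"
    using C J by (simp add: D_def mult_ac flip: ennreal_mult)
  finally have nn: "(\<integral>\<^sup>+y. ennreal (\<bar>((\<kappa> * P y ^ m) *\<^sub>R \<omega> y) \<bullet> l\<bar> powr q) \<partial>M) = ennreal (D * ?J)" .
  show "integrable M (\<lambda>y. \<bar>((\<kappa> * P y ^ m) *\<^sub>R \<omega> y) \<bullet> l\<bar> powr q)"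
    by (rule integrableI_bounded) (use nn in auto)
  show "(\<integral>y. \<bar>((\<kappa> * P y ^ m) *\<^sub>R \<omega> y) \<bullet> l\<bar> powr q \<partial>M) = D * ?J"
    by (subst integral_eq_nn_integral) (use nn D J in auto)
qed

theorem sharp_const_comparison:
  fixes \<kappa> :: real and l t v :: 'a
  assumes A: "A \<in> sets M" "emeasure M A \<noteq> 0" "emeasure M A \<noteq> top"
    and grad: "\<And>\<phi> l. \<phi> \<in> Lp_space (conjugate_exponent (ennreal q)) M \<Longrightarrow>
      grad (Op \<phi>) x \<bullet> l = (\<integral>y. (((\<kappa> * P y ^ m) *\<^sub>R \<omega> y) \<bullet> l) * \<phi> y \<partial>M)"
    and l: "norm l = 1" and t: "norm t = 1" "t \<bullet> e = 0" and v: "v \<in> {e, - e}"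
  shows "sharp_const_dir M Op (ennreal q) x t \<le> sharp_const_dir M Op (ennreal q) x l"
    and "sharp_const_dir M Op (ennreal q) x l \<le> sharp_const_dir M Op (ennreal q) x v"
    and "sharp_const_dir M Op (ennreal q) x v = sharp_const M Op (ennreal q) x"
proof -
  let ?K = "\<lambda>y. (\<kappa> * P y ^ m) *\<^sub>R \<omega> y"
  let ?D = "\<bar>\<kappa>\<bar> powr q * b powr (real m * (q - 1)) * C"
  have D: "0 \<le> ?D" using C by simp
  have K: "?K \<in> borel_measurable M" by measurable
  have dir: "sharp_const_dir M Op (ennreal q) x l = (?D * directional_moment weight q e l) powr (1 / q)" for l
    by (subst sharp_const_dir_eq[OF q1 K has_integral_kernel(1) A grad])
      (simp_all only: has_integral_kernel(2))
  have max: "?D * directional_moment weight q e l \<le> ?D * directional_moment weight q e e" if "norm l = 1" for l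
    using D directional_moment_le_parallel[OF norm_e that] by (rule mult_left_mono[rotated])
  have nn: "0 \<le> ?D * directional_moment weight q e l" for l
    using D by (simp add: directional_moment_def weight_nonneg)
  have full: "sharp_const M Op (ennreal q) x = (?D * directional_moment weight q e e) powr (1 / q)"
    by (subst sharp_const_eq[OF q1 K has_integral_kernel(1) A grad norm_e])
      (simp_all only: has_integral_kernel(2) max)
  have vv: "directional_moment weight q e v = directional_moment weight q e e"
    using v by (auto simp: directional_moment_def)
  show "sharp_const_dir M Op (ennreal q) x t \<le> sharp_const_dir M Op (ennreal q) x l"
    unfolding dir using nn D q1 directional_moment_orthogonal_le[OF norm_e l t]
    by (intro powr_mono2 mult_left_mono) auto
  show "sharp_const_dir M Op (ennreal q) x l \<le> sharp_const_dir M Op (ennreal q) x v"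
    unfolding dir vv using nn max[OF l] q1 by (intro powr_mono2) auto
  show "sharp_const_dir M Op (ennreal q) x v = sharp_const M Op (ennreal q) x"
    unfolding dir vv full ..
qed

end

section \<open>Differentiation under the integral\<close>

text \<open>Differentiability is tested along sequences so that dominated convergence applies. The
  mean value inequality turns the gradient bound on the ball into a Lipschitz bound with the same
  \<open>W\<close>.\<close>

lemma GDERIV_integral:
  fixes k :: "'a::euclidean_space \<Rightarrow> 'b \<Rightarrow> real" and D :: "'a \<Rightarrow> 'b \<Rightarrow> 'a" and \<phi> W :: "'b \<Rightarrow> real"
  assumes \<delta>: "0 < \<delta>"
    and deriv: "\<And>z y. z \<in> ball x \<delta> \<Longrightarrow> y \<in> space M \<Longrightarrow> GDERIV (\<lambda>z. k z y) z :> D z y"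
    and bound: "\<And>z y. z \<in> ball x \<delta> \<Longrightarrow> y \<in> space M \<Longrightarrow> norm (D z y) \<le> W y"
    and meas[measurable]: "D x \<in> borel_measurable M" "\<phi> \<in> borel_measurable M"
    and k: "\<And>z. z \<in> ball x \<delta> \<Longrightarrow> integrable M (\<lambda>y. k z y * \<phi> y)"
    and W: "integrable M (\<lambda>y. W y * \<phi> y)"
  shows "GDERIV (\<lambda>z. \<integral>y. k z y * \<phi> y \<partial>M) x :> (\<integral>y. \<phi> y *\<^sub>R D x y \<partial>M)"
proof -
  let ?S = "ball x \<delta>" and ?u = "\<lambda>z. \<integral>y. k z y * \<phi> y \<partial>M" and ?E = "\<integral>y. \<phi> y *\<^sub>R D x y \<partial>M"
  have x: "x \<in> ?S" using \<delta> by simp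
  have W0: "0 \<le> W y" if "y \<in> space M" for y using bound[OF x that] norm_ge_zero order_trans by blast
  have iD: "integrable M (\<lambda>y. \<phi> y *\<^sub>R D x y)"
  proof (rule Bochner_Integration.integrable_bound[OF integrable_abs[OF W]])
    show "AE y in M. norm (\<phi> y *\<^sub>R D x y) \<le> norm \<bar>W y * \<phi> y\<bar>"
      using bound[OF x] W0 by (intro AE_I2) (auto simp: abs_mult mult.commute[of "W _"] intro!: mult_left_mono)
  qed measurable
  have lip: "\<bar>k z y - k x y\<bar> \<le> W y * norm (z - x)" if z: "z \<in> ?S" and y: "y \<in> space M" for z y
    unfolding real_norm_def[symmetric]
  proof (rule differentiable_bound[of ?S])
    fix w assume w: "w \<in> ?S"
    show "((\<lambda>z. k z y) has_derivative (\<lambda>h. h \<bullet> D w y)) (at w within ?S)"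
      using deriv[OF w y] unfolding gderiv_def by (rule has_derivative_at_withinI)
    show "onorm (\<lambda>h. h \<bullet> D w y) \<le> W y"
      using order_trans[OF Cauchy_Schwarz_ineq2 mult_left_mono[OF bound[OF w y] norm_ge_zero]]
      by (intro onorm_bound W0[OF y]) (simp add: mult.commute)
  qed (use z x in auto)
  have "(?u has_derivative (\<lambda>h. h \<bullet> ?E)) (at x within ?S)"
    unfolding has_derivative_iff_norm
  proof (intro conjI)
    show "bounded_linear (\<lambda>h. h \<bullet> ?E)" by (rule bounded_linear_inner_left)
    show "((\<lambda>z. norm (?u z - ?u x - (z - x) \<bullet> ?E) / norm (z - x)) \<longlongrightarrow> 0) (at x within ?S)"
      unfolding tendsto_at_iff_sequentially comp_def
    proof (intro allI impI)
      fix X :: "nat \<Rightarrow> 'a" assume X: "\<forall>i. X i \<in> ?S - {x}" and lim: "X \<longlonglongrightarrow> x"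
      \<comment> \<open>\<open>Q i\<close> is the first-order remainder divided by the step length,
        with the factor \<open>\<phi>\<close> included.\<close>
      define Q where "Q i y = (k (X i) y - k x y - (X i - x) \<bullet> D x y) / norm (X i - x) * \<phi> y" for i y
      have XS: "X i \<in> ?S" "X i \<noteq> x" for i using X by auto
      have iQ: "integrable M (\<lambda>y. k (X i) y * \<phi> y - k x y * \<phi> y - (X i - x) \<bullet> (\<phi> y *\<^sub>R D x y))" for i
        using k[OF XS(1)[of i]] k[OF x] iD by (intro Bochner_Integration.integrable_diff integrable_inner_right)
      have Qe: "Q i y = (k (X i) y * \<phi> y - k x y * \<phi> y - (X i - x) \<bullet> (\<phi> y *\<^sub>R D x y)) / norm (X i - x)" for i y
        by (simp add: Q_def field_simps)
      have intQ: "(\<integral>y. Q i y \<partial>M) = (?u (X i) - ?u x - (X i - x) \<bullet> ?E) / norm (X i - x)" for i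
        unfolding Qe using k[OF XS(1)[of i]] k[OF x] iD
        by (simp add: Bochner_Integration.integral_diff integral_inner_right integrable_inner_right del: inner_scaleR_right)
      have "(\<lambda>i. \<integral>y. Q i y \<partial>M) \<longlonglongrightarrow> (\<integral>y. 0 \<partial>M)"
      proof (rule integral_dominated_convergence[where w = "\<lambda>y. 2 * \<bar>W y * \<phi> y\<bar>"])
        show "(\<lambda>y. 0) \<in> borel_measurable M" by simp
        show "Q i \<in> borel_measurable M" for i
          using borel_measurable_integrable[OF iQ[of i]] unfolding Qe[abs_def] by measurable
        show "integrable M (\<lambda>y. 2 * \<bar>W y * \<phi> y\<bar>)" using W by simp
        show "AE y in M. (\<lambda>i. Q i y) \<longlonglongrightarrow> 0"
        proof (rule AE_I2)
          fix y assume y: "y \<in> space M"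
          have "((\<lambda>z. k z y) has_derivative (\<lambda>h. h \<bullet> D x y)) (at x within ?S)"
            using deriv[OF x y] unfolding gderiv_def by (rule has_derivative_at_withinI)
          then have "((\<lambda>z. norm (k z y - k x y - (z - x) \<bullet> D x y) / norm (z - x)) \<longlongrightarrow> 0) (at x within ?S)"
            unfolding has_derivative_iff_norm by blast
          then have "(\<lambda>i. norm (k (X i) y - k x y - (X i - x) \<bullet> D x y) / norm (X i - x)) \<longlonglongrightarrow> 0"
            unfolding tendsto_at_iff_sequentially comp_def using X lim by blast
          then have "(\<lambda>i. norm (k (X i) y - k x y - (X i - x) \<bullet> D x y) / norm (X i - x) * \<bar>\<phi> y\<bar>) \<longlonglongrightarrow> 0"
            by (rule tendsto_mult_left_zero)
          then show "(\<lambda>i. Q i y) \<longlonglongrightarrow> 0"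
            by (rule Lim_null_comparison[rotated]) (simp add: Q_def abs_mult)
        qed
        \<comment> \<open>One \<open>W\<close> comes from the Lipschitz bound on the increment, the
          other from the linear term.\<close>
        show "AE y in M. norm (Q i y) \<le> 2 * \<bar>W y * \<phi> y\<bar>" for i
        proof (rule AE_I2)
          fix y assume y: "y \<in> space M"
          have n: "0 < norm (X i - x)" using XS by simp
          have "\<bar>(X i - x) \<bullet> D x y\<bar> \<le> norm (X i - x) * norm (D x y)" by (rule Cauchy_Schwarz_ineq2)
          also have "\<dots> \<le> norm (X i - x) * W y" using bound[OF x y] by (intro mult_left_mono) auto
          finally have "\<bar>k (X i) y - k x y - (X i - x) \<bullet> D x y\<bar> \<le> 2 * W y * norm (X i - x)"
            using lip[OF XS(1) y, of i]
              abs_triangle_ineq4[of "k (X i) y - k x y" "(X i - x) \<bullet> D x y"]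
            by (simp only: mult.commute[of _ "W y"] mult.assoc mult_2 distrib_left)
          then have "\<bar>k (X i) y - k x y - (X i - x) \<bullet> D x y\<bar> / norm (X i - x) \<le> 2 * W y"
            using n by (simp add: divide_le_eq)
          then have "\<bar>k (X i) y - k x y - (X i - x) \<bullet> D x y\<bar> / norm (X i - x) * \<bar>\<phi> y\<bar> \<le> 2 * W y * \<bar>\<phi> y\<bar>"
            by (intro mult_right_mono) auto
          then show "norm (Q i y) \<le> 2 * \<bar>W y * \<phi> y\<bar>" using W0[OF y] by (simp add: Q_def abs_mult)
        qed
      qed
      then have "(\<lambda>i. \<bar>\<integral>y. Q i y \<partial>M\<bar>) \<longlonglongrightarrow> 0" by (simp add: tendsto_rabs_zero)
      then show "(\<lambda>i. norm (?u (X i) - ?u x - (X i - x) \<bullet> ?E) / norm (X i - x)) \<longlonglongrightarrow> 0"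
        unfolding intQ by simp
    qed
  qed
  then show ?thesis unfolding gderiv_def using at_within_open[OF x open_ball] by simp
qed

text \<open>A single \<open>q\<close>-integrable \<open>W\<close> dominates the kernel and its
  gradient near \<open>x\<close>, so Hoelder against \<open>\<phi>\<close> yields all the
  integrability that differentiation requires.\<close>

lemma grad_integral_operator:
  fixes k :: "'a::euclidean_space \<Rightarrow> 'b \<Rightarrow> real" and D :: "'a \<Rightarrow> 'b \<Rightarrow> 'a" and \<phi> W :: "'b \<Rightarrow> real"
  assumes q: "1 \<le> q" and \<delta>: "0 < \<delta>"
    and deriv: "\<And>z y. z \<in> ball x \<delta> \<Longrightarrow> y \<in> space M \<Longrightarrow> GDERIV (\<lambda>z. k z y) z :> D z y"
    and bound: "\<And>z y. z \<in> ball x \<delta> \<Longrightarrow> y \<in> space M \<Longrightarrow> norm (D z y) \<le> W y"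
    and bound_k: "\<And>z y. z \<in> ball x \<delta> \<Longrightarrow> y \<in> space M \<Longrightarrow> \<bar>k z y\<bar> \<le> W y"
    and meas[measurable]: "\<And>z. k z \<in> borel_measurable M" "D x \<in> borel_measurable M" "W \<in> borel_measurable M"
    and W: "integrable M (\<lambda>y. \<bar>W y\<bar> powr q)"
    and \<phi>: "\<phi> \<in> Lp_space (conjugate_exponent (ennreal q)) M"
  shows "grad (\<lambda>z. \<integral>y. k z y * \<phi> y \<partial>M) x \<bullet> l = (\<integral>y. (D x y \<bullet> l) * \<phi> y \<partial>M)"
proof -
  have [measurable]: "\<phi> \<in> borel_measurable M" using \<phi> by (simp add: Lp_space_def)
  have x: "x \<in> ball x \<delta>" using \<delta> by simp
  have iW: "integrable M (\<lambda>y. W y * \<phi> y)" by (rule Hoelder_integrable[OF q _ W \<phi>]) measurable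
  have W0: "\<bar>D x y \<bullet> l\<bar> \<le> W y * norm l" "norm (D x y) \<le> W y" "0 \<le> W y" if "y \<in> space M" for y
  proof -
    show "norm (D x y) \<le> W y" using bound[OF x that] .
    then show "\<bar>D x y \<bullet> l\<bar> \<le> W y * norm l"
      using Cauchy_Schwarz_ineq2[of "D x y" l] by (meson mult_right_mono norm_ge_zero order_trans)
    show "0 \<le> W y" using bound[OF x that] norm_ge_zero order_trans by blast
  qed
  have "GDERIV (\<lambda>z. \<integral>y. k z y * \<phi> y \<partial>M) x :> (\<integral>y. \<phi> y *\<^sub>R D x y \<partial>M)"
  proof (rule GDERIV_integral[OF \<delta> deriv bound])
    show "integrable M (\<lambda>y. k z y * \<phi> y)" if "z \<in> ball x \<delta>" for z
      by (rule Bochner_Integration.integrable_bound[OF integrable_abs[OF iW]])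
        (measurable, use bound_k[OF that] W0(3) in \<open>auto intro!: AE_I2 mult_right_mono simp: abs_mult\<close>)
  qed (use iW in auto)
  then have "grad (\<lambda>z. \<integral>y. k z y * \<phi> y \<partial>M) x \<bullet> l = (\<integral>y. \<phi> y *\<^sub>R D x y \<partial>M) \<bullet> l"
    by (simp add: grad_eqI)
  also have "\<dots> = (\<integral>y. (\<phi> y *\<^sub>R D x y) \<bullet> l \<partial>M)"
  proof (rule integral_inner_left[symmetric])
    show "integrable M (\<lambda>y. \<phi> y *\<^sub>R D x y)" if "l \<noteq> 0"
      by (rule Bochner_Integration.integrable_bound[OF integrable_abs[OF iW]])
        (measurable, use W0 in \<open>auto intro!: AE_I2 mult_left_mono simp: abs_mult mult.commute[of "W _"]\<close>)
  qed
  finally show ?thesis by (simp add: mult.commute)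
qed

text \<open>The gradient is kept as \<open>m\<close> times the kernel times a logarithmic gradient,
  the vector that will become a multiple of \<open>\<omega>\<close>. The numerator \<open>N\<close>
  is \<open>1 - (norm z)^2\<close> for the ball and the height for the half-space.\<close>

lemma GDERIV_poisson_kernel:
  fixes z p :: "'a::euclidean_space"
  assumes N: "GDERIV N z :> \<nu>" and zp: "z \<noteq> p" and pos: "N z \<noteq> 0"
  shows "GDERIV (\<lambda>z. c * (N z / (norm (z - p))\<^sup>2) ^ m) z :>
    (c * (real m * (N z / (norm (z - p))\<^sup>2) ^ m)) *\<^sub>R (\<nu> /\<^sub>R N z - (2 / (norm (z - p))\<^sup>2) *\<^sub>R (z - p))"
proof -
  define D where "D = (norm (z - p))\<^sup>2"
  have D0: "D \<noteq> 0" using zp by (simp add: D_def)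
  have "GDERIV (\<lambda>z. (norm (z - p))\<^sup>2) z :> 2 *\<^sub>R (z - p)"
    unfolding gderiv_def power2_norm_eq_inner by (auto intro!: derivative_eq_intros simp: inner_commute)
  then have "GDERIV (\<lambda>z. inverse ((norm (z - p))\<^sup>2)) z :> - (inverse D)\<^sup>2 *\<^sub>R (2 *\<^sub>R (z - p))"
    using D0 unfolding D_def by (rule GDERIV_inverse)
  then have Q: "GDERIV (\<lambda>z. N z * inverse ((norm (z - p))\<^sup>2)) z :>
      N z *\<^sub>R (- (inverse D)\<^sup>2 *\<^sub>R (2 *\<^sub>R (z - p))) + inverse D *\<^sub>R \<nu>"
    unfolding D_def by (rule GDERIV_mult[OF N])
  have "DERIV (\<lambda>s. c * s ^ m) s :> c * (real m * s ^ (m - 1))" for s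
    by (auto intro!: derivative_eq_intros)
  from GDERIV_DERIV_compose[OF Q this]
  have "GDERIV (\<lambda>z. c * (N z / (norm (z - p))\<^sup>2) ^ m) z :> (c * (real m * (N z / D) ^ (m - 1))) *\<^sub>R
      (N z *\<^sub>R (- (inverse D)\<^sup>2 *\<^sub>R (2 *\<^sub>R (z - p))) + inverse D *\<^sub>R \<nu>)"
    by (simp only: divide_inverse D_def)
  moreover have "N z *\<^sub>R (- (inverse D)\<^sup>2 *\<^sub>R (2 *\<^sub>R (z - p))) + inverse D *\<^sub>R \<nu> =
      (N z / D) *\<^sub>R (\<nu> /\<^sub>R N z - (2 / D) *\<^sub>R (z - p))"
    using pos by (simp add: scaleR_diff_right divide_inverse power2_eq_square mult_ac)
  \<comment> \<open>For \<open>m = 0\<close> the exponent \<open>m - 1\<close> is truncated, but the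
    factor \<open>real m\<close> makes both sides zero.\<close>
  moreover have "real m * (N z / D) ^ m = real m * (N z / D) ^ (m - 1) * (N z / D)"
    by (cases m) auto
  ultimately show ?thesis by (simp add: D_def mult.assoc)
qed

section \<open>The ball\<close>

lemma AE_unit_ball_measure_nonzero: "AE z in unit_ball_measure. z \<noteq> (0::'a::euclidean_space)"
  by (rule AE_uniform_measureI) (auto intro: eventually_mono[OF AE_lborel_singleton[of 0]])

lemma space_sphere_measure: "space (sphere_measure :: 'a::euclidean_space measure) = sphere 0 1"
  by (simp add: sphere_measure_def sphere_borel_measure_def space_restrict_space)

lemma borel_measurable_sphere_measure:
  assumes "f \<in> borel_measurable (borel :: 'a::euclidean_space measure)"
  shows "f \<in> borel_measurable sphere_measure"
proof -
  have "f \<in> borel_measurable (restrict_space borel (sphere 0 1))"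
    using assms by (rule measurable_restrict_space1)
  then have "f \<in> borel_measurable sphere_borel_measure"
    unfolding sphere_borel_measure_def by simp
  then show ?thesis unfolding sphere_measure_def by (rule measurable_completion)
qed

lemma nn_integral_sphere_measure:
  fixes f :: "'a::euclidean_space \<Rightarrow> ennreal"
  assumes [measurable]: "f \<in> borel_measurable borel"
  shows "(\<integral>\<^sup>+y. f y \<partial>sphere_measure) = (\<integral>\<^sup>+z. f (sgn z) \<partial>unit_ball_measure)"
proof -
  let ?U = "unit_ball_measure :: 'a measure"
  have m: "sgn \<in> restrict_space ?U (- {0}) \<rightarrow>\<^sub>M restrict_space borel (sphere (0::'a) 1)"
    by (rule measurable_restrict_space2)
      (auto simp: space_restrict_space norm_sgn intro!: measurable_restrict_space1)
  have "(\<integral>\<^sup>+y. f y \<partial>sphere_measure) = (\<integral>\<^sup>+z. f (sgn z) \<partial>restrict_space ?U (- {0}))"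
    unfolding sphere_measure_def nn_integral_completion sphere_borel_measure_def
    by (rule nn_integral_distr[OF m]) (simp add: measurable_restrict_space1)
  also have "\<dots> = (\<integral>\<^sup>+z. f (sgn z) * indicator (- {0}) z \<partial>?U)"
    by (rule nn_integral_restrict_space) simp
  also have "\<dots> = (\<integral>\<^sup>+z. f (sgn z) \<partial>?U)"
    by (rule nn_integral_cong_AE, rule eventually_mono[OF AE_unit_ball_measure_nonzero]) simp
  finally show ?thesis .
qed

lemma prob_space_sphere_measure: "prob_space (sphere_measure :: 'a::euclidean_space measure)"
proof
  interpret prob_space "unit_ball_measure :: 'a measure" by (rule prob_space_unit_ball_measure)
  show "emeasure sphere_measure (space (sphere_measure :: 'a measure)) = 1"
    using nn_integral_sphere_measure[of "\<lambda>_::'a. 1"] emeasure_space_1 by simp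
qed

section \<open>The Moebius action of a boost on the sphere\<close>

context
  fixes e :: "'a::euclidean_space \<times> real" and \<gamma> \<sigma> :: real
  assumes e: "norm e = 1" and g: "\<bar>\<sigma>\<bar> < \<gamma>" "\<gamma>\<^sup>2 - \<sigma>\<^sup>2 = 1"
begin

text \<open>At \<open>z = 0\<close> the quotient is 0 by default and the factor is
  \<open>\<gamma>\<close>; positivity at every point is needed for the star body formula.\<close>

lemma boost_factor_pos: "0 < \<gamma> - \<sigma> * (z \<bullet> e / norm z)"
proof -
  have "\<bar>z \<bullet> e\<bar> \<le> norm z" using Cauchy_Schwarz_ineq2[of z e] e by simp
  then have "\<bar>z \<bullet> e / norm z\<bar> \<le> 1" by (simp add: divide_le_eq)
  then have "\<bar>\<sigma> * (z \<bullet> e / norm z)\<bar> \<le> \<bar>\<sigma>\<bar>" unfolding abs_mult by (intro mult_left_le) auto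
  then show ?thesis using g(1) by linarith
qed

text \<open>Boosts preserve the light cone, so the norm of the spatial part equals the boosted time
  component \<open>\<gamma> * norm z - \<sigma> * (z \<bullet> e)\<close>.\<close>

lemma norm_boost: "norm (boost e \<gamma> \<sigma> z) = norm z * (\<gamma> - \<sigma> * (z \<bullet> e / norm z))"
proof (rule power2_eq_imp_eq)
  have ee: "e \<bullet> e = 1" using e by (simp add: dot_square_norm)
  have zz: "z \<bullet> z = (norm z)\<^sup>2" by (simp add: dot_square_norm)
  have r: "norm z * (\<gamma> - \<sigma> * (z \<bullet> e / norm z)) = \<gamma> * norm z - \<sigma> * (z \<bullet> e)"
    by (cases "z = 0") (auto simp: field_simps)
  let ?c = "(\<gamma> - 1) * (z \<bullet> e) - \<sigma> * norm z"
  have "(norm (boost e \<gamma> \<sigma> z))\<^sup>2 = (norm z)\<^sup>2 + 2 * ?c * (z \<bullet> e) + ?c\<^sup>2"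
    unfolding power2_norm_eq_inner boost_def
    by (simp add: inner_simps ee zz inner_commute power2_eq_square algebra_simps)
  also have "\<dots> = (norm z)\<^sup>2 - (z \<bullet> e)\<^sup>2 + (\<gamma> * (z \<bullet> e) - \<sigma> * norm z)\<^sup>2"
    by (simp add: power2_eq_square algebra_simps)
  also have "\<dots> = (\<gamma> * norm z - \<sigma> * (z \<bullet> e))\<^sup>2 + (1 - (\<gamma>\<^sup>2 - \<sigma>\<^sup>2)) * ((norm z)\<^sup>2 - (z \<bullet> e)\<^sup>2)"
    by (simp add: power2_eq_square algebra_simps)
  finally show "(norm (boost e \<gamma> \<sigma> z))\<^sup>2 = (norm z * (\<gamma> - \<sigma> * (z \<bullet> e / norm z)))\<^sup>2"
    unfolding r g(2) by simp
qed (use boost_factor_pos[of z] in auto)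

lemma boost_scaleR: "0 < c \<Longrightarrow> boost e \<gamma> \<sigma> (c *\<^sub>R z) = c *\<^sub>R boost e \<gamma> \<sigma> z"
  by (simp add: boost_def algebra_simps)

text \<open>The boost pulls the ball back to a star body and has Jacobian equal to its factor.
  Returning to the ball costs the inverse factor to the full dimension, leaving the power
  \<open>DIM('a)\<close>, one less.\<close>

lemma nn_integral_sphere_boost:
  fixes H :: "'a \<times> real \<Rightarrow> ennreal"
  assumes [measurable]: "H \<in> borel_measurable borel"
  shows "(\<integral>\<^sup>+z. ennreal ((1 / (\<gamma> - \<sigma> * (z \<bullet> e / norm z))) ^ DIM('a)) * H (sgn (boost e \<gamma> \<sigma> z)) \<partial>unit_ball_measure) =
    (\<integral>\<^sup>+z. H (sgn z) \<partial>unit_ball_measure)"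
proof -
  let ?\<rho> = "\<lambda>z. \<gamma> - \<sigma> * (z \<bullet> e / norm z)"
  have sgnscale: "sgn (c *\<^sub>R z) = sgn z" if "0 < c" for c :: real and z :: "'a \<times> real"
    using that by (simp add: sgn_scaleR)
  have ball: "indicator (ball 0 1) = (indicator {z. norm z < 1} :: 'a \<times> real \<Rightarrow> ennreal)"
    by (auto simp: indicator_def fun_eq_iff)
  have "(\<integral>\<^sup>+z. indicator (ball 0 1) z * H (sgn z) \<partial>lborel) =
      (\<integral>\<^sup>+z. indicator (ball 0 1) (boost e \<gamma> \<sigma> z) * H (sgn (boost e \<gamma> \<sigma> z)) * ennreal (?\<rho> z) \<partial>lborel)"
    unfolding ball by (rule nn_integral_boost[OF _ _ g(2) e]) (measurable, use g(1) in linarith)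
  also have "\<dots> = (\<integral>\<^sup>+z. indicator {z. norm z * ?\<rho> z < 1} z * (H (sgn (boost e \<gamma> \<sigma> z)) * ennreal (?\<rho> z)) \<partial>lborel)"
    unfolding ball by (simp add: norm_boost indicator_def mult.assoc)
  also have "\<dots> = (\<integral>\<^sup>+z. indicator (ball 0 1) z * (H (sgn (boost e \<gamma> \<sigma> z)) * ennreal (?\<rho> z)) *
      ennreal ((1 / ?\<rho> z) ^ DIM('a \<times> real)) \<partial>lborel)"
    by (rule nn_integral_star_body) (simp_all add: boost_scaleR sgnscale boost_factor_pos[simplified])
  also have "\<dots> = (\<integral>\<^sup>+z. indicator (ball 0 1) z * (ennreal ((1 / ?\<rho> z) ^ DIM('a)) * H (sgn (boost e \<gamma> \<sigma> z))) \<partial>lborel)"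
  proof (rule nn_integral_cong)
    fix z
    have p: "0 < ?\<rho> z" by (rule boost_factor_pos)
    then have pr: "ennreal (?\<rho> z) * ennreal ((1 / ?\<rho> z) ^ DIM('a \<times> real)) = ennreal ((1 / ?\<rho> z) ^ DIM('a))"
      by (subst ennreal_mult[symmetric]) auto
    show "indicator (ball 0 1) z * (H (sgn (boost e \<gamma> \<sigma> z)) * ennreal (?\<rho> z)) *
      ennreal ((1 / ?\<rho> z) ^ DIM('a \<times> real)) =
      indicator (ball 0 1) z * (ennreal ((1 / ?\<rho> z) ^ DIM('a)) * H (sgn (boost e \<gamma> \<sigma> z)))"
      unfolding pr[symmetric] by (simp only: mult_ac)
  qed
  finally show ?thesis by (simp add: nn_integral_unit_ball_measure)
qed

end

theorem C_ball_comparison: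
  fixes x l t v :: "'a::euclidean_space \<times> real"
  assumes x: "x \<noteq> 0" "norm x < 1" and q: "1 \<le> q"
    and a: "real DIM('a) * (q - 1) = 0 \<or> 1 \<le> real DIM('a) * (q - 1)"
    and l: "norm l = 1" and t: "norm t = 1" "t \<bullet> (x /\<^sub>R norm x) = 0"
    and v: "v \<in> {x /\<^sub>R norm x, - (x /\<^sub>R norm x)}"
  shows "C_ball_dir (ennreal q) x t \<le> C_ball_dir (ennreal q) x l"
    and "C_ball_dir (ennreal q) x l \<le> C_ball_dir (ennreal q) x v"
    and "C_ball_dir (ennreal q) x v = C_ball (ennreal q) x"
proof -
  define r e where "r = norm x" and "e = x /\<^sub>R norm x"
  \<comment> \<open>Dictated by \<open>1 / P y = \<gamma> - \<sigma> * (y \<bullet> e)\<close>,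
    which is \<open>(norm (x - y))^2\<close> expanded for unit \<open>y\<close>; the rapidity is
    \<open>2 * artanh r\<close>.\<close>
  define \<gamma> \<sigma> where "\<gamma> = (1 + r\<^sup>2) / (1 - r\<^sup>2)" and "\<sigma> = 2 * r / (1 - r\<^sup>2)"
  define P where "P y = (1 - (norm x)\<^sup>2) / (norm (x - y))\<^sup>2" for y
  \<comment> \<open>Up to the factor \<open>2 / (1 - r^2)\<close> this is the logarithmic gradient
    of the Poisson kernel at \<open>x\<close>.\<close>
  define \<omega> where "\<omega> y = P y *\<^sub>R (y - x) - x" for y
  let ?m = "DIM('a)" and ?M = "sphere_measure :: ('a \<times> real) measure"
  have r: "0 < r" "r < 1" using x by (auto simp: r_def)
  then have r2: "0 < 1 - r\<^sup>2" by (simp add: power_less_one_iff)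
  have e: "norm e = 1" "x = r *\<^sub>R e" using x by (auto simp: e_def r_def)
  have ee: "e \<bullet> e = 1" using e by (simp add: dot_square_norm)
  have "0 < (1 - r)\<^sup>2 / (1 - r\<^sup>2)" using r r2 by simp
  then have g1: "\<bar>\<sigma>\<bar> < \<gamma>" using r r2
    by (simp add: \<gamma>_def \<sigma>_def divide_strict_right_mono power2_eq_square algebra_simps zero_less_divide_iff)
  have g2: "\<gamma>\<^sup>2 - \<sigma>\<^sup>2 = 1"
  proof -
    have "(1 + r\<^sup>2)\<^sup>2 - (2 * r)\<^sup>2 = (1 - r\<^sup>2)\<^sup>2" by (simp add: power2_eq_square algebra_simps)
    then show ?thesis using r2 by (simp add: \<gamma>_def \<sigma>_def power_divide flip: diff_divide_distrib)
  qed
  have Pinv: "1 / P y = \<gamma> - \<sigma> * (y \<bullet> e)" "0 < P y" if "norm y = 1" for y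
  proof -
    have "(norm (x - y))\<^sup>2 = 1 + r\<^sup>2 - 2 * r * (y \<bullet> e)"
    proof -
      have "x \<bullet> x = r\<^sup>2" "y \<bullet> y = 1" using that by (simp_all add: dot_square_norm r_def)
      moreover have "x \<bullet> y = r * (y \<bullet> e)" "y \<bullet> x = r * (y \<bullet> e)" by (simp_all add: e(2) inner_commute)
      ultimately show ?thesis unfolding power2_norm_eq_inner inner_diff_left inner_diff_right by simp
    qed
    then show "1 / P y = \<gamma> - \<sigma> * (y \<bullet> e)"
      by (simp add: P_def r_def[symmetric] \<gamma>_def \<sigma>_def flip: diff_divide_distrib)
    have "x \<noteq> y" using that x by auto
    then show "0 < P y" using r2 by (simp add: P_def r_def[symmetric])
  qed
  have boost_eq: "boost e \<gamma> \<sigma> y = (1 / P y) *\<^sub>R \<omega> y" if "norm y = 1" for y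
  proof -
    have "(1 / P y) *\<^sub>R \<omega> y = y - x - (1 / P y) *\<^sub>R x"
      using Pinv(2)[OF that] by (simp add: \<omega>_def scaleR_diff_right)
    also have "\<dots> = y - (r * (1 + (\<gamma> - \<sigma> * (y \<bullet> e)))) *\<^sub>R e"
      unfolding Pinv(1)[OF that] by (simp add: e(2) algebra_simps)
    also have "r * (1 + (\<gamma> - \<sigma> * (y \<bullet> e))) = \<sigma> - (\<gamma> - 1) * (y \<bullet> e)"
    proof -
      have "(1 - r\<^sup>2) * \<gamma> = 1 + r\<^sup>2" "(1 - r\<^sup>2) * \<sigma> = 2 * r" using r2 by (auto simp: \<gamma>_def \<sigma>_def)
      then have "(1 - r\<^sup>2) * (r * (1 + (\<gamma> - \<sigma> * (y \<bullet> e)))) = (1 - r\<^sup>2) * (\<sigma> - (\<gamma> - 1) * (y \<bullet> e))" by algebra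
      then show ?thesis using r2 by simp
    qed
    finally show ?thesis using that by (simp add: boost_def algebra_simps)
  qed
  have \<omega>_eq: "\<omega> y = sgn (boost e \<gamma> \<sigma> y)" if "norm y = 1" for y
  proof -
    have "norm (boost e \<gamma> \<sigma> y) = 1 / P y"
      using norm_boost[OF e(1) g1 g2, of y] Pinv(1)[OF that] that by simp
    then show ?thesis using boost_eq[OF that] Pinv(2)[OF that] by (simp add: sgn_div_norm)
  qed
  have meas: "P \<in> borel_measurable borel" "\<omega> \<in> borel_measurable borel"
    unfolding P_def \<omega>_def by measurable
  note [measurable] = meas meas[THEN borel_measurable_sphere_measure]
  have K: "conformal_kernel \<gamma> \<sigma> q (1 + (2 * \<gamma>) powr (real ?m * (q - 1))) ?m ?M P \<omega> e 1 1"
  proof (intro conformal_kernel.intro conformal_kernel_axioms.intro)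
    show "even_increasing (boundary_weight \<gamma> \<sigma> (real ?m * (q - 1))) q (1 + (2 * \<gamma>) powr (real ?m * (q - 1)))"
      by (rule even_increasing_boundary_weight) (use g1 a q in auto)
    show "0 < P y" if "y \<in> space ?M" for y using that Pinv by (simp add: space_sphere_measure)
    \<comment> \<open>The boost has factor \<open>1 / P y\<close> at \<open>y\<close>, and the
      inverse boost, with \<open>- \<sigma>\<close>, has factor
      \<open>\<gamma> + \<sigma> * (\<omega> y \<bullet> e)\<close> at \<open>\<omega> y\<close>;
      the two are reciprocal.\<close>
    show "P y = 1 * (\<gamma> + \<sigma> * (\<omega> y \<bullet> e))" if "y \<in> space ?M" for y
    proof -
      have y: "norm y = 1" using that by (simp add: space_sphere_measure)
      have "(1 / P y) * (\<omega> y \<bullet> e) = boost e \<gamma> \<sigma> y \<bullet> e" unfolding boost_eq[OF y] by simp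
      also have "\<dots> = \<gamma> * (y \<bullet> e) - \<sigma>" using y ee by (simp add: boost_def inner_simps algebra_simps)
      finally have w: "(1 / P y) * (\<omega> y \<bullet> e) = \<gamma> * (y \<bullet> e) - \<sigma>" .
      have "(1 / P y) * (\<gamma> + \<sigma> * (\<omega> y \<bullet> e)) = \<gamma> * (1 / P y) + \<sigma> * (\<gamma> * (y \<bullet> e) - \<sigma>)"
        unfolding w[symmetric] by (simp add: distrib_left)
      also have "\<dots> = \<gamma>\<^sup>2 - \<sigma>\<^sup>2" unfolding Pinv(1)[OF y] by (simp add: power2_eq_square algebra_simps)
      finally show ?thesis using g2 Pinv(2)[OF y] by (simp add: field_simps)
    qed
    show "(\<integral>\<^sup>+y. ennreal (P y ^ ?m) * H (\<omega> y) \<partial>?M) = ennreal 1 * (\<integral>\<^sup>+z. H (sgn z) \<partial>unit_ball_measure)"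
      if [measurable]: "H \<in> borel_measurable borel" for H
    proof -
      have "(\<integral>\<^sup>+y. ennreal (P y ^ ?m) * H (\<omega> y) \<partial>?M) =
          (\<integral>\<^sup>+z. ennreal (P (sgn z) ^ ?m) * H (\<omega> (sgn z)) \<partial>unit_ball_measure)"
        by (rule nn_integral_sphere_measure) measurable
      also have "\<dots> = (\<integral>\<^sup>+z. ennreal ((1 / (\<gamma> - \<sigma> * (z \<bullet> e / norm z))) ^ ?m) * H (sgn (boost e \<gamma> \<sigma> z)) \<partial>unit_ball_measure)"
      proof (rule nn_integral_cong_AE, rule eventually_mono[OF AE_unit_ball_measure_nonzero])
        fix z :: "'a \<times> real" assume "z \<noteq> 0"
        then have n: "norm (sgn z) = 1" by (simp add: norm_sgn)
        have s: "sgn z = (1 / norm z) *\<^sub>R z" by (simp add: sgn_div_norm inverse_eq_divide)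
        have "P (sgn z) = 1 / (\<gamma> - \<sigma> * (z \<bullet> e / norm z))"
        proof -
          have "P (sgn z) = 1 / (1 / P (sgn z))" by simp
          also have "\<dots> = 1 / (\<gamma> - \<sigma> * (sgn z \<bullet> e))" unfolding Pinv(1)[OF n] ..
          finally show ?thesis by (simp add: s)
        qed
        moreover have "\<omega> (sgn z) = sgn (boost e \<gamma> \<sigma> z)"
        proof -
          have "boost e \<gamma> \<sigma> (sgn z) = (1 / norm z) *\<^sub>R boost e \<gamma> \<sigma> z"
            unfolding s using \<open>z \<noteq> 0\<close> by (intro boost_scaleR[OF e(1) g1 g2]) simp
          then show ?thesis using \<open>z \<noteq> 0\<close> unfolding \<omega>_eq[OF n] by (simp add: sgn_scaleR)
        qed
        ultimately show "ennreal (P (sgn z) ^ ?m) * H (\<omega> (sgn z)) =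
            ennreal ((1 / (\<gamma> - \<sigma> * (z \<bullet> e / norm z))) ^ ?m) * H (sgn (boost e \<gamma> \<sigma> z))" by simp
      qed
      also have "\<dots> = (\<integral>\<^sup>+z. H (sgn z) \<partial>unit_ball_measure)"
        by (rule nn_integral_sphere_boost[OF e(1) g1 g2]) measurable
      finally show ?thesis by simp
    qed
  qed (use q e in auto)
  interpret S: prob_space ?M by (rule prob_space_sphere_measure)
  define \<kappa> where "\<kappa> = 2 * real ?m / (1 - r\<^sup>2)"
  have grad: "grad (poisson_ball \<phi>) x \<bullet> l = (\<integral>y. (((\<kappa> * P y ^ ?m) *\<^sub>R \<omega> y) \<bullet> l) * \<phi> y \<partial>?M)"
    if \<phi>: "\<phi> \<in> Lp_space (conjugate_exponent (ennreal q)) ?M" for \<phi> l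
  proof -
    \<comment> \<open>Half the distance from \<open>x\<close> to the sphere: near \<open>x\<close>
      both \<open>norm (z - y)\<close> and \<open>1 - (norm z)^2\<close> are at least
      \<open>\<delta>\<close>.\<close>
    define \<delta> where "\<delta> = (1 - r) / 2"
    have \<delta>: "0 < \<delta>" using r by (simp add: \<delta>_def)
    define k where "k z y = 1 * ((1 - (norm z)\<^sup>2) / (norm (z - y))\<^sup>2) ^ ?m" for z y :: "'a \<times> real"
    define D where "D z y = (1 * (real ?m * ((1 - (norm z)\<^sup>2) / (norm (z - y))\<^sup>2) ^ ?m)) *\<^sub>R
      ((- 2 *\<^sub>R z) /\<^sub>R (1 - (norm z)\<^sup>2) - (2 / (norm (z - y))\<^sup>2) *\<^sub>R (z - y))" for z y :: "'a \<times> real"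
    \<comment> \<open>A constant is enough on a probability space. The kernel is at most
      \<open>(1 / \<delta>^2) ^ m\<close>, and the logarithmic gradient at most
      \<open>2 / \<delta> + 2 / \<delta>\<close>.\<close>
    define W where "W = (1 / \<delta>\<^sup>2) ^ ?m * (1 + real ?m * (4 / \<delta>))"
    have est: "\<delta> \<le> norm (z - y)" "\<delta> \<le> 1 - (norm z)\<^sup>2" "1 - (norm z)\<^sup>2 \<le> 1" "norm z \<le> 1"
      if "z \<in> ball x \<delta>" "y \<in> space ?M" for z y
    proof -
      have y: "norm y = 1" using that by (simp add: space_sphere_measure)
      have "norm z \<le> norm x + norm (z - x)" by (rule norm_triangle_sub)
      then have z: "norm z \<le> 1 - \<delta>" using that by (simp add: dist_norm norm_minus_commute \<delta>_def r_def field_simps)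
      then show "norm z \<le> 1" using \<delta> by simp
      have "norm y \<le> norm z + norm (y - z)" by (rule norm_triangle_sub)
      then show "\<delta> \<le> norm (z - y)" using y z by (simp add: norm_minus_commute)
      have "(norm z)\<^sup>2 \<le> norm z * 1" unfolding power2_eq_square using z \<delta> by (intro mult_left_mono) auto
      then show "\<delta> \<le> 1 - (norm z)\<^sup>2" using z by simp
    qed auto
    have Pest: "0 \<le> ((1 - (norm z)\<^sup>2) / (norm (z - y))\<^sup>2) ^ ?m" "((1 - (norm z)\<^sup>2) / (norm (z - y))\<^sup>2) ^ ?m \<le> (1 / \<delta>\<^sup>2) ^ ?m"
      if "z \<in> ball x \<delta>" "y \<in> space ?M" for z y
    proof -
      have "0 \<le> (1 - (norm z)\<^sup>2) / (norm (z - y))\<^sup>2" using est[OF that] \<delta> by simp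
      moreover have "(1 - (norm z)\<^sup>2) / (norm (z - y))\<^sup>2 \<le> 1 / \<delta>\<^sup>2"
        using est[OF that] \<delta> by (intro frac_le power_mono) auto
      ultimately show "0 \<le> ((1 - (norm z)\<^sup>2) / (norm (z - y))\<^sup>2) ^ ?m" "((1 - (norm z)\<^sup>2) / (norm (z - y))\<^sup>2) ^ ?m \<le> (1 / \<delta>\<^sup>2) ^ ?m"
        by (auto intro: power_mono)
    qed
    have "grad (\<lambda>z. \<integral>y. k z y * \<phi> y \<partial>?M) x \<bullet> l = (\<integral>y. (D x y \<bullet> l) * \<phi> y \<partial>?M)"
    proof (rule grad_integral_operator[OF q \<delta>, where W = "\<lambda>_. W"])
      fix z y assume zy: "z \<in> ball x \<delta>" "y \<in> space ?M"
      note est = est[OF zy] and Pest = Pest[OF zy]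
      have G: "GDERIV (\<lambda>z. 1 - (norm z)\<^sup>2) z :> - 2 *\<^sub>R z"
        unfolding gderiv_def power2_norm_eq_inner by (auto intro!: derivative_eq_intros simp: inner_commute)
      show "GDERIV (\<lambda>z. k z y) z :> D z y"
        unfolding k_def D_def by (rule GDERIV_poisson_kernel[OF G]) (use est \<delta> in auto)
      show "\<bar>k z y\<bar> \<le> W"
      proof -
        have "\<bar>k z y\<bar> \<le> (1 / \<delta>\<^sup>2) ^ ?m * 1" using Pest by (simp add: k_def)
        also have "\<dots> \<le> W" unfolding W_def using \<delta> by (intro mult_left_mono) auto
        finally show ?thesis .
      qed
      have n1: "norm ((2 / (norm (z - y))\<^sup>2) *\<^sub>R (z - y)) = 2 / norm (z - y)"
        by (cases "z = y") (auto simp: power2_eq_square)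
      have n2: "norm ((- 2 *\<^sub>R z) /\<^sub>R (1 - (norm z)\<^sup>2)) = 2 * norm z / (1 - (norm z)\<^sup>2)"
        using est \<delta> by (simp add: divide_inverse)
      have "norm ((- 2 *\<^sub>R z) /\<^sub>R (1 - (norm z)\<^sup>2) - (2 / (norm (z - y))\<^sup>2) *\<^sub>R (z - y)) \<le>
          2 * norm z / (1 - (norm z)\<^sup>2) + 2 / norm (z - y)"
        unfolding n1[symmetric] n2[symmetric] by (rule norm_triangle_ineq4)
      also have "\<dots> \<le> 2 / \<delta> + 2 / \<delta>" using est \<delta> by (intro add_mono frac_le) auto
      finally have n: "norm ((- 2 *\<^sub>R z) /\<^sub>R (1 - (norm z)\<^sup>2) - (2 / (norm (z - y))\<^sup>2) *\<^sub>R (z - y)) \<le> 4 / \<delta>" by simp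
      have "norm (D z y) = real ?m * ((1 - (norm z)\<^sup>2) / (norm (z - y))\<^sup>2) ^ ?m *
          norm ((- 2 *\<^sub>R z) /\<^sub>R (1 - (norm z)\<^sup>2) - (2 / (norm (z - y))\<^sup>2) *\<^sub>R (z - y))"
        unfolding D_def norm_scaleR using Pest by simp
      also have "\<dots> \<le> real ?m * (1 / \<delta>\<^sup>2) ^ ?m * (4 / \<delta>)"
        using n Pest \<delta> by (intro mult_mono mult_left_mono) auto
      also have "\<dots> \<le> W" unfolding W_def using \<delta> by (simp add: algebra_simps)
      finally show "norm (D z y) \<le> W" .
    next
      show "k z \<in> borel_measurable ?M" for z
        unfolding k_def by (rule borel_measurable_sphere_measure) measurable
      show "D x \<in> borel_measurable ?M"
        unfolding D_def by (rule borel_measurable_sphere_measure) measurable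
    qed (use \<phi> in auto)
    also have "(\<lambda>z. \<integral>y. k z y * \<phi> y \<partial>?M) = poisson_ball \<phi>"
      by (simp add: k_def poisson_ball_def fun_eq_iff)
    also have "(\<integral>y. (D x y \<bullet> l) * \<phi> y \<partial>?M) = (\<integral>y. (((\<kappa> * P y ^ ?m) *\<^sub>R \<omega> y) \<bullet> l) * \<phi> y \<partial>?M)"
    proof (rule Bochner_Integration.integral_cong[OF refl])
      fix y
      have "(2 / (1 - r\<^sup>2)) *\<^sub>R \<omega> y = (- 2 *\<^sub>R x) /\<^sub>R (1 - (norm x)\<^sup>2) - (2 / (norm (x - y))\<^sup>2) *\<^sub>R (x - y)"
      proof -
        have "(2 / b) * (b / d) = 2 / d" if "b \<noteq> 0" for b d :: real using that by simp
        then have c: "(2 / (1 - r\<^sup>2)) * P y = 2 / (norm (x - y))\<^sup>2"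
          using r2 unfolding P_def r_def[symmetric] by (metis less_irrefl)
        have "(2 / (1 - r\<^sup>2)) *\<^sub>R \<omega> y = ((2 / (1 - r\<^sup>2)) * P y) *\<^sub>R (y - x) - (2 / (1 - r\<^sup>2)) *\<^sub>R x"
          by (simp add: \<omega>_def scaleR_diff_right)
        then show ?thesis unfolding c r_def[symmetric] by (simp add: scaleR_diff_right divide_inverse mult.commute)
      qed
      then have "D x y = (real ?m * P y ^ ?m) *\<^sub>R ((2 / (1 - r\<^sup>2)) *\<^sub>R \<omega> y)"
        unfolding D_def P_def by simp
      also have "\<dots> = (\<kappa> * P y ^ ?m) *\<^sub>R \<omega> y" by (simp add: \<kappa>_def mult_ac)
      finally show "(D x y \<bullet> l) * \<phi> y = (((\<kappa> * P y ^ ?m) *\<^sub>R \<omega> y) \<bullet> l) * \<phi> y" by simp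
    qed
    finally show ?thesis .
  qed
  have A: "space ?M \<in> sets ?M" "emeasure ?M (space ?M) \<noteq> 0" "emeasure ?M (space ?M) \<noteq> top"
    using S.emeasure_space_1 by auto
  have te: "t \<bullet> e = 0" and ve: "v \<in> {e, - e}" using t v by (auto simp: e_def)
  note cmp = conformal_kernel.sharp_const_comparison[OF K A grad l t(1) te ve]
  show "C_ball_dir (ennreal q) x t \<le> C_ball_dir (ennreal q) x l"
    "C_ball_dir (ennreal q) x l \<le> C_ball_dir (ennreal q) x v"
    "C_ball_dir (ennreal q) x v = C_ball (ennreal q) x"
    unfolding C_ball_dir_def C_ball_def by (rule cmp; assumption)+
qed

section \<open>The half-space\<close>

lemma abs_snd_le_norm: "\<bar>snd z\<bar> \<le> norm z" for z :: "'a::real_normed_vector \<times> real"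
  using norm_snd_le[of "snd z" "fst z"] by simp

text \<open>Substituting \<open>y = fst x + snd x * w\<close> reduces to the base point
  \<open>(0, 1)\<close>, where the vector is the stereographic image of \<open>w\<close>. The
  dimension times the ball volume is the unnormalized sphere area, and \<open>1 / 2\<close> compares
  \<open>1 / ((norm w)^2 + 1)\<close> with the stereographic density.\<close>

lemma nn_integral_half_space_kernel:
  fixes x :: "'a::euclidean_space \<times> real" and H :: "'a \<times> real \<Rightarrow> ennreal"
  assumes x: "0 < snd x" and [measurable]: "H \<in> borel_measurable borel"
  shows "(\<integral>\<^sup>+y. ennreal ((snd x / (norm (x - (y, 0)))\<^sup>2) ^ DIM('a)) *
      H ((0, 1) - (2 * snd x / (norm (x - (y, 0)))\<^sup>2) *\<^sub>R (x - (y, 0))) \<partial>lborel) =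
    ennreal ((1 / 2) ^ DIM('a) * real DIM('a \<times> real) * measure lborel (ball (0 :: 'a \<times> real) 1)) *
    (\<integral>\<^sup>+z. H (sgn z) \<partial>unit_ball_measure)"
proof -
  let ?m = "DIM('a)" and ?s = "snd x"
  let ?S = "\<lambda>w::'a. (w, ((norm w)\<^sup>2 - 1) / 2)" and ?V = "emeasure lborel (ball (0 :: 'a \<times> real) 1)"
  have "(\<integral>\<^sup>+y. ennreal ((?s / (norm (x - (y, 0)))\<^sup>2) ^ ?m) *
      H ((0, 1) - (2 * ?s / (norm (x - (y, 0)))\<^sup>2) *\<^sub>R (x - (y, 0))) \<partial>lborel) =
    ennreal (\<bar>?s\<bar> ^ ?m) * (\<integral>\<^sup>+w. ennreal ((?s / (norm (x - (fst x + ?s *\<^sub>R w, 0)))\<^sup>2) ^ ?m) *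
      H ((0, 1) - (2 * ?s / (norm (x - (fst x + ?s *\<^sub>R w, 0)))\<^sup>2) *\<^sub>R (x - (fst x + ?s *\<^sub>R w, 0))) \<partial>lborel)"
    by (rule nn_integral_lborel_scale) (measurable, use x in simp)
  also have "\<dots> = (\<integral>\<^sup>+w. ennreal ((1 / 2) ^ ?m) * (H (sgn (?S w)) * ennreal ((2 / ((norm w)\<^sup>2 + 1)) ^ ?m)) \<partial>lborel)"
  proof (subst nn_integral_cmult[symmetric], measurable, rule nn_integral_cong)
    fix w :: 'a
    define \<mu> where "\<mu> = (norm w)\<^sup>2 + 1"
    have \<mu>: "0 < \<mu>" by (simp add: \<mu>_def add_nonneg_pos)
    have x': "x - (fst x + ?s *\<^sub>R w, 0) = ?s *\<^sub>R (- w, 1)" by (simp add: prod_eq_iff)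
    have D: "(norm (?s *\<^sub>R (- w, 1 :: real)))\<^sup>2 = ?s\<^sup>2 * \<mu>"
      unfolding norm_scaleR by (simp add: norm_Pair \<mu>_def power_mult_distrib)
    have "(norm (?S w))\<^sup>2 = (\<mu> / 2)\<^sup>2"
      by (simp add: norm_Pair \<mu>_def power2_eq_square field_simps)
    then have "norm (?S w) = \<mu> / 2" by (rule power2_eq_imp_eq) (use \<mu> in auto)
    then have S: "sgn (?S w) = (2 / \<mu>) *\<^sub>R ?S w"
      by (simp only: sgn_div_norm) (simp add: inverse_eq_divide del: scaleR_Pair)
    have 1: "?s ^ ?m * (?s / (?s\<^sup>2 * \<mu>)) ^ ?m = (1 / 2) ^ ?m * (2 / \<mu>) ^ ?m"
      using x unfolding power_mult_distrib[symmetric] by (simp add: power2_eq_square)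
    have 2: "(0, 1) - (2 * ?s / (?s\<^sup>2 * \<mu>)) *\<^sub>R (?s *\<^sub>R (- w, 1)) = sgn (?S w)"
    proof -
      have k: "2 * ?s / (?s\<^sup>2 * \<mu>) * ?s = 2 / \<mu>" using x by (simp add: power2_eq_square)
      have nw: "(norm w)\<^sup>2 = \<mu> - 1" by (simp add: \<mu>_def)
      have "1 - 2 / \<mu> = 2 / \<mu> * (((norm w)\<^sup>2 - 1) / 2)" unfolding nw using \<mu> by (simp add: field_simps)
      then show ?thesis unfolding S scaleR_scaleR k by simp
    qed
    have 3: "ennreal (\<bar>?s\<bar> ^ ?m) * ennreal ((?s / (?s\<^sup>2 * \<mu>)) ^ ?m) = ennreal ((1 / 2) ^ ?m) * ennreal ((2 / \<mu>) ^ ?m)"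
      using x \<mu> 1 by (simp flip: ennreal_mult)
    show "ennreal (\<bar>?s\<bar> ^ ?m) * (ennreal ((?s / (norm (x - (fst x + ?s *\<^sub>R w, 0)))\<^sup>2) ^ ?m) *
        H ((0, 1) - (2 * ?s / (norm (x - (fst x + ?s *\<^sub>R w, 0)))\<^sup>2) *\<^sub>R (x - (fst x + ?s *\<^sub>R w, 0)))) =
        ennreal ((1 / 2) ^ ?m) * (H (sgn (?S w)) * ennreal ((2 / ((norm w)\<^sup>2 + 1)) ^ ?m))"
      unfolding x' D 2 \<mu>_def[symmetric] mult.assoc[symmetric] 3 by (simp only: mult_ac)
  qed
  also have "\<dots> = ennreal ((1 / 2) ^ ?m) * (\<integral>\<^sup>+w. H (sgn (?S w)) * ennreal ((2 / ((norm w)\<^sup>2 + 1)) ^ ?m) \<partial>lborel)"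
    by (rule nn_integral_cmult) measurable
  also have "(\<integral>\<^sup>+w. H (sgn (?S w)) * ennreal ((2 / ((norm w)\<^sup>2 + 1)) ^ ?m) \<partial>lborel) =
      ennreal (real DIM('a \<times> real)) * (\<integral>\<^sup>+z. indicator (ball 0 1) z * H (sgn z) \<partial>lborel)"
  proof -
    have "ennreal (real DIM('a \<times> real)) * ennreal (1 / DIM('a \<times> real)) = 1" by (subst ennreal_mult[symmetric]) auto
    then show ?thesis
      by (subst nn_integral_stereographic) (auto simp: sgn_scaleR simp flip: mult.assoc)
  qed
  also have "(\<integral>\<^sup>+z. indicator (ball 0 1) z * H (sgn z) \<partial>lborel) = ?V * (\<integral>\<^sup>+z. H (sgn z) \<partial>unit_ball_measure)"
    using emeasure_unit_ball[where 'a = "'a \<times> real"]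
    by (subst nn_integral_unit_ball_measure) (auto simp: ennreal_mult_divide_eq ennreal_times_divide mult.commute[of ?V])
  also have "ennreal ((1 / 2) ^ ?m) * (ennreal (real DIM('a \<times> real)) * (?V * (\<integral>\<^sup>+z. H (sgn z) \<partial>unit_ball_measure))) =
      ennreal ((1 / 2) ^ ?m * real DIM('a \<times> real) * measure lborel (ball (0 :: 'a \<times> real) 1)) *
      (\<integral>\<^sup>+z. H (sgn z) \<partial>unit_ball_measure)"
  proof -
    have "?V = ennreal (measure lborel (ball (0 :: 'a \<times> real) 1))"
      using emeasure_unit_ball[where 'a = "'a \<times> real"] by (simp add: emeasure_eq_ennreal_measure)
    then show ?thesis by (simp add: ennreal_mult mult.assoc)
  qed
  finally show ?thesis .
qed

theorem C_half_space_comparison: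
  fixes x l t v :: "'a::euclidean_space \<times> real"
  assumes x: "x \<in> half_space" and q: "1 \<le> q"
    and a: "real DIM('a) * (q - 1) = 0 \<or> 1 \<le> real DIM('a) * (q - 1)"
    and l: "norm l = 1" and t: "norm t = 1" "t \<bullet> (0, 1) = 0" and v: "v \<in> {(0, 1), - (0, 1)}"
  shows "C_half_space_dir (ennreal q) x t \<le> C_half_space_dir (ennreal q) x l"
    and "C_half_space_dir (ennreal q) x l \<le> C_half_space_dir (ennreal q) x v"
    and "C_half_space_dir (ennreal q) x v = C_half_space (ennreal q) x"
proof -
  define s where "s = snd x"
  have s: "0 < s" using x by (simp add: s_def half_space_def)
  define P where "P y = s / (norm (x - (y, 0)))\<^sup>2" for y
  define \<omega> where "\<omega> y = (0, 1) - (2 * s / (norm (x - (y, 0)))\<^sup>2) *\<^sub>R (x - (y, 0))" for y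
  let ?m = "DIM('a)" and ?M = "lebesgue :: 'a measure"
  let ?C = "(1 / 2) ^ ?m * real DIM('a \<times> real) * measure lborel (ball (0 :: 'a \<times> real) 1)"
  have xy: "s \<le> norm (x - (y, 0))" for y :: 'a
    using abs_snd_le_norm[of "x - (y, 0)"] s by (simp add: s_def)
  have meas: "P \<in> borel_measurable borel" "\<omega> \<in> borel_measurable borel"
    unfolding P_def \<omega>_def by measurable
  have leb: "f \<in> borel_measurable ?M" if "f \<in> borel_measurable borel" for f :: "'a \<Rightarrow> 'c::topological_space"
    using that by (intro measurable_completion) simp
  note [measurable] = meas meas[THEN leb]
  \<comment> \<open>The last coordinate of \<open>\<omega> y\<close> is
    \<open>1 - 2 * s * P y\<close>, which fixes the constants. They satisfy
    \<open>\<bar>\<sigma>\<bar> = \<gamma>\<close>, the degenerate limit of a boost: the weight base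
    vanishes at the pole, the image of infinity.\<close>
  have K: "conformal_kernel 1 (- 1) q (1 + (2 * 1) powr (real ?m * (q - 1))) ?m ?M P \<omega> (0, 1) (1 / (2 * s)) ?C"
  proof (intro conformal_kernel.intro conformal_kernel_axioms.intro)
    show "even_increasing (boundary_weight 1 (- 1) (real ?m * (q - 1))) q (1 + (2 * 1) powr (real ?m * (q - 1)))"
      by (rule even_increasing_boundary_weight) (use a q in auto)
    show "0 < P y" if "y \<in> space ?M" for y
    proof -
      have "0 < norm (x - (y, 0))" using xy[of y] s by linarith
      then show ?thesis using s unfolding P_def by (intro divide_pos_pos) auto
    qed
    show "P y = 1 / (2 * s) * (1 + - 1 * (\<omega> y \<bullet> (0, 1)))" if "y \<in> space ?M" for y
    proof -
      have "x \<bullet> (0, 1) = s" by (simp add: inner_prod_def s_def)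
      then show ?thesis using s by (simp add: P_def \<omega>_def inner_simps)
    qed
    show "(\<integral>\<^sup>+y. ennreal (P y ^ ?m) * H (\<omega> y) \<partial>?M) = ennreal ?C * (\<integral>\<^sup>+z. H (sgn z) \<partial>unit_ball_measure)"
      if "H \<in> borel_measurable borel" for H
      unfolding nn_integral_completion P_def \<omega>_def s_def
      using s that by (intro nn_integral_half_space_kernel) (auto simp: s_def)
  qed (use q s in \<open>auto simp: norm_Pair\<close>)
  define c where "c = poisson_const DIM('a \<times> real)"
  define \<kappa> where "\<kappa> = c * real ?m / s"
  have grad: "grad (poisson_half_space \<phi>) x \<bullet> l = (\<integral>y. (((\<kappa> * P y ^ ?m) *\<^sub>R \<omega> y) \<bullet> l) * \<phi> y \<partial>?M)"
    if \<phi>: "\<phi> \<in> Lp_space (conjugate_exponent (ennreal q)) ?M" for \<phi> l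
  proof -
    define \<delta> where "\<delta> = s / 2"
    have \<delta>: "0 < \<delta>" using s by (simp add: \<delta>_def)
    define k where "k z y = c * (snd z / (norm (z - (y, 0)))\<^sup>2) ^ ?m" for z :: "'a \<times> real" and y :: 'a
    define D where "D z y = (c * (real ?m * (snd z / (norm (z - (y, 0)))\<^sup>2) ^ ?m)) *\<^sub>R
      ((0, 1) /\<^sub>R snd z - (2 / (norm (z - (y, 0)))\<^sup>2) *\<^sub>R (z - (y, 0)))" for z :: "'a \<times> real" and y :: 'a
    \<comment> \<open>A multiple of \<open>P y ^ m\<close> keeps the bound
      \<open>q\<close>-integrable. The 6 is 3/2 from \<open>snd z \<le> 3 * \<delta>\<close> times 4
      from \<open>norm (x - (y, 0)) \<le> 2 * norm (z - (y, 0))\<close>; \<open>3 / \<delta>\<close>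
      bounds the logarithmic gradient.\<close>
    define W where "W y = (\<bar>c\<bar> * 6 ^ ?m * (1 + real ?m * (3 / \<delta>))) * P y ^ ?m" for y
    have est: "\<delta> \<le> norm (z - (y, 0))" "\<delta> \<le> snd z" "snd z \<le> 3 * \<delta>" "norm (x - (y, 0)) \<le> 2 * norm (z - (y, 0))"
      if "z \<in> ball x \<delta>" for z and y :: 'a
    proof -
      have d: "norm (x - z) < \<delta>" using that by (simp add: dist_norm)
      have "\<bar>s - snd z\<bar> \<le> norm (x - z)" using abs_snd_le_norm[of "x - z"] by (simp add: s_def)
      then show 1: "\<delta> \<le> snd z" "snd z \<le> 3 * \<delta>" using d by (auto simp: \<delta>_def)
      show 2: "\<delta> \<le> norm (z - (y, 0))" using abs_snd_le_norm[of "z - (y, 0)"] 1 by simp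
      have "norm (x - (y, 0)) \<le> norm (x - z) + norm (z - (y, 0))"
        using norm_triangle_ineq[of "x - z" "z - (y, 0)"] by (simp only: diff_add_cancel add_diff_eq)
      then show "norm (x - (y, 0)) \<le> 2 * norm (z - (y, 0))" using d 2 by simp
    qed
    have Pest: "0 \<le> (snd z / (norm (z - (y, 0)))\<^sup>2) ^ ?m" "(snd z / (norm (z - (y, 0)))\<^sup>2) ^ ?m \<le> 6 ^ ?m * P y ^ ?m"
      if "z \<in> ball x \<delta>" for z y
    proof -
      note est = est(1)[OF that, of y] est(2,3)[OF that] est(4)[OF that, of y]
      have nn: "0 \<le> snd z / (norm (z - (y, 0)))\<^sup>2" using est \<delta> by simp
      have xp: "0 < norm (x - (y, 0))" using xy[of y] s by linarith
      have "(norm (x - (y, 0)))\<^sup>2 \<le> (2 * norm (z - (y, 0)))\<^sup>2" using est(4) by (intro power_mono) auto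
      then have "(norm (x - (y, 0)))\<^sup>2 / 4 \<le> (norm (z - (y, 0)))\<^sup>2" by (simp add: power_mult_distrib)
      then have "snd z / (norm (z - (y, 0)))\<^sup>2 \<le> (3 * \<delta>) / ((norm (x - (y, 0)))\<^sup>2 / 4)"
        using est \<delta> xp by (intro frac_le) auto
      also have "\<dots> = 6 * P y" by (simp add: P_def \<delta>_def)
      finally have "(snd z / (norm (z - (y, 0)))\<^sup>2) ^ ?m \<le> (6 * P y) ^ ?m" using nn by (intro power_mono)
      then show "(snd z / (norm (z - (y, 0)))\<^sup>2) ^ ?m \<le> 6 ^ ?m * P y ^ ?m" by (simp only: power_mult_distrib)
      show "0 \<le> (snd z / (norm (z - (y, 0)))\<^sup>2) ^ ?m" using nn by (rule zero_le_power)
    qed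
    have P0: "0 \<le> P y ^ ?m" for y using s by (simp add: P_def)
    have "grad (\<lambda>z. \<integral>y. k z y * \<phi> y \<partial>?M) x \<bullet> l = (\<integral>y. (D x y \<bullet> l) * \<phi> y \<partial>?M)"
    proof (rule grad_integral_operator[OF q \<delta>, where W = W])
      fix z y assume z: "z \<in> ball x \<delta>"
      note est = est(1)[OF z, of y] est(2,3)[OF z] est(4)[OF z, of y] and Pest = Pest[OF z, of y]
      have G: "GDERIV snd z :> (0, 1)"
        unfolding gderiv_def by (auto intro!: derivative_eq_intros simp: inner_prod_def)
      show "GDERIV (\<lambda>z. k z y) z :> D z y"
        unfolding k_def D_def by (rule GDERIV_poisson_kernel[OF G]) (use est \<delta> in auto)
      show "\<bar>k z y\<bar> \<le> W y"
      proof -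
        have "\<bar>k z y\<bar> \<le> \<bar>c\<bar> * (6 ^ ?m * P y ^ ?m) * 1"
          unfolding k_def abs_mult using Pest by (simp add: mult_left_mono)
        also have "\<dots> \<le> \<bar>c\<bar> * (6 ^ ?m * P y ^ ?m) * (1 + real ?m * (3 / \<delta>))"
          using \<delta> P0 by (intro mult_left_mono) auto
        finally show ?thesis by (simp only: W_def mult_ac)
      qed
      have n1: "norm ((2 / (norm (z - (y, 0)))\<^sup>2) *\<^sub>R (z - (y, 0))) = 2 / norm (z - (y, 0))"
        by (cases "z = (y, 0)") (auto simp: power2_eq_square)
      have n2: "norm ((0, 1) /\<^sub>R snd z :: 'a \<times> real) = 1 / snd z"
        using est \<delta> by (simp add: norm_Pair divide_inverse)
      have "norm ((0, 1) /\<^sub>R snd z - (2 / (norm (z - (y, 0)))\<^sup>2) *\<^sub>R (z - (y, 0))) \<le>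
          1 / snd z + 2 / norm (z - (y, 0))"
        unfolding n1[symmetric] n2[symmetric] by (rule norm_triangle_ineq4)
      also have "\<dots> \<le> 1 / \<delta> + 2 / \<delta>" using est \<delta> by (intro add_mono frac_le) auto
      finally have n: "norm ((0, 1) /\<^sub>R snd z - (2 / (norm (z - (y, 0)))\<^sup>2) *\<^sub>R (z - (y, 0))) \<le> 3 / \<delta>" by simp
      have "norm (D z y) = \<bar>c\<bar> * (real ?m * (snd z / (norm (z - (y, 0)))\<^sup>2) ^ ?m) *
          norm ((0, 1) /\<^sub>R snd z - (2 / (norm (z - (y, 0)))\<^sup>2) *\<^sub>R (z - (y, 0)))"
        unfolding D_def norm_scaleR abs_mult using Pest by simp
      also have "\<dots> \<le> \<bar>c\<bar> * (real ?m * (6 ^ ?m * P y ^ ?m)) * (3 / \<delta>)"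
        using n Pest \<delta> by (intro mult_mono mult_left_mono) auto
      also have "\<dots> = \<bar>c\<bar> * (6 ^ ?m * P y ^ ?m) * (real ?m * (3 / \<delta>))" by (simp only: mult_ac)
      also have "\<dots> \<le> \<bar>c\<bar> * (6 ^ ?m * P y ^ ?m) * (1 + real ?m * (3 / \<delta>))"
        using \<delta> P0 by (intro mult_left_mono) auto
      also have "\<dots> = W y" by (simp only: W_def mult_ac)
      finally show "norm (D z y) \<le> W y" .
    next
      show "k z \<in> borel_measurable ?M" for z
        unfolding k_def by (rule leb) measurable
      show "D x \<in> borel_measurable ?M"
        unfolding D_def by (rule leb) measurable
      show "W \<in> borel_measurable ?M" unfolding W_def by measurable
      have "\<bar>W y\<bar> powr q = \<bar>\<bar>c\<bar> * 6 ^ ?m * (1 + real ?m * (3 / \<delta>))\<bar> powr q * \<bar>P y ^ ?m\<bar> powr q" for y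
        unfolding W_def abs_mult by (simp only: powr_mult abs_ge_zero mult_nonneg_nonneg)
      then show "integrable ?M (\<lambda>y. \<bar>W y\<bar> powr q)"
        using conformal_kernel.integrable_power[OF K] by simp
    qed (use \<phi> in auto)
    also have "(\<lambda>z. \<integral>y. k z y * \<phi> y \<partial>?M) = poisson_half_space \<phi>"
    proof
      fix z :: "'a \<times> real"
      have "(norm (z - (y, 0)))\<^sup>2 = (norm (fst z - y))\<^sup>2 + (snd z)\<^sup>2" for y
        by (simp add: norm_prod_def)
      then show "(\<integral>y. k z y * \<phi> y \<partial>?M) = poisson_half_space \<phi> z"
        by (simp add: k_def poisson_half_space_def c_def mult.assoc)
    qed
    also have "(\<integral>y. (D x y \<bullet> l) * \<phi> y \<partial>?M) = (\<integral>y. (((\<kappa> * P y ^ ?m) *\<^sub>R \<omega> y) \<bullet> l) * \<phi> y \<partial>?M)"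
    proof (rule Bochner_Integration.integral_cong[OF refl])
      fix y
      have "(1 / s) *\<^sub>R \<omega> y = (0, 1) /\<^sub>R s - (2 / (norm (x - (y, 0)))\<^sup>2) *\<^sub>R (x - (y, 0))"
      proof -
        have c: "1 / s * (2 * s / (norm (x - (y, 0)))\<^sup>2) = 2 / (norm (x - (y, 0)))\<^sup>2" using s by simp
        show ?thesis unfolding \<omega>_def scaleR_diff_right scaleR_scaleR c by (simp add: divide_inverse)
      qed
      then have "D x y = (c * (real ?m * P y ^ ?m)) *\<^sub>R ((1 / s) *\<^sub>R \<omega> y)"
        unfolding D_def P_def s_def[symmetric] by simp
      also have "\<dots> = (\<kappa> * P y ^ ?m) *\<^sub>R \<omega> y" by (simp add: \<kappa>_def mult_ac)
      finally show "(D x y \<bullet> l) * \<phi> y = (((\<kappa> * P y ^ ?m) *\<^sub>R \<omega> y) \<bullet> l) * \<phi> y" by simp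
    qed
    finally show ?thesis .
  qed
  have A: "ball 0 1 \<in> sets ?M" "emeasure ?M (ball 0 1) \<noteq> 0" "emeasure ?M (ball 0 1) \<noteq> top"
    using emeasure_unit_ball[where 'a = 'a] by auto
  note cmp = conformal_kernel.sharp_const_comparison[OF K A grad l t v]
  show "C_half_space_dir (ennreal q) x t \<le> C_half_space_dir (ennreal q) x l"
    "C_half_space_dir (ennreal q) x l \<le> C_half_space_dir (ennreal q) x v"
    "C_half_space_dir (ennreal q) x v = C_half_space (ennreal q) x"
    unfolding C_half_space_dir_def C_half_space_def by (rule cmp; assumption)+
qed

theorem theorem1p2:
  fixes n K\<^sub>0 :: nat and q :: real
  assumes dim: "n = DIM((real ^ 'm) \<times> real)"
    and n: "3 \<le> n"
    and q: "q \<in> {(2 * real K\<^sub>0 - 1) / (real n - 1) + 1 .. 2 * real K\<^sub>0 / (real n - 1) + 1} \<inter> {1..}"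
  shows
    "(\<forall>x \<in> ball (0 :: (real ^ 'm) \<times> real) 1 - {0}. \<forall>l \<in> sphere 0 1. \<forall>t \<in> sphere 0 1.
        t \<bullet> (x /\<^sub>R norm x) = 0 \<longrightarrow>
        C_ball_dir (ennreal q) x t \<le> C_ball_dir (ennreal q) x l \<and>
        (\<forall>v \<in> {x /\<^sub>R norm x, - (x /\<^sub>R norm x)}.
           C_ball_dir (ennreal q) x l \<le> C_ball_dir (ennreal q) x v \<and>
           C_ball_dir (ennreal q) x v = C_ball (ennreal q) x)) \<and>
     (\<forall>x \<in> (half_space :: ((real ^ 'm) \<times> real) set). \<forall>l \<in> sphere 0 1. \<forall>t \<in> sphere 0 1.
        t \<bullet> (0, 1) = 0 \<longrightarrow>
        C_half_space_dir (ennreal q) x t \<le> C_half_space_dir (ennreal q) x l \<and>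
        (\<forall>v \<in> {(0, 1), - (0, 1)}.
           C_half_space_dir (ennreal q) x l \<le> C_half_space_dir (ennreal q) x v \<and>
           C_half_space_dir (ennreal q) x v = C_half_space (ennreal q) x))"
proof -
  let ?m = "DIM(real ^ 'm)"
  have m: "real n - 1 = real ?m" "0 < real ?m" by (simp_all add: dim)
  define a where "a = real ?m * (q - 1)"
  have q1: "1 \<le> q" using q by simp
  have "2 * real K\<^sub>0 - 1 \<le> a" "a \<le> 2 * real K\<^sub>0" "0 \<le> a"
    using q m by (auto simp: a_def field_simps)
  \<comment> \<open>If \<open>K\<^sub>0 = 0\<close> the upper end of the interval forces
    \<open>a = 0\<close>; otherwise the lower end gives \<open>a \<ge> 1\<close>.\<close>
  then have a: "real ?m * (q - 1) = 0 \<or> 1 \<le> real ?m * (q - 1)"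
    unfolding a_def[symmetric] by (cases "K\<^sub>0 = 0") auto
  show ?thesis
  proof (rule conjI; intro ballI impI)
    fix x l t :: "(real ^ 'm) \<times> real"
    assume x: "x \<in> ball 0 1 - {0}" and lt: "l \<in> sphere 0 1" "t \<in> sphere 0 1" and tx: "t \<bullet> (x /\<^sub>R norm x) = 0"
    have "x \<noteq> 0" "norm x < 1" "norm l = 1" "norm t = 1" using x lt by auto
    note cmp = C_ball_comparison[OF this(1,2) q1 a this(3,4) tx]
    show "C_ball_dir (ennreal q) x t \<le> C_ball_dir (ennreal q) x l \<and>
        (\<forall>v \<in> {x /\<^sub>R norm x, - (x /\<^sub>R norm x)}.
           C_ball_dir (ennreal q) x l \<le> C_ball_dir (ennreal q) x v \<and>
           C_ball_dir (ennreal q) x v = C_ball (ennreal q) x)"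
      \<comment> \<open>The first comparison does not mention \<open>v\<close>, so the positive
        choice of sign is supplied to discharge its premise.\<close>
      using cmp(1)[OF insertI1] cmp(2,3) by blast
  next
    fix x l t :: "(real ^ 'm) \<times> real"
    assume x: "x \<in> half_space" and lt: "l \<in> sphere 0 1" "t \<in> sphere 0 1" and te: "t \<bullet> (0, 1) = 0"
    have "norm l = 1" "norm t = 1" using lt by auto
    note cmp = C_half_space_comparison[OF x q1 a this te]
    show "C_half_space_dir (ennreal q) x t \<le> C_half_space_dir (ennreal q) x l \<and>
        (\<forall>v \<in> {(0, 1), - (0, 1)}.
           C_half_space_dir (ennreal q) x l \<le> C_half_space_dir (ennreal q) x v \<and>
           C_half_space_dir (ennreal q) x v = C_half_space (ennreal q) x)"
      using cmp(1)[OF insertI1] cmp(2,3) by blast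
  qed
qed

end
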